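(* If $G$ is a compact Lie group endowed with a bi-invariant metric, then $L(\Omega,G)/G$ is a classifying space for the topological group $G$ inside the category of paracompact spaces.
   Context: The bi-invariant metric $d$ of $G$ defines its topology. $\Omega$ denotes an uncountable standard Borel space endowed with a non-atomic probability measure; integration against it is written $dt$. $L(\Omega,G)$ is the set of Borel maps $\Omega\to G$ modulo almost-everywhere equality, with the metric $d(f_1,f_2)=\int_\Omega d(f_1(t),f_2(t))\,dt$. $G$ acts on it by $(g.f)(t)=g f(t)$, and $L(\Omega,G)/G$ is the quotient space, with metric $d(\bar f_1,\bar f_2)=\inf_{g\in G}d(g.f_1,f_2)$. A classifying space for $G$ in the category of paracompact spaces is a paracompact space $B$ carrying a locally trivial principal $G$-bundle $E\to B$ which is universal: for every paracompact space $X$, pulling back $E$ induces a bijection from the set of homotopy classes of maps $X\to B$ to the set of isomorphism classes of locally trivial principal $G$-bundles over $X$. *)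

theory Defs
  imports "HOL-Probability.Probability" "HOL-Algebra.Group"
begin

section \<open>Lie groups\<close>

definition topological_group :: "('g, 'm) monoid_scheme \<Rightarrow> 'g topology \<Rightarrow> bool" where
  "topological_group G T \<longleftrightarrow>
     group G \<and> topspace T = carrier G \<and>
     continuous_map (prod_topology T T) T (\<lambda>(x, y). x \<otimes>\<^bsub>G\<^esub> y) \<and>
     continuous_map T T (\<lambda>x. inv\<^bsub>G\<^esub> x)"

text \<open>
  Manifolds are modelled on \<^const>\<open>Euclidean_space\<close> \<open>n\<close>, the space of real sequences vanishing from
  index \<open>n\<close> on, and not on a type of class \<^class>\<open>euclidean_space\<close>: the latter has
  positive dimension, which would exclude the zero-dimensional Lie groups, i.e. the finite groups
  among the compact ones.
\<close>

definition partial_deriv :: "nat \<Rightarrow> ((nat \<Rightarrow> real) \<Rightarrow> real) \<Rightarrow> (nat \<Rightarrow> real) \<Rightarrow> real" where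
  "partial_deriv i f x = deriv (\<lambda>t. f (x(i := t))) (x i)"

text \<open>Meant for \<open>U\<close> open in \<^const>\<open>Euclidean_space\<close> \<open>n\<close>.\<close>

primrec Ck_on :: "nat \<Rightarrow> nat \<Rightarrow> (nat \<Rightarrow> real) set \<Rightarrow> ((nat \<Rightarrow> real) \<Rightarrow> real) \<Rightarrow> bool" where
  "Ck_on 0 n U f \<longleftrightarrow> continuous_map (subtopology (Euclidean_space n) U) euclideanreal f"
| "Ck_on (Suc k) n U f \<longleftrightarrow>
     continuous_map (subtopology (Euclidean_space n) U) euclideanreal f \<and>
     (\<forall>i<n. (\<forall>x\<in>U. (\<lambda>t. f (x(i := t))) field_differentiable at (x i)) \<and>
            Ck_on k n U (partial_deriv i f))"

definition smooth_on :: "nat \<Rightarrow> (nat \<Rightarrow> real) set \<Rightarrow> ((nat \<Rightarrow> real) \<Rightarrow> real) \<Rightarrow> bool" where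
  "smooth_on n U f \<longleftrightarrow> (\<forall>k. Ck_on k n U f)"

type_synonym 'a chart = "'a set \<times> ('a \<Rightarrow> nat \<Rightarrow> real)"

definition is_chart :: "nat \<Rightarrow> 'a topology \<Rightarrow> 'a chart \<Rightarrow> bool" where
  "is_chart n T = (\<lambda>(U, \<phi>).
     openin T U \<and> openin (Euclidean_space n) (\<phi> ` U) \<and>
     homeomorphic_map (subtopology T U) (subtopology (Euclidean_space n) (\<phi> ` U)) \<phi>)"

text \<open>The coordinate expression of \<open>F\<close> in the charts \<open>(U, \<phi>)\<close> and \<open>(V, \<psi>)\<close> is smooth.\<close>

definition smooth_in_charts ::
    "nat \<Rightarrow> nat \<Rightarrow> ('a \<Rightarrow> 'b) \<Rightarrow> 'a chart \<Rightarrow> 'b chart \<Rightarrow> bool" where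
  "smooth_in_charts n m F = (\<lambda>(U, \<phi>) (V, \<psi>).
     \<forall>j<m. smooth_on n (\<phi> ` {x \<in> U. F x \<in> V}) (\<lambda>y. \<psi> (F (inv_into U \<phi> y)) j))"

definition smooth_manifold :: "nat \<Rightarrow> 'a topology \<Rightarrow> 'a chart set \<Rightarrow> bool" where
  "smooth_manifold n T A \<longleftrightarrow>
     Hausdorff_space T \<and> second_countable T \<and>
     (\<forall>c\<in>A. is_chart n T c) \<and> (\<Union>c\<in>A. fst c) = topspace T \<and>
     (\<forall>c\<in>A. \<forall>c'\<in>A. smooth_in_charts n n (\<lambda>x. x) c c')"

definition smooth_map ::
    "nat \<Rightarrow> 'a topology \<Rightarrow> 'a chart set \<Rightarrow> nat \<Rightarrow> 'b topology \<Rightarrow> 'b chart set \<Rightarrow> ('a \<Rightarrow> 'b) \<Rightarrow> bool" where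
  "smooth_map n T A m S B F \<longleftrightarrow>
     continuous_map T S F \<and> (\<forall>c\<in>A. \<forall>c'\<in>B. smooth_in_charts n m F c c')"

text \<open>The product atlas, with values in \<^const>\<open>Euclidean_space\<close> \<open>(n + m)\<close>.\<close>

definition prod_atlas :: "nat \<Rightarrow> 'a chart set \<Rightarrow> 'b chart set \<Rightarrow> ('a \<times> 'b) chart set" where
  "prod_atlas n A B =
     {(U \<times> V, \<lambda>(x, y) i. if i < n then \<phi> x i else \<psi> y (i - n)) | U \<phi> V \<psi>. (U, \<phi>) \<in> A \<and> (V, \<psi>) \<in> B}"

definition Lie_group :: "('g, 'm) monoid_scheme \<Rightarrow> 'g topology \<Rightarrow> bool" where
  "Lie_group G T \<longleftrightarrow> topological_group G T \<and>
     (\<exists>n A. smooth_manifold n T A \<and>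
        smooth_map (n + n) (prod_topology T T) (prod_atlas n A A) n T A (\<lambda>(x, y). x \<otimes>\<^bsub>G\<^esub> y) \<and>
        smooth_map n T A n T A (\<lambda>x. inv\<^bsub>G\<^esub> x))"

definition bi_invariant :: "('g, 'm) monoid_scheme \<Rightarrow> ('g \<Rightarrow> 'g \<Rightarrow> real) \<Rightarrow> bool" where
  "bi_invariant G d \<longleftrightarrow>
     (\<forall>g\<in>carrier G. \<forall>x\<in>carrier G. \<forall>y\<in>carrier G.
        d (g \<otimes>\<^bsub>G\<^esub> x) (g \<otimes>\<^bsub>G\<^esub> y) = d x y \<and> d (x \<otimes>\<^bsub>G\<^esub> g) (y \<otimes>\<^bsub>G\<^esub> g) = d x y)"

section \<open>Standard Borel probability spaces\<close>

definition borel_of :: "'a topology \<Rightarrow> 'a measure" where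
  "borel_of T = sigma (topspace T) {U. openin T U}"

definition standard_borel :: "'a measure \<Rightarrow> bool" where
  "standard_borel M \<longleftrightarrow>
     (\<exists>T. completely_metrizable_space T \<and> second_countable T \<and>
          topspace T = space M \<and> sets (borel_of T) = sets M)"

definition nonatomic :: "'a measure \<Rightarrow> bool" where
  "nonatomic M \<longleftrightarrow>
     (\<forall>A\<in>sets M. emeasure M A > 0 \<longrightarrow>
        (\<exists>B\<in>sets M. B \<subseteq> A \<and> 0 < emeasure M B \<and> emeasure M B < emeasure M A))"

section \<open>The space of random elements of a group and its quotient\<close>

definition ae_rel :: "'w measure \<Rightarrow> 'g topology \<Rightarrow> (('w \<Rightarrow> 'g) \<times> ('w \<Rightarrow> 'g)) set" where
  "ae_rel M T = {(f, f'). f \<in> M \<rightarrow>\<^sub>M borel_of T \<and> f' \<in> M \<rightarrow>\<^sub>M borel_of T \<and> (AE t in M. f t = f' t)}"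

definition L_space :: "'w measure \<Rightarrow> 'g topology \<Rightarrow> ('w \<Rightarrow> 'g) set set" where
  "L_space M T = (M \<rightarrow>\<^sub>M borel_of T) // ae_rel M T"

text \<open>
  The value \<open>0\<close> outside the carriers, here and in \<open>LG_dist\<close> below, is there because the locale
  \<^locale>\<open>Metric_space\<close> requires symmetry and nonnegativity on the whole type.
\<close>

definition L_dist ::
    "'w measure \<Rightarrow> 'g topology \<Rightarrow> ('g \<Rightarrow> 'g \<Rightarrow> real) \<Rightarrow> ('w \<Rightarrow> 'g) set \<Rightarrow> ('w \<Rightarrow> 'g) set \<Rightarrow> real" where
  "L_dist M T d c1 c2 =
     (if c1 \<in> L_space M T \<and> c2 \<in> L_space M T
      then the_elem (\<Union>f1\<in>c1. \<Union>f2\<in>c2. {\<integral>t. d (f1 t) (f2 t) \<partial>M}) else 0)"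

definition L_topology ::
    "'w measure \<Rightarrow> 'g topology \<Rightarrow> ('g \<Rightarrow> 'g \<Rightarrow> real) \<Rightarrow> ('w \<Rightarrow> 'g) set topology" where
  "L_topology M T d = Metric_space.mtopology (L_space M T) (L_dist M T d)"

definition L_act ::
    "('g, 'm) monoid_scheme \<Rightarrow> 'w measure \<Rightarrow> 'g topology \<Rightarrow> 'g \<Rightarrow> ('w \<Rightarrow> 'g) set \<Rightarrow> ('w \<Rightarrow> 'g) set" where
  "L_act G M T g c = (\<Union>f\<in>c. ae_rel M T `` {\<lambda>t. g \<otimes>\<^bsub>G\<^esub> f t})"

definition L_orbit ::
    "('g, 'm) monoid_scheme \<Rightarrow> 'w measure \<Rightarrow> 'g topology \<Rightarrow> ('w \<Rightarrow> 'g) set \<Rightarrow> ('w \<Rightarrow> 'g) set set" where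
  "L_orbit G M T c = (\<lambda>g. L_act G M T g c) ` carrier G"

definition LG_space ::
    "('g, 'm) monoid_scheme \<Rightarrow> 'w measure \<Rightarrow> 'g topology \<Rightarrow> ('w \<Rightarrow> 'g) set set set" where
  "LG_space G M T = L_orbit G M T ` L_space M T"

definition LG_dist ::
    "('g, 'm) monoid_scheme \<Rightarrow> 'w measure \<Rightarrow> 'g topology \<Rightarrow> ('g \<Rightarrow> 'g \<Rightarrow> real) \<Rightarrow>
     ('w \<Rightarrow> 'g) set set \<Rightarrow> ('w \<Rightarrow> 'g) set set \<Rightarrow> real" where
  "LG_dist G M T d o1 o2 =
     (if o1 \<in> LG_space G M T \<and> o2 \<in> LG_space G M T
      then the_elem (\<Union>c1\<in>o1. \<Union>c2\<in>o2. {INF g\<in>carrier G. L_dist M T d (L_act G M T g c1) c2})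
      else 0)"

definition LG_topology ::
    "('g, 'm) monoid_scheme \<Rightarrow> 'w measure \<Rightarrow> 'g topology \<Rightarrow> ('g \<Rightarrow> 'g \<Rightarrow> real) \<Rightarrow>
     ('w \<Rightarrow> 'g) set set topology" where
  "LG_topology G M T d = Metric_space.mtopology (LG_space G M T) (LG_dist G M T d)"

section \<open>Principal bundles and classifying spaces\<close>

text \<open>Bundles carry a left action, like \<open>L_act\<close>; a right action \<open>e \<cdot> g\<close> corresponds to
  the left action \<open>g\<inverse> \<cdot> e\<close>.\<close>

record ('g, 'e, 'x) gbundle =
  btotal :: "'e topology"
  bproj :: "'e \<Rightarrow> 'x"
  bact :: "'g \<Rightarrow> 'e \<Rightarrow> 'e"

definition principal_bundle ::
    "('g, 'm) monoid_scheme \<Rightarrow> 'g topology \<Rightarrow> 'x topology \<Rightarrow> ('g, 'e, 'x) gbundle \<Rightarrow> bool" where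
  "principal_bundle G T X P \<longleftrightarrow>
     continuous_map (btotal P) X (bproj P) \<and>
     continuous_map (prod_topology T (btotal P)) (btotal P) (\<lambda>(g, e). bact P g e) \<and>
     (\<forall>e\<in>topspace (btotal P). bact P \<one>\<^bsub>G\<^esub> e = e \<and>
        (\<forall>g\<in>carrier G. bproj P (bact P g e) = bproj P e \<and>
           (\<forall>h\<in>carrier G. bact P (h \<otimes>\<^bsub>G\<^esub> g) e = bact P h (bact P g e)))) \<and>
     (\<forall>x\<in>topspace X. \<exists>U \<phi>. openin X U \<and> x \<in> U \<and>
        homeomorphic_map (prod_topology (subtopology X U) T)
          (subtopology (btotal P) {e \<in> topspace (btotal P). bproj P e \<in> U}) \<phi> \<and>
        (\<forall>u\<in>U. \<forall>g\<in>carrier G. bproj P (\<phi> (u, g)) = u \<and>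
           (\<forall>h\<in>carrier G. \<phi> (u, h \<otimes>\<^bsub>G\<^esub> g) = bact P h (\<phi> (u, g)))))"

text \<open>Isomorphism of principal bundles over the same base.\<close>

definition bundle_iso ::
    "('g, 'm) monoid_scheme \<Rightarrow> ('g, 'e, 'x) gbundle \<Rightarrow> ('g, 'f, 'x) gbundle \<Rightarrow> bool" where
  "bundle_iso G P Q \<longleftrightarrow>
     (\<exists>\<phi>. homeomorphic_map (btotal P) (btotal Q) \<phi> \<and>
        (\<forall>e\<in>topspace (btotal P). bproj Q (\<phi> e) = bproj P e \<and>
           (\<forall>g\<in>carrier G. \<phi> (bact P g e) = bact Q g (\<phi> e))))"

definition pullback ::
    "'x topology \<Rightarrow> ('x \<Rightarrow> 'b) \<Rightarrow> ('g, 'e, 'b) gbundle \<Rightarrow> ('g, 'x \<times> 'e, 'x) gbundle" where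
  "pullback X f P =
     \<lparr> btotal = subtopology (prod_topology X (btotal P)) {(x, e). f x = bproj P e},
       bproj = fst,
       bact = (\<lambda>g (x, e). (x, bact P g e)) \<rparr>"

definition paracompact_space :: "'x topology \<Rightarrow> bool" where
  "paracompact_space X \<longleftrightarrow> Hausdorff_space X \<and>
     (\<forall>\<U>. (\<forall>U\<in>\<U>. openin X U) \<and> \<Union>\<U> = topspace X \<longrightarrow>
        (\<exists>\<V>. (\<forall>V\<in>\<V>. openin X V) \<and> \<Union>\<V> = topspace X \<and>
              (\<forall>V\<in>\<V>. \<exists>U\<in>\<U>. V \<subseteq> U) \<and> locally_finite_in X \<V>))"

text \<open>
  \<open>B\<close>, carrying the bundle \<open>E\<close>, is a classifying space in the category of paracompact spaces. The
  equivalence below says that pulling back \<open>E\<close> is well defined and injective from homotopy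
  classes of maps \<open>X \<rightarrow> B\<close> to isomorphism classes of bundles over \<open>X\<close>, the clause after it that this
  is surjective. As a formula cannot quantify over types, the types of \<open>X\<close> and of the total
  space of \<open>P\<close> are parameters. They are to be left as type variables, and the bundle \<open>E\<close> is
  an argument so that it cannot depend on them.
\<close>

definition classifying_space ::
    "'x itself \<Rightarrow> 'p itself \<Rightarrow> ('g, 'm) monoid_scheme \<Rightarrow> 'g topology \<Rightarrow>
     'b topology \<Rightarrow> ('g, 'e, 'b) gbundle \<Rightarrow> bool" where
  "classifying_space TX TP G T B E \<longleftrightarrow>
     paracompact_space B \<and> principal_bundle G T B E \<and>
     (\<forall>X :: 'x topology. paracompact_space X \<longrightarrow>
        (\<forall>f f'. continuous_map X B f \<and> continuous_map X B f' \<longrightarrow>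
           (homotopic_with (\<lambda>_. True) X B f f' \<longleftrightarrow>
            bundle_iso G (pullback X f E) (pullback X f' E))) \<and>
        (\<forall>P :: ('g, 'p, 'x) gbundle. principal_bundle G T X P \<longrightarrow>
           (\<exists>f. continuous_map X B f \<and> bundle_iso G P (pullback X f E))))"

definition LG_bundle ::
    "('g, 'm) monoid_scheme \<Rightarrow> 'w measure \<Rightarrow> 'g topology \<Rightarrow> ('g \<Rightarrow> 'g \<Rightarrow> real) \<Rightarrow>
     ('g, ('w \<Rightarrow> 'g) set, ('w \<Rightarrow> 'g) set set) gbundle" where
  "LG_bundle G M T d =
     \<lparr> btotal = L_topology M T d, bproj = L_orbit G M T, bact = L_act G M T \<rparr>"

end

theory Submission
  imports Defs
begin

text \<open>
  Cutting \<open>\<Omega>\<close> by a uniformly distributed function \<open>c\<close>, two random elements are joined by the path of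
  random elements equal to the first where \<open>c \<le> s\<close> and to the second elsewhere. This path depends
  continuously and equivariantly on its end points, so any two equivariant maps into \<open>L(\<Omega>, G)\<close> are
  equivariantly homotopic; and local trivialisations of a principal bundle over a paracompact space
  are glued to an equivariant map into \<open>L(\<Omega>, G)\<close> by letting each of them occupy a part of \<open>\<Omega>\<close> of measure
  given by a partition of unity. Conversely, a homotopy is lifted to an isomorphism of pullbacks by
  transporting along local lifts, for times that are again prescribed by the partition of unity.

  Only the local triviality of \<open>L(\<Omega>, G) \<rightarrow> L(\<Omega>, G)/G\<close> uses the Lie group structure. With
  a cut-off chart \<open>v\<close> of \<open>G\<close> at the identity, the equation \<open>\<integral> v(f\<^sub>0(t) f(t)\<^sup>-\<^sup>1 g) dt = 0\<close> has, for \<open>f\<close> close to \<open>f\<^sub>0\<close>, a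
  unique solution \<open>g\<close> near the identity, because its left-hand side is in the chart a contraction away from
  the identity map. Its solution depends equivariantly on \<open>f\<close>, which gives a slice.
\<close>

section \<open>Paracompact spaces\<close>

text \<open>Two obstacles shape the proof. A partition of unity on a paracompact space may have
  uncountably many indices, and the local operations attached to them (transport along lifts,
  filling of parts of \<Omega>) do not commute. They are therefore composed along one global order
  of the indices, by a machinery (\<open>run\<close>) that serves both uses. Secondly, the metric of
  \<open>L_space\<close> is an L1 distance: an \<open>f\<close> near \<open>f0\<close> may be far
  from it on a small part of \<Omega>, where no chart helps. So the cut-off chart \<open>v\<close>
  obeys a Lipschitz bound along small right translations at every point of \<open>G\<close>, and
  every pointwise estimate is affine in \<open>d\<close>. Such estimates can be integrated, and the
  bad part then costs at most a constant times the distance. Compactness of \<open>G\<close> enters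
  through bounds for \<open>d\<close> and \<open>v\<close>, and through infima over orbits that are
  attained.\<close>

lemma continuous_map_local:
  assumes "\<And>x. x \<in> topspace X \<Longrightarrow> \<exists>U. openin X U \<and> x \<in> U \<and> continuous_map (subtopology X U) Y f"
  shows "continuous_map X Y f"
proof -
  obtain N where N: "\<And>x. x \<in> topspace X \<Longrightarrow> openin X (N x) \<and> x \<in> N x \<and> continuous_map (subtopology X (N x)) Y f"
    using assms by metis
  show ?thesis
    by (rule pasting_lemma [where I = "topspace X" and T = N and f = "\<lambda>_. f"]) (use N in auto)
qed

section \<open>Separation and partitions of unity in paracompact spaces\<close>

lemma paracompact_space_refinement:
  assumes "paracompact_space X" "\<forall>U\<in>\<U>. openin X U" "\<Union>\<U> = topspace X"
  shows "\<exists>\<V>. (\<forall>V\<in>\<V>. openin X V) \<and> \<Union>\<V> = topspace X \<and>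
    (\<forall>V\<in>\<V>. \<exists>U\<in>\<U>. V \<subseteq> U) \<and> locally_finite_in X \<V>"
  by (rule assms(1) [unfolded paracompact_space_def, THEN conjunct2, THEN spec, THEN mp])
    (rule conjI assms(2,3))+

text \<open>The common step from Hausdorff to regular (\<open>S\<close> a point) and from regular to
  normal (\<open>S\<close> closed). Cover the space by the complement of \<open>C\<close> and by
  open sets whose closures miss \<open>S\<close>. In a locally finite refinement the closure of a
  union is the union of the closures, so the members that meet \<open>C\<close> have a union whose
  closure still misses \<open>S\<close>.\<close>

lemma paracompact_space_separation:
  assumes X: "paracompact_space X" and C: "closedin X C" and S: "S \<subseteq> topspace X"
    and sep: "\<And>c. c \<in> C \<Longrightarrow> \<exists>U V. openin X U \<and> openin X V \<and> c \<in> U \<and> S \<subseteq> V \<and> disjnt U V"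
  shows "\<exists>U V. openin X U \<and> openin X V \<and> C \<subseteq> U \<and> S \<subseteq> V \<and> disjnt U V"
proof -
  let ?A = "{U. openin X U \<and> disjnt S (X closure_of U)}"
  have "\<exists>U\<in>?A. c \<in> U" if "c \<in> C" for c
  proof -
    obtain U V where UV: "openin X U" "openin X V" "c \<in> U" "S \<subseteq> V" "disjnt U V" using sep [OF \<open>c \<in> C\<close>] by blast
    then have "disjnt V (X closure_of U)"
      by (metis disjnt_def disjnt_sym openin_Int_closure_of_eq_empty)
    then show ?thesis using UV by (auto simp: disjnt_def)
  qed
  then have "topspace X \<subseteq> \<Union>(insert (topspace X - C) ?A)" by blast
  moreover have "\<Union>(insert (topspace X - C) ?A) \<subseteq> topspace X" using openin_subset by blast
  ultimately have eq: "\<Union>(insert (topspace X - C) ?A) = topspace X" by (rule equalityI [rotated])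
  have "\<forall>U\<in>insert (topspace X - C) ?A. openin X U" using C by auto
  from paracompact_space_refinement [OF X this eq]
  obtain \<V> where V: "\<forall>V\<in>\<V>. openin X V" "\<Union>\<V> = topspace X"
      "\<forall>V\<in>\<V>. \<exists>U\<in>insert (topspace X - C) ?A. V \<subseteq> U" "locally_finite_in X \<V>"
    by (elim exE conjE) (rule that)
  \<comment> \<open>A member that meets \<open>C\<close> is not contained in the complement of
    \<open>C\<close>, hence lies in a set whose closure misses \<open>S\<close>.\<close>
  define \<W> where "\<W> = {V\<in>\<V>. V \<inter> C \<noteq> {}}"
  have lf: "locally_finite_in X \<W>" using V(4) by (rule locally_finite_in_subset) (auto simp: \<W>_def)
  have "disjnt S (X closure_of V)" if "V \<in> \<W>" for V
  proof -
    have "V \<in> \<V>" using that by (simp add: \<W>_def)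
    from bspec [OF V(3) this]
    obtain U where U: "U \<in> insert (topspace X - C) ?A" "V \<subseteq> U" by (rule bexE)
    have "V \<inter> C \<noteq> {}" using that unfolding \<W>_def by blast
    then have "U \<noteq> topspace X - C" using U(2) by blast
    then have "disjnt S (X closure_of U)" using U(1) by blast
    then show ?thesis using closure_of_mono [OF U(2), of X] unfolding disjnt_def by blast
  qed
  then have "disjnt S (X closure_of \<Union>\<W>)"
    unfolding closure_of_locally_finite_Union [OF lf] disjnt_def by blast
  moreover have "openin X (\<Union>\<W>)" using V(1) unfolding \<W>_def by blast
  moreover have "C \<subseteq> \<Union>\<W>"
  proof
    fix c assume "c \<in> C"
    then have "c \<in> \<Union>\<V>" using V(2) closedin_subset [OF C] by blast
    then show "c \<in> \<Union>\<W>" using \<open>c \<in> C\<close> unfolding \<W>_def by blast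
  qed
  moreover have "\<Union>\<W> \<subseteq> X closure_of \<Union>\<W>"
    by (intro closure_of_subset openin_subset) fact
  moreover have "openin X (topspace X - X closure_of \<Union>\<W>)"
    by (intro openin_diff openin_topspace closedin_closure_of)
  moreover have "disjnt (\<Union>\<W>) (topspace X - X closure_of \<Union>\<W>)"
    using \<open>\<Union>\<W> \<subseteq> X closure_of \<Union>\<W>\<close> unfolding disjnt_def by blast
  moreover have "S \<subseteq> topspace X - X closure_of \<Union>\<W>"
    using S \<open>disjnt S (X closure_of \<Union>\<W>)\<close> unfolding disjnt_def by blast
  ultimately show ?thesis by blast
qed

lemma paracompact_imp_regular_space:
  assumes X: "paracompact_space X"
  shows "regular_space X"
  unfolding regular_space_def
proof (intro allI impI)
  fix C a assume Ca: "closedin X C \<and> a \<in> topspace X - C"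
  have "\<exists>U V. openin X U \<and> openin X V \<and> C \<subseteq> U \<and> {a} \<subseteq> V \<and> disjnt U V"
  proof (rule paracompact_space_separation [OF X])
    fix c assume "c \<in> C"
    then show "\<exists>U V. openin X U \<and> openin X V \<and> c \<in> U \<and> {a} \<subseteq> V \<and> disjnt U V"
    proof -
      have "c \<in> topspace X" "a \<in> topspace X" "c \<noteq> a"
        using \<open>c \<in> C\<close> Ca closedin_subset [of X C] by blast+
      moreover have "Hausdorff_space X" using X unfolding paracompact_space_def by (rule conjunct1)
      ultimately obtain U V where "openin X U" "openin X V" "c \<in> U" "a \<in> V" "disjnt U V"
        unfolding Hausdorff_space_def by meson
      then show ?thesis by blast
    qed
  qed (use Ca in auto)
  then show "\<exists>U V. openin X U \<and> openin X V \<and> a \<in> U \<and> C \<subseteq> V \<and> disjnt U V"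
    by (metis disjnt_sym insert_subset)
qed

lemma paracompact_imp_normal_space:
  assumes X: "paracompact_space X"
  shows "normal_space X"
  unfolding normal_space_def
proof (intro allI impI)
  fix S C assume A: "closedin X S \<and> closedin X C \<and> disjnt S C"
  show "\<exists>U V. openin X U \<and> openin X V \<and> S \<subseteq> U \<and> C \<subseteq> V \<and> disjnt U V"
  proof (rule paracompact_space_separation [OF X])
    fix c assume "c \<in> S"
    then have "c \<in> topspace X - C" using A closedin_subset [of X S] by (auto simp: disjnt_def)
    with A have "closedin X C \<and> c \<in> topspace X - C" by blast
    with paracompact_imp_regular_space [OF X]
    show "\<exists>U V. openin X U \<and> openin X V \<and> c \<in> U \<and> C \<subseteq> V \<and> disjnt U V"
      unfolding regular_space_def by (elim allE [of _ C] allE [of _ c] impE)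
  qed (use A in \<open>auto dest: closedin_subset\<close>)
qed

text \<open>Two refinements are taken: \<open>\<V>\<close> of the given cover, and
  \<open>\<W>\<close> whose members have closures inside members of \<open>\<V>\<close>. Together
  they shrink \<open>\<V>\<close> to closed sets, which Urysohn functions separate from the
  complements. The closure of the support is required to lie in \<open>V\<close>, since later
  constructions are defined on \<open>V\<close> only and must be extended continuously beyond
  it.\<close>

lemma paracompact_partition_of_unity:
  fixes X :: "'x topology"
  assumes X: "paracompact_space X" and \<U>: "\<And>U. U \<in> \<U> \<Longrightarrow> openin X U" "\<Union>\<U> = topspace X"
  obtains \<V> :: "'x set set" and lam :: "'x set \<Rightarrow> 'x \<Rightarrow> real" where
    "\<And>V. V \<in> \<V> \<Longrightarrow> openin X V" "\<And>V. V \<in> \<V> \<Longrightarrow> \<exists>U\<in>\<U>. V \<subseteq> U"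
    "\<And>V. V \<in> \<V> \<Longrightarrow> continuous_map X euclideanreal (lam V)"
    "\<And>V x. 0 \<le> lam V x"
    "\<And>V. V \<in> \<V> \<Longrightarrow> X closure_of {x \<in> topspace X. lam V x \<noteq> 0} \<subseteq> V"
    "\<And>x. x \<in> topspace X \<Longrightarrow> \<exists>N. openin X N \<and> x \<in> N \<and> finite {V \<in> \<V>. \<exists>y\<in>N. lam V y \<noteq> 0}"
    "\<And>x. x \<in> topspace X \<Longrightarrow> (\<Sum>V\<in>{V\<in>\<V>. lam V x \<noteq> 0}. lam V x) = 1"
proof -
  have "\<forall>U\<in>\<U>. openin X U" using \<U>(1) by blast
  from paracompact_space_refinement [OF X this \<U>(2)]
  obtain \<V> where V: "\<forall>V\<in>\<V>. openin X V" "\<Union>\<V> = topspace X"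
      "\<forall>V\<in>\<V>. \<exists>U\<in>\<U>. V \<subseteq> U" and lfV: "locally_finite_in X \<V>"
    by (elim exE conjE) (rule that)
  let ?O = "{O'. openin X O' \<and> (\<exists>V\<in>\<V>. X closure_of O' \<subseteq> V)}"
  have "\<exists>O'\<in>?O. x \<in> O'" if x: "x \<in> topspace X" for x
  proof -
    obtain V where "V \<in> \<V>" "x \<in> V" using V(2) x by auto
    then have "closedin X (topspace X - V) \<and> x \<in> topspace X - (topspace X - V)" using V(1) x by auto
    then obtain O' where O': "openin X O'" "x \<in> O'" "disjnt (topspace X - V) (X closure_of O')"
      using paracompact_imp_regular_space [OF X] unfolding regular_space
      by (elim allE [of _ "topspace X - V"] allE [of _ x] impE exE conjE) (auto intro: that)
    then have "X closure_of O' \<subseteq> V"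
      using closure_of_subset_topspace [of X O'] by (auto simp: disjnt_def)
    then show ?thesis using O' \<open>V \<in> \<V>\<close> by blast
  qed
  then have "topspace X \<subseteq> \<Union>?O" by blast
  moreover have "\<Union>?O \<subseteq> topspace X" using openin_subset by blast
  ultimately have eq: "\<Union>?O = topspace X" by (rule equalityI [rotated])
  have "\<forall>U\<in>?O. openin X U" by auto
  from paracompact_space_refinement [OF X this eq]
  obtain \<W> where W: "\<forall>V\<in>\<W>. openin X V" "\<Union>\<W> = topspace X"
      "\<forall>V\<in>\<W>. \<exists>U\<in>?O. V \<subseteq> U" and lfW: "locally_finite_in X \<W>"
    by (elim exE conjE) (rule that)
  have "\<exists>V. V \<in> \<V> \<and> X closure_of W \<subseteq> V" if WW: "W \<in> \<W>" for W
  proof -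
    from bspec [OF W(3) WW] obtain O' where "O' \<in> ?O" "W \<subseteq> O'" by (rule bexE)
    then show ?thesis using closure_of_mono [of W O' X] by blast
  qed
  then obtain f where f: "\<And>W. W \<in> \<W> \<Longrightarrow> f W \<in> \<V> \<and> X closure_of W \<subseteq> f W" by metis
  \<comment> \<open>The shrinking of \<open>V\<close>: every member of \<open>\<W>\<close> is
    assigned to one set of \<open>\<V>\<close> containing its closure, so the sets
    \<open>C V\<close> still cover the space.\<close>
  define C where "C V = X closure_of \<Union>{W\<in>\<W>. f W = V}" for V
  have CV: "C V \<subseteq> V" if "V \<in> \<V>" for V
  proof -
    have "locally_finite_in X {W\<in>\<W>. f W = V}" using lfW by (rule locally_finite_in_subset) auto
    then have "C V = \<Union>((closure_of) X ` {W\<in>\<W>. f W = V})" unfolding C_def by (rule closure_of_locally_finite_Union)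
    then show ?thesis using f by blast
  qed
  have "\<exists>g. continuous_map X (top_of_set {0..1::real}) g \<and> g ` (topspace X - V) \<subseteq> {0} \<and> g ` C V \<subseteq> {1}"
    if "V \<in> \<V>" for V
  proof -
    have a: "closedin X (topspace X - V)" using V(1) that by blast
    have b: "closedin X (C V)" by (simp add: C_def)
    have c: "disjnt (topspace X - V) (C V)" using CV [OF that] by (auto simp: disjnt_def)
    obtain h where "continuous_map X (top_of_set {0..1::real}) h" "h ` (topspace X - V) \<subseteq> {0}" "h ` C V \<subseteq> {1}"
      by (rule Urysohn_lemma [OF paracompact_imp_normal_space [OF X] a b c zero_le_one])
    then show ?thesis by blast
  qed
  then obtain g where g: "\<And>V. V \<in> \<V> \<Longrightarrow> continuous_map X (top_of_set {0..1::real}) (g V) \<and> g V ` (topspace X - V) \<subseteq> {0} \<and> g V ` C V \<subseteq> {1}"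
    by metis
  have gc: "continuous_map X euclideanreal (g V)" if "V \<in> \<V>" for V
    using g [OF that] continuous_map_into_fulltopology by blast
  \<comment> \<open>The set where \<open>g V\<close> is nonzero may have a closure that leaves
    \<open>V\<close>. After cutting at 1/2 the support lies in the closed set where
    \<open>g V\<close> is at least 1/2, which is contained in \<open>V\<close>.\<close>
  define h where "h V x = max 0 (g V x - 1/2)" for V x
  have hc: "continuous_map X euclideanreal (h V)" if "V \<in> \<V>" for V
    unfolding h_def by (intro continuous_intros gc that)
  have h0: "0 \<le> h V x" for V x by (simp add: h_def)
  have hV: "X closure_of {x \<in> topspace X. h V x \<noteq> 0} \<subseteq> V" if "V \<in> \<V>" for V
  proof -
    have "closedin X {x \<in> topspace X. g V x \<in> {1/2..}}"
      by (rule closedin_continuous_map_preimage [OF gc [OF that]]) auto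
    then have "X closure_of {x \<in> topspace X. h V x \<noteq> 0} \<subseteq> {x \<in> topspace X. g V x \<in> {1/2..}}"
      by (rule closure_of_minimal [rotated]) (auto simp: h_def)
    also have "\<dots> \<subseteq> V" using g [OF that] by force
    finally show ?thesis .
  qed
  have hV': "x \<in> V" if "V \<in> \<V>" "x \<in> topspace X" "h V x \<noteq> 0" for V x
    using hV [OF that(1)] closure_of_subset [of "{x \<in> topspace X. h V x \<noteq> 0}" X] that by auto
  have lf: "\<exists>N. openin X N \<and> x \<in> N \<and> finite {V \<in> \<V>. \<exists>y\<in>N. h V y \<noteq> 0}" if x: "x \<in> topspace X" for x
  proof -
    obtain N where N: "openin X N" "x \<in> N" "finite {U \<in> \<V>. U \<inter> N \<noteq> {}}"
      using lfV x unfolding locally_finite_in_def by blast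
    have "finite {V \<in> \<V>. \<exists>y\<in>N. h V y \<noteq> 0}"
    proof (rule finite_subset [OF _ N(3)], rule subsetI)
      fix V assume "V \<in> {V \<in> \<V>. \<exists>y\<in>N. h V y \<noteq> 0}"
      then obtain y where y: "V \<in> \<V>" "y \<in> N" "h V y \<noteq> 0" by blast
      then have "y \<in> V" using hV' [of V y] openin_subset [OF N(1)] by blast
      then show "V \<in> {U \<in> \<V>. U \<inter> N \<noteq> {}}" using y by blast
    qed
    then show ?thesis using N by blast
  qed
  define s where "s x = (\<Sum>V\<in>{V\<in>\<V>. h V x \<noteq> 0}. h V x)" for x
  have spos: "s x > 0" if x: "x \<in> topspace X" for x
  proof -
    obtain W where "W \<in> \<W>" "x \<in> W" using W(2) x by auto
    then have "x \<in> C (f W)" unfolding C_def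
      using closure_of_subset [of "\<Union>{Wa \<in> \<W>. f Wa = f W}" X] W(2) by blast
    moreover have fW: "f W \<in> \<V>" using f [OF \<open>W \<in> \<W>\<close>] by simp
    ultimately have "g (f W) x = 1" using g [OF fW] by blast
    then have "h (f W) x \<noteq> 0" by (simp add: h_def)
    note this fW
    moreover have "finite {V\<in>\<V>. h V x \<noteq> 0}"
      using lf [OF x] by (smt (verit) Collect_mono finite_subset)
    ultimately show ?thesis unfolding s_def
      using h0 by (intro sum_pos2 [where i = "f W"]) (auto simp: less_le)
  qed
  have sc: "continuous_map X euclideanreal s"
  proof (rule continuous_map_local)
    fix x assume x: "x \<in> topspace X"
    obtain N where N: "openin X N" "x \<in> N" and fin: "finite {V \<in> \<V>. \<exists>y\<in>N. h V y \<noteq> 0}"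
      using lf [OF x] by blast
    have "continuous_map (subtopology X N) euclideanreal (\<lambda>y. \<Sum>V\<in>{V \<in> \<V>. \<exists>y\<in>N. h V y \<noteq> 0}. h V y)"
      using fin hc by (intro continuous_map_sum continuous_map_from_subtopology) auto
    moreover have "(\<Sum>V\<in>{V \<in> \<V>. \<exists>y\<in>N. h V y \<noteq> 0}. h V y) = s y" if "y \<in> N" for y
      unfolding s_def by (rule sum.mono_neutral_right) (use fin that in auto)
    ultimately have "continuous_map (subtopology X N) euclideanreal s"
      by (rule continuous_map_eq) auto
    then show "\<exists>U. openin X U \<and> x \<in> U \<and> continuous_map (subtopology X U) euclideanreal s"
      using N by blast
  qed
  define lam where "lam V x = (if x \<in> topspace X then h V x / s x else 0)" for V x
  have lam0: "lam V x \<noteq> 0 \<longleftrightarrow> x \<in> topspace X \<and> h V x \<noteq> 0" for V x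
    using spos [of x] by (auto simp: lam_def)
  show thesis
  proof
    fix V assume "V \<in> \<V>"
    show "openin X V" "\<exists>U\<in>\<U>. V \<subseteq> U" using V \<open>V \<in> \<V>\<close> by auto
    have "continuous_map X euclideanreal (\<lambda>x. h V x / s x)"
      by (intro continuous_map_real_divide hc sc \<open>V \<in> \<V>\<close>) (use spos in force)
    then show "continuous_map X euclideanreal (lam V)"
      by (rule continuous_map_eq) (auto simp: lam_def)
    show "X closure_of {x \<in> topspace X. lam V x \<noteq> 0} \<subseteq> V"
      using hV [OF \<open>V \<in> \<V>\<close>] by (simp add: lam0 cong: conj_cong)
  next
    fix V x show "0 \<le> lam V x" using h0 spos by (simp add: lam_def less_imp_le)
  next
    fix x assume x: "x \<in> topspace X"
    show "\<exists>N. openin X N \<and> x \<in> N \<and> finite {V \<in> \<V>. \<exists>y\<in>N. lam V y \<noteq> 0}"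
      using lf [OF x] by (smt (verit) Collect_mono finite_subset lam0)
    show "(\<Sum>V\<in>{V\<in>\<V>. lam V x \<noteq> 0}. lam V x) = 1"
      using x spos [OF x] by (simp add: lam0 lam_def s_def flip: sum_divide_distrib)
  qed
qed

section \<open>Paracompactness of metric spaces\<close>

text \<open>M. E. Rudin's proof: \<open>D U n\<close> is the union of the balls of radius \<open>2\<^sup>-\<^sup>n\<close> around the points that are first
  covered by \<open>U\<close>, lie deep enough in \<open>U\<close> and were not reached at an earlier stage.\<close>

lemma (in Metric_space) paracompact_space_mtopology: "paracompact_space mtopology"
  unfolding paracompact_space_def
proof (intro conjI allI impI Hausdorff_space_mtopology)
  fix \<U> assume \<U>: "(\<forall>U\<in>\<U>. openin mtopology U) \<and> \<Union>\<U> = topspace mtopology"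
  obtain r :: "'a set rel" where "well_order_on UNIV r" using well_order_on by blast
  then have wf: "wf (r - Id)" and tot: "total_on UNIV r"
    by (auto simp: well_order_on_def linear_order_on_def)
  have "\<exists>U\<in>\<U>. x \<in> U \<and> (\<forall>V. (V, U) \<in> r - Id \<longrightarrow> \<not> (V \<in> \<U> \<and> x \<in> V))" if "x \<in> M" for x
  proof -
    obtain U where U: "U \<in> {U\<in>\<U>. x \<in> U}" using \<U> \<open>x \<in> M\<close> by auto
    show ?thesis using wfE_min [OF wf U] by (metis (no_types, lifting) mem_Collect_eq)
  qed
  then obtain F where F: "\<And>x. x \<in> M \<Longrightarrow> F x \<in> \<U> \<and> x \<in> F x"
    and Fmin: "\<And>x V. x \<in> M \<Longrightarrow> (V, F x) \<in> r - Id \<Longrightarrow> V \<in> \<U> \<Longrightarrow> x \<notin> V"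
    by metis
  \<comment> \<open>The points reached before stage \<open>n\<close>. The recursion needs only this
    union over all \<open>U\<close>; the single sets are recovered afterwards because a centre
    \<open>x\<close> determines \<open>F x\<close>.\<close>
  define P where "P = rec_nat {} (\<lambda>n A. A \<union> \<Union>{mball x (1/2^n) |x. x \<in> M - A \<and> mball x (3/2^n) \<subseteq> F x})"
  \<comment> \<open>The radius \<open>3/2^n\<close> keeps centres that belong to different
    \<open>U\<close> at least \<open>3/2^n\<close> apart, so that their balls of radius
    \<open>1/2^n\<close> are still more than \<open>1/2^n\<close> apart.\<close>
  define D where "D U n = \<Union>{mball x (1/2^n) |x. x \<in> M - P n \<and> F x = U \<and> mball x (3/2^n) \<subseteq> U}" for U n
  have P0: "P 0 = {}" and PS: "P (Suc n) = P n \<union> (\<Union>U. D U n)" for n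
    by (auto simp: P_def D_def)
  have DP: "D U j \<subseteq> P n" if "j < n" for U j n
    using that by (induction n) (auto simp: PS less_Suc_eq)
  have PD: "\<exists>U j. x \<in> D U j" if "x \<in> P n" for x n
    using that by (induction n) (auto simp: PS P0)
  have DU: "D U n \<subseteq> U" for U n
  proof
    fix p assume "p \<in> D U n"
    then obtain x where x: "p \<in> mball x (1/2^n)" "mball x (3/2^n) \<subseteq> U" by (auto simp: D_def)
    moreover have "mball x (1/2^n) \<subseteq> mball x (3/2^n)"
      by (rule mball_subset_concentric) (simp add: divide_right_mono)
    ultimately show "p \<in> U" by auto
  qed
  have DO: "openin mtopology (D U n)" for U n by (auto simp: D_def)
  have DM: "D U n \<subseteq> M" for U n using DO openin_subset by fastforce
  have cover: "\<exists>U n. x \<in> D U n" if x: "x \<in> M" for x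
  proof -
    obtain e where e: "e > 0" "mball x e \<subseteq> F x"
      using F [OF x] \<U> unfolding openin_mtopology by meson
    obtain n where "(1/2)^n < e/3" using e real_arch_pow_inv [of "e/3" "1/2"] by auto
    then have "3/2^n \<le> e" by (simp add: power_one_over field_simps)
    then have sub: "mball x (3/2^n) \<subseteq> F x" using e mball_subset_concentric by blast
    show ?thesis
    proof (cases "x \<in> P n")
      case True then show ?thesis using PD by blast
    next
      case False
      then have "mball x (1/2^n) \<subseteq> D (F x) n" using sub x by (auto simp: D_def)
      moreover have "x \<in> mball x (1/2^n)" using x by simp
      ultimately show ?thesis by blast
    qed
  qed
  let ?V = "{D U n |U n. D U n \<noteq> {}}"
  have D\<U>: "U \<in> \<U>" if "D U n \<noteq> {}" for U n
    using that F by (fastforce simp: D_def)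
  have "locally_finite_in mtopology ?V"
    unfolding locally_finite_in_def
  proof (intro conjI ballI)
    show "\<Union>?V \<subseteq> topspace mtopology" using DM by auto
  next
    fix x assume "x \<in> topspace mtopology"
    then have x: "x \<in> M" by simp
    obtain U n where Un: "x \<in> D U n" using cover [OF x] by blast
    then obtain e where e: "e > 0" "mball x e \<subseteq> D U n" using DO openin_mtopology by metis
    obtain j where j: "(1/2::real)^j < e" using e real_arch_pow_inv [of "e" "1/2"] by auto
    have je: "1/2^j < e" using j by (simp add: power_one_over)
    \<comment> \<open>From stage \<open>k\<close> on, centres avoid \<open>D U n\<close>, hence the
      ball of radius \<open>e\<close> around \<open>x\<close>, and both radii involved are at most
      half of \<open>1/2^j < e\<close>. So only the stages below \<open>k\<close> can meet
      \<open>N\<close>.\<close>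
    define k where "k = n + j + 1"
    define N where "N = mball x (1/2^k)"
    have far: "D V i \<inter> N = {}" if i: "i \<ge> k" for V i
    proof (rule ccontr)
      assume "D V i \<inter> N \<noteq> {}"
      then obtain p where p1: "p \<in> D V i" "p \<in> mball x (1/2^k)" unfolding N_def by blast
      then obtain y where p: "p \<in> mball x (1/2^k)" "p \<in> mball y (1/2^i)" and y: "y \<in> M - P i"
        unfolding D_def by blast
      have "y \<notin> D U n" using DP [of n i U] i y by (auto simp: k_def)
      then have "d x y \<ge> 1/2^j" using e je x y by (smt (verit) DiffD1 in_mball subsetD)
      moreover have "d x y \<le> d x p + d y p" using p triangle'' commute by (metis in_mball triangle')
      moreover have "1/2^i \<le> (1/2^k::real)" using i by (simp add: field_simps)
      moreover have "1/2^k \<le> (1/2^(j+1)::real)" unfolding k_def by (simp add: field_simps)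
      moreover have "1/2^(j+1) = (1/2^j::real) / 2" by simp
      ultimately show False using p by simp
    qed
    \<comment> \<open>Two points of \<open>N\<close> are less than \<open>1/2^i\<close> apart, too
      close to lie in balls of stage \<open>i\<close> that belong to different sets of the
      cover.\<close>
    have one: "V = W" if i: "i < k" and V: "D V i \<inter> N \<noteq> {}" and W: "D W i \<inter> N \<noteq> {}" for V W i
    proof -
      have aux: False if VW: "(V, W) \<in> r - Id" and V: "D V i \<inter> N \<noteq> {}" and W: "D W i \<inter> N \<noteq> {}" for V W
      proof -
        obtain p y where p: "p \<in> N" "p \<in> mball y (1/2^i)" and y: "y \<in> M - P i" "F y = V" "mball y (3/2^i) \<subseteq> V"
          using V unfolding D_def by blast
        obtain q z where q: "q \<in> N" "q \<in> mball z (1/2^i)" and z: "z \<in> M - P i" "F z = W" "mball z (3/2^i) \<subseteq> W"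
          using W unfolding D_def by blast
        have "z \<notin> V" using Fmin [of z V] z VW D\<U> [of V i] V by auto
        then have far': "d y z \<ge> 3/2^i" using y z by (metis DiffD1 in_mball linorder_not_less subsetD)
        have M': "p \<in> M" "q \<in> M" "y \<in> M" "z \<in> M" using p q y z by (auto simp: N_def)
        have "d y z \<le> d y p + d p q + d q z"
          using M' triangle [of y p z] triangle [of p q z] by linarith
        moreover have "d p q \<le> d x p + d x q" using M' x triangle'' by blast
        moreover have "d y p < 1/2^i" "d q z < 1/2^i" "d x p < 1/2^k" "d x q < 1/2^k"
          using p q by (auto simp: N_def commute)
        moreover have "1/2^k \<le> (1/2^(Suc i)::real)" 
          using i by (intro divide_left_mono power_increasing) auto
        ultimately have "d y z < 3 * (1/2^i)" by simp
        then show False using far' by simp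
      qed
      show ?thesis using aux [OF _ V W] aux [OF _ W V] tot by (metis DiffI UNIV_I pair_in_Id_conv total_on_def)
    qed
    have "{S\<in>?V. S \<inter> N \<noteq> {}} \<subseteq> (\<Union>i<k. {D V i |V. D V i \<inter> N \<noteq> {}})"
    proof
      fix S assume "S \<in> {S\<in>?V. S \<inter> N \<noteq> {}}"
      then obtain V i where "S = D V i" "D V i \<inter> N \<noteq> {}" by blast
      moreover then have "i < k" using far [of i V] by (meson not_le)
      ultimately show "S \<in> (\<Union>i<k. {D V i |V. D V i \<inter> N \<noteq> {}})" by blast
    qed
    moreover have "finite {D V i |V. D V i \<inter> N \<noteq> {}}" if "i < k" for i
    proof (cases "\<exists>V. D V i \<inter> N \<noteq> {}")
      case True
      then obtain V where V: "D V i \<inter> N \<noteq> {}" by blast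
      have "{D V i |V. D V i \<inter> N \<noteq> {}} \<subseteq> {D V i}" using one [OF that V] by auto
      then show ?thesis by (rule finite_subset) auto
    qed (auto intro: finite_subset [of _ "{}"])
    ultimately have "finite {S\<in>?V. S \<inter> N \<noteq> {}}" by (meson finite_UN_I finite_lessThan finite_subset lessThan_iff)
    then show "\<exists>V. openin mtopology V \<and> x \<in> V \<and> finite {S\<in>?V. S \<inter> V \<noteq> {}}"
      using x by (intro exI [of _ N]) (auto simp: N_def)
  qed
  moreover have "\<Union>?V = topspace mtopology"
  proof
    show "\<Union>?V \<subseteq> topspace mtopology" using DM by auto
    show "topspace mtopology \<subseteq> \<Union>?V"
    proof
      fix x assume "x \<in> topspace mtopology"
      then obtain U n where "x \<in> D U n" using cover by (metis topspace_mtopology)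
      then show "x \<in> \<Union>?V" by blast
    qed
  qed
  moreover have "\<forall>V\<in>?V. \<exists>U\<in>\<U>. V \<subseteq> U" using D\<U> DU by blast
  moreover have "\<forall>V\<in>?V. openin mtopology V" using DO by blast
  ultimately show "\<exists>\<V>. (\<forall>V\<in>\<V>. openin mtopology V) \<and> \<Union>\<V> = topspace mtopology \<and>
      (\<forall>V\<in>\<V>. \<exists>U\<in>\<U>. V \<subseteq> U) \<and> locally_finite_in mtopology \<V>"
    by (intro exI [of _ ?V]) simp
qed

section \<open>Principal bundles\<close>

locale top_group = group G for G :: "('g, 'm) monoid_scheme" (structure) +
  fixes T :: "'g topology"
  assumes topological_group: "topological_group G T"
begin

lemma topspace_T: "topspace T = carrier G"
  using topological_group by (simp add: topological_group_def)

lemma continuous_map_mult: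
  assumes "continuous_map Z T f" "continuous_map Z T g"
  shows "continuous_map Z T (\<lambda>z. f z \<otimes> g z)"
proof -
  have "continuous_map (prod_topology T T) T (\<lambda>(x, y). x \<otimes> y)"
    using topological_group by (simp add: topological_group_def)
  from continuous_map_compose [OF continuous_map_pairedI [OF assms] this]
  show ?thesis by (simp add: o_def)
qed

lemma continuous_map_inv:
  assumes "continuous_map Z T f"
  shows "continuous_map Z T (\<lambda>z. inv (f z))"
proof -
  have "continuous_map T T (\<lambda>x. inv x)"
    using topological_group by (simp add: topological_group_def)
  from continuous_map_compose [OF assms this] show ?thesis by (simp add: o_def)
qed

end

lemma top_group_iff: "top_group G T \<longleftrightarrow> topological_group G T"
  by (auto simp: top_group_def top_group_axioms_def topological_group_def)

section \<open>Local sections and division in the fibres\<close>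

locale principal_bundle_on = top_group G T for G :: "('g, 'm) monoid_scheme" (structure) and T +
  fixes X :: "'x topology" and P :: "('g, 'e, 'x) gbundle"
  assumes principal: "principal_bundle G T X P"
begin

abbreviation E where "E \<equiv> topspace (btotal P)"

lemma proj_cont: "continuous_map (btotal P) X (bproj P)"
  using principal unfolding principal_bundle_def by (elim conjE)

lemma proj_in: "e \<in> E \<Longrightarrow> bproj P e \<in> topspace X"
  using proj_cont continuous_map_image_subset_topspace by fast

lemma act_cont: "continuous_map (prod_topology T (btotal P)) (btotal P) (\<lambda>(g, e). bact P g e)"
  using principal unfolding principal_bundle_def by (elim conjE)

lemma act_in: "g \<in> carrier G \<Longrightarrow> e \<in> E \<Longrightarrow> bact P g e \<in> E"
  using continuous_map_image_subset_topspace [OF act_cont] by (force simp: topspace_T)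

lemma act_comp:
  assumes "continuous_map Z T f" "continuous_map Z (btotal P) s"
  shows "continuous_map Z (btotal P) (\<lambda>z. bact P (f z) (s z))"
  using continuous_map_compose [OF continuous_map_pairedI [OF assms] act_cont] by (simp add: o_def)

lemma act_laws:
  "\<forall>e\<in>E. bact P \<one> e = e \<and> (\<forall>g\<in>carrier G. bproj P (bact P g e) = bproj P e \<and>
    (\<forall>h\<in>carrier G. bact P (h \<otimes> g) e = bact P h (bact P g e)))"
  using principal unfolding principal_bundle_def by (elim conjE)

lemma act_one: "e \<in> E \<Longrightarrow> bact P \<one> e = e"
  and proj_act: "e \<in> E \<Longrightarrow> g \<in> carrier G \<Longrightarrow> bproj P (bact P g e) = bproj P e"
  and act_mult: "e \<in> E \<Longrightarrow> g \<in> carrier G \<Longrightarrow> h \<in> carrier G \<Longrightarrow> bact P (h \<otimes> g) e = bact P h (bact P g e)"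
  using act_laws by simp_all

text \<open>A trivialisation is traded for a section \<open>s\<close>, the image of the identity,
  and a fibre coordinate \<open>\<theta>\<close>, the group component of its inverse. In this form
  it can be composed with maps that do not come from a product.\<close>

lemma local_data:
  assumes x: "x \<in> topspace X"
  shows "\<exists>U s \<theta>. openin X U \<and> x \<in> U \<and> continuous_map (subtopology X U) (btotal P) s \<and>
    continuous_map (subtopology (btotal P) {e \<in> E. bproj P e \<in> U}) T \<theta> \<and>
    (\<forall>u\<in>U. bproj P (s u) = u) \<and>
    (\<forall>e\<in>E. bproj P e \<in> U \<longrightarrow> bact P (\<theta> e) (s (bproj P e)) = e) \<and>
    (\<forall>u\<in>U. \<forall>g\<in>carrier G. \<theta> (bact P g (s u)) = g)"
proof -
  have "\<forall>x\<in>topspace X. \<exists>U \<phi>. openin X U \<and> x \<in> U \<and>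
        homeomorphic_map (prod_topology (subtopology X U) T)
          (subtopology (btotal P) {e \<in> E. bproj P e \<in> U}) \<phi> \<and>
        (\<forall>u\<in>U. \<forall>g\<in>carrier G. bproj P (\<phi> (u, g)) = u \<and>
           (\<forall>h\<in>carrier G. \<phi> (u, h \<otimes> g) = bact P h (\<phi> (u, g))))"
    using principal unfolding principal_bundle_def by (elim conjE)
  from bspec [OF this x] obtain U \<phi> where U: "openin X U" "x \<in> U"
    and hom: "homeomorphic_map (prod_topology (subtopology X U) T) (subtopology (btotal P) {e \<in> E. bproj P e \<in> U}) \<phi>"
    and \<phi>: "\<forall>u\<in>U. \<forall>g\<in>carrier G. bproj P (\<phi> (u, g)) = u \<and> (\<forall>h\<in>carrier G. \<phi> (u, h \<otimes> g) = bact P h (\<phi> (u, g)))"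
    by (elim exE conjE) (rule that)
  have UX: "U \<subseteq> topspace X" using U(1) by (rule openin_subset)
  obtain \<psi> where hm: "homeomorphic_maps (prod_topology (subtopology X U) T) (subtopology (btotal P) {e \<in> E. bproj P e \<in> U}) \<phi> \<psi>"
    using iffD1 [OF homeomorphic_map_maps hom] by (elim exE) (rule that)
  have c\<phi>: "continuous_map (prod_topology (subtopology X U) T) (btotal P) \<phi>"
    using hm unfolding homeomorphic_maps_def by (meson continuous_map_into_fulltopology)
  have c\<psi>: "continuous_map (subtopology (btotal P) {e \<in> E. bproj P e \<in> U}) (prod_topology (subtopology X U) T) \<psi>"
    using hm unfolding homeomorphic_maps_def by (elim conjE)
  have \<psi>\<phi>: "\<psi> (\<phi> (u, g)) = (u, g)" if "u \<in> U" "g \<in> carrier G" for u g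
    using hm that UX unfolding homeomorphic_maps_def by (auto simp: topspace_T)
  have \<phi>\<psi>: "\<phi> (\<psi> e) = e" if "e \<in> E" "bproj P e \<in> U" for e
    using hm that unfolding homeomorphic_maps_def by auto
  define s where "s u = \<phi> (u, \<one>)" for u
  define \<theta> where "\<theta> e = snd (\<psi> e)" for e
  have eq: "\<phi> (u, g) = bact P g (s u)" if "u \<in> U" "g \<in> carrier G" for u g
    using \<phi> that unfolding s_def by (metis one_closed r_one)
  have cs: "continuous_map (subtopology X U) (btotal P) s"
  proof -
    have "continuous_map (subtopology X U) (prod_topology (subtopology X U) T) (\<lambda>u. (u, \<one>))"
      by (intro continuous_map_pairedI) (auto simp: topspace_T)
    from continuous_map_compose [OF this c\<phi>] show ?thesis by (simp add: o_def s_def [abs_def])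
  qed
  have c\<theta>: "continuous_map (subtopology (btotal P) {e \<in> E. bproj P e \<in> U}) T \<theta>"
    using continuous_map_compose [OF c\<psi> continuous_map_snd] unfolding \<theta>_def o_def .
  have "bact P (\<theta> e) (s (bproj P e)) = e" if e: "e \<in> E" "bproj P e \<in> U" for e
  proof -
    have "e \<in> topspace (subtopology (btotal P) {e \<in> E. bproj P e \<in> U})" using e by simp
    then have "\<psi> e \<in> U \<times> carrier G" using continuous_map_image_subset_topspace [OF c\<psi>] UX
      by (auto simp: topspace_T)
    then obtain u g where ug: "\<psi> e = (u, g)" "u \<in> U" "g \<in> carrier G" by blast
    then have "e = \<phi> (u, g)" using \<phi>\<psi> [OF e] by simp
    moreover have "bproj P e = u" using \<phi> ug calculation by simp
    ultimately show ?thesis using eq ug by (simp add: \<theta>_def)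
  qed
  moreover have "\<forall>u\<in>U. bproj P (s u) = u" using \<phi> by (simp add: s_def)
  moreover have "\<forall>u\<in>U. \<forall>g\<in>carrier G. \<theta> (bact P g (s u)) = g"
    using \<psi>\<phi> eq by (metis \<theta>_def snd_conv)
  ultimately show ?thesis using U cs c\<theta> by blast
qed

lemma local_section:
  assumes "x \<in> topspace X"
  obtains U s where "openin X U" "x \<in> U" "continuous_map (subtopology X U) (btotal P) s"
    "\<And>u. u \<in> U \<Longrightarrow> s u \<in> E" "\<And>u. u \<in> U \<Longrightarrow> bproj P (s u) = u"
proof -
  from local_data [OF assms] obtain U s where U: "openin X U" "x \<in> U" "continuous_map (subtopology X U) (btotal P) s"
    "\<forall>u\<in>U. bproj P (s u) = u" by (elim exE conjE) (rule that)
  then have "s u \<in> E" if "u \<in> U" for u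
    using continuous_map_image_subset_topspace [OF U(3)] openin_subset [OF U(1)] that by auto
  with U show thesis using that by blast
qed

lemma proj_surj: "x \<in> topspace X \<Longrightarrow> \<exists>e\<in>E. bproj P e = x"
  using local_section by metis

text \<open>The action is free and transitive on fibres because the coordinate turns it into left
  translation: \<open>\<theta>\<close> of \<open>g\<close> applied to \<open>e'\<close> is
  \<open>g \<otimes> \<theta> e'\<close>.\<close>

lemma ex_act:
  assumes "e \<in> E" "e' \<in> E" "bproj P e = bproj P e'"
  shows "\<exists>!g. g \<in> carrier G \<and> bact P g e' = e"
proof -
  from local_data [OF proj_in [OF assms(1)]] obtain U s \<theta> where U: "openin X U" "bproj P e \<in> U"
    "continuous_map (subtopology X U) (btotal P) s"
    and c: "continuous_map (subtopology (btotal P) {e \<in> E. bproj P e \<in> U}) T \<theta>"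
    and s: "\<forall>u\<in>U. bproj P (s u) = u"
    and a: "\<forall>e\<in>E. bproj P e \<in> U \<longrightarrow> bact P (\<theta> e) (s (bproj P e)) = e"
    and b: "\<forall>u\<in>U. \<forall>g\<in>carrier G. \<theta> (bact P g (s u)) = g"
    by (elim exE conjE) (rule that)
  define x where "x = bproj P e"
  have xU: "x \<in> U" using U by (simp add: x_def)
  have sE: "s x \<in> E" using continuous_map_image_subset_topspace [OF U(3)] xU openin_subset [OF U(1)] by auto
  have \<theta>: "\<theta> y \<in> carrier G" if "y \<in> E" "bproj P y \<in> U" for y
    using continuous_map_image_subset_topspace [OF c] that by (auto simp: topspace_T)
  have e: "bact P (\<theta> e) (s x) = e" "bact P (\<theta> e') (s x) = e'" "\<theta> e \<in> carrier G" "\<theta> e' \<in> carrier G"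
    using a \<theta> assms xU x_def by auto
  have ge: "bact P g e' = bact P (g \<otimes> \<theta> e') (s x)" if "g \<in> carrier G" for g
    using act_mult [OF sE e(4) that] e by simp
  show ?thesis
  proof (rule ex1I [of _ "\<theta> e \<otimes> inv (\<theta> e')"])
    show "\<theta> e \<otimes> inv (\<theta> e') \<in> carrier G \<and> bact P (\<theta> e \<otimes> inv (\<theta> e')) e' = e"
      using e ge [of "\<theta> e \<otimes> inv (\<theta> e')"] by (simp add: m_assoc)
  next
    fix g assume g: "g \<in> carrier G \<and> bact P g e' = e"
    then have "\<theta> e = g \<otimes> \<theta> e'" using ge [of g] b xU e by (metis m_closed)
    then show "g = \<theta> e \<otimes> inv (\<theta> e')" using g e by (simp add: m_assoc)
  qed
qed

text \<open>The translation function of a principal bundle: the quotient of two points of one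
  fibre.\<close>

definition bdiv :: "'e \<Rightarrow> 'e \<Rightarrow> 'g" where
  "bdiv e e' = (THE g. g \<in> carrier G \<and> bact P g e' = e)"

lemma bdiv:
  assumes "e \<in> E" "e' \<in> E" "bproj P e = bproj P e'"
  shows "bdiv e e' \<in> carrier G" "bact P (bdiv e e') e' = e"
  using theI' [OF ex_act [OF assms]] by (simp_all add: bdiv_def)

lemma bdiv_eqI:
  assumes "e' \<in> E" "g \<in> carrier G" "bact P g e' = e"
  shows "bdiv e e' = g"
  using ex_act [of e e'] act_in proj_act assms unfolding bdiv_def by blast

lemma bdiv_act:
  assumes "e \<in> E" "e' \<in> E" "bproj P e = bproj P e'" "h \<in> carrier G"
  shows "bdiv (bact P h e) e' = h \<otimes> bdiv e e'"
  using bdiv [OF assms(1-3)] assms by (intro bdiv_eqI) (simp_all add: act_mult)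

text \<open>Over a trivialising set the quotient equals
  \<open>\<theta> (a y) \<otimes> inv (\<theta> (b y))\<close>, in which the chosen section
  cancels.\<close>

lemma bdiv_cont:
  assumes a: "continuous_map Z (btotal P) a" and b: "continuous_map Z (btotal P) b"
    and ab: "\<And>z. z \<in> topspace Z \<Longrightarrow> bproj P (a z) = bproj P (b z)"
  shows "continuous_map Z T (\<lambda>z. bdiv (a z) (b z))"
proof (rule continuous_map_local)
  fix z assume z: "z \<in> topspace Z"
  have aE: "a y \<in> E" and bE: "b y \<in> E" if "y \<in> topspace Z" for y
    using that a b continuous_map_image_subset_topspace by blast+
  from local_data [OF proj_in [OF aE [OF z]]] obtain U s \<theta> where U: "openin X U" "bproj P (a z) \<in> U"
    "continuous_map (subtopology X U) (btotal P) s"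
    and c: "continuous_map (subtopology (btotal P) {e \<in> E. bproj P e \<in> U}) T \<theta>"
    and s: "\<forall>u\<in>U. bproj P (s u) = u"
    and A: "\<forall>e\<in>E. bproj P e \<in> U \<longrightarrow> bact P (\<theta> e) (s (bproj P e)) = e"
    and B: "\<forall>u\<in>U. \<forall>g\<in>carrier G. \<theta> (bact P g (s u)) = g"
    by (elim exE conjE) (rule that)
  have \<theta>: "\<theta> y \<in> carrier G" if "y \<in> E" "bproj P y \<in> U" for y
    using continuous_map_image_subset_topspace [OF c] that by (auto simp: topspace_T)
  let ?N = "{y \<in> topspace Z. bproj P (a y) \<in> U}"
  have N: "openin Z ?N"
    using openin_continuous_map_preimage [OF continuous_map_compose [OF a proj_cont] U(1)] by (simp add: o_def)
  have into: "continuous_map (subtopology Z ?N) (subtopology (btotal P) {e \<in> E. bproj P e \<in> U}) f"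
    if "continuous_map Z (btotal P) f" "\<And>y. y \<in> topspace Z \<Longrightarrow> bproj P (f y) = bproj P (a y)" for f
    using that continuous_map_image_subset_topspace [OF that(1)]
    by (auto simp: continuous_map_in_subtopology intro: continuous_map_from_subtopology)
  have "continuous_map (subtopology Z ?N) T (\<lambda>y. \<theta> (a y) \<otimes> inv (\<theta> (b y)))"
    using continuous_map_compose [OF into [OF a] c] continuous_map_compose [OF into [OF b] c] ab
    by (intro continuous_map_mult continuous_map_inv) (simp_all add: o_def)
  then have "continuous_map (subtopology Z ?N) T (\<lambda>y. bdiv (a y) (b y))"
  proof (rule continuous_map_eq)
    fix y assume "y \<in> topspace (subtopology Z ?N)"
    then have y: "y \<in> topspace Z" "bproj P (a y) \<in> U" by auto
    let ?x = "bproj P (a y)"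
    have sE: "s ?x \<in> E" using continuous_map_image_subset_topspace [OF U(3)] y openin_subset [OF U(1)] by auto
    have t: "\<theta> (a y) \<in> carrier G" "\<theta> (b y) \<in> carrier G" using y \<theta> aE bE ab [OF y(1)] by auto
    have *: "bact P (\<theta> (a y)) (s ?x) = a y" "bact P (\<theta> (b y)) (s ?x) = b y"
      using A y aE bE ab [OF y(1)] by metis+
    have "bact P (\<theta> (a y) \<otimes> inv (\<theta> (b y))) (b y) = bact P (\<theta> (a y) \<otimes> inv (\<theta> (b y)) \<otimes> \<theta> (b y)) (s ?x)"
      using t sE *(2) act_mult [of "s ?x" "\<theta> (b y)" "\<theta> (a y) \<otimes> inv (\<theta> (b y))"] by simp
    also have "\<dots> = a y" using t * by (simp add: m_assoc)
    finally show "\<theta> (a y) \<otimes> inv (\<theta> (b y)) = bdiv (a y) (b y)"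
      using t bE y(1) by (metis bdiv_eqI inv_closed m_closed)
  qed
  then show "\<exists>U. openin Z U \<and> z \<in> U \<and> continuous_map (subtopology Z U) T (\<lambda>z. bdiv (a z) (b z))"
    using N z U(2) by blast
qed

end

text \<open>The converse of \<open>local_data\<close>: \<open>(u, g)\<close> is sent to
  \<open>g\<close> applied to \<open>s u\<close>, with inverse given by projection and
  \<open>\<theta>\<close>. A bundle is thus recognised without exhibiting homeomorphisms.\<close>

lemma (in top_group) principal_bundleI:
  assumes pc: "continuous_map (btotal P) X (bproj P)"
    and ac: "continuous_map (prod_topology T (btotal P)) (btotal P) (\<lambda>(g, e). bact P g e)"
    and one: "\<And>e. e \<in> topspace (btotal P) \<Longrightarrow> bact P \<one> e = e"
    and pa: "\<And>e g. e \<in> topspace (btotal P) \<Longrightarrow> g \<in> carrier G \<Longrightarrow> bproj P (bact P g e) = bproj P e"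
    and am: "\<And>e g h. e \<in> topspace (btotal P) \<Longrightarrow> g \<in> carrier G \<Longrightarrow> h \<in> carrier G \<Longrightarrow>
        bact P (h \<otimes> g) e = bact P h (bact P g e)"
    and loc: "\<And>x. x \<in> topspace X \<Longrightarrow> \<exists>U s \<theta>. openin X U \<and> x \<in> U \<and>
        continuous_map (subtopology X U) (btotal P) s \<and>
        continuous_map (subtopology (btotal P) {e \<in> topspace (btotal P). bproj P e \<in> U}) T \<theta> \<and>
        (\<forall>u\<in>U. bproj P (s u) = u) \<and>
        (\<forall>e\<in>topspace (btotal P). bproj P e \<in> U \<longrightarrow> bact P (\<theta> e) (s (bproj P e)) = e) \<and>
        (\<forall>u\<in>U. \<forall>g\<in>carrier G. \<theta> (bact P g (s u)) = g)"
  shows "principal_bundle G T X P"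
proof -
  let ?E = "topspace (btotal P)"
  have ain: "bact P g e \<in> ?E" if "g \<in> carrier G" "e \<in> ?E" for g e
    using continuous_map_image_subset_topspace [OF ac] that by (force simp: topspace_T)
  have "\<exists>U \<phi>. openin X U \<and> x \<in> U \<and>
        homeomorphic_map (prod_topology (subtopology X U) T)
          (subtopology (btotal P) {e \<in> ?E. bproj P e \<in> U}) \<phi> \<and>
        (\<forall>u\<in>U. \<forall>g\<in>carrier G. bproj P (\<phi> (u, g)) = u \<and>
           (\<forall>h\<in>carrier G. \<phi> (u, h \<otimes> g) = bact P h (\<phi> (u, g))))" if x: "x \<in> topspace X" for x
  proof -
    from loc [OF x] obtain U s \<theta> where U: "openin X U" "x \<in> U" and cs: "continuous_map (subtopology X U) (btotal P) s"
      and c: "continuous_map (subtopology (btotal P) {e \<in> ?E. bproj P e \<in> U}) T \<theta>"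
      and s: "\<forall>u\<in>U. bproj P (s u) = u"
      and A: "\<forall>e\<in>?E. bproj P e \<in> U \<longrightarrow> bact P (\<theta> e) (s (bproj P e)) = e"
      and B: "\<forall>u\<in>U. \<forall>g\<in>carrier G. \<theta> (bact P g (s u)) = g"
      by (elim exE conjE) (rule that)
    have UX: "U \<subseteq> topspace X" using U(1) by (rule openin_subset)
    have sE: "s u \<in> ?E" if "u \<in> U" for u
      using continuous_map_image_subset_topspace [OF cs] UX that by auto
    define \<phi> where "\<phi> = (\<lambda>(u, g). bact P g (s u))"
    define \<psi> where "\<psi> e = (bproj P e, \<theta> e)" for e
    have "continuous_map (prod_topology (subtopology X U) T) (btotal P) \<phi>"
    proof -
      have "continuous_map (prod_topology (subtopology X U) T) (prod_topology T (btotal P)) (\<lambda>p. (snd p, s (fst p)))"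
        using continuous_map_compose [OF continuous_map_fst cs]
        by (intro continuous_map_pairedI continuous_map_snd) (simp add: o_def)
      from continuous_map_compose [OF this ac] show ?thesis by (simp add: o_def \<phi>_def case_prod_unfold)
    qed
    moreover have "\<phi> \<in> topspace (prod_topology (subtopology X U) T) \<rightarrow> {e \<in> ?E. bproj P e \<in> U}"
      using sE ain pa s by (auto simp: \<phi>_def topspace_T)
    ultimately have c\<phi>: "continuous_map (prod_topology (subtopology X U) T) (subtopology (btotal P) {e \<in> ?E. bproj P e \<in> U}) \<phi>"
      by (simp add: continuous_map_in_subtopology image_subset_iff_funcset)
    have c\<psi>: "continuous_map (subtopology (btotal P) {e \<in> ?E. bproj P e \<in> U}) (prod_topology (subtopology X U) T) \<psi>"
      unfolding \<psi>_def using pc c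
      by (intro continuous_map_pairedI) (auto simp: continuous_map_in_subtopology intro: continuous_map_from_subtopology)
    have "\<psi> (\<phi> p) = p" if "p \<in> topspace (prod_topology (subtopology X U) T)" for p
      using that sE pa s B by (auto simp: \<phi>_def \<psi>_def topspace_T)
    moreover have "\<phi> (\<psi> e) = e" if "e \<in> topspace (subtopology (btotal P) {e \<in> ?E. bproj P e \<in> U})" for e
      using that A by (auto simp: \<phi>_def \<psi>_def)
    ultimately have "homeomorphic_maps (prod_topology (subtopology X U) T) (subtopology (btotal P) {e \<in> ?E. bproj P e \<in> U}) \<phi> \<psi>"
      using c\<phi> c\<psi> unfolding homeomorphic_maps_def by blast
    then have "homeomorphic_map (prod_topology (subtopology X U) T) (subtopology (btotal P) {e \<in> ?E. bproj P e \<in> U}) \<phi>"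
      using homeomorphic_map_maps by blast
    moreover have "\<forall>u\<in>U. \<forall>g\<in>carrier G. bproj P (\<phi> (u, g)) = u \<and>
           (\<forall>h\<in>carrier G. \<phi> (u, h \<otimes> g) = bact P h (\<phi> (u, g)))"
      using sE pa s am by (simp add: \<phi>_def)
    ultimately show ?thesis using U by blast
  qed
  then show ?thesis using pc ac one pa am unfolding principal_bundle_def by blast
qed

text \<open>A local section \<open>s\<close> pulls back to \<open>y \<mapsto> (y, s (f y))\<close>,
  and division by it is the fibre coordinate.\<close>

lemma (in principal_bundle_on) principal_pullback:
  assumes f: "continuous_map Y X f"
  shows "principal_bundle G T Y (pullback Y f P)"
proof (rule principal_bundleI)
  let ?Q = "pullback Y f P"
  have Qt: "btotal ?Q = subtopology (prod_topology Y (btotal P)) {(x, e). f x = bproj P e}"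
    and Qp: "bproj ?Q = fst" and Qa: "bact ?Q = (\<lambda>g (x, e). (x, bact P g e))"
    by (simp_all add: pullback_def)
  have QE: "topspace (btotal ?Q) = {(x, e). x \<in> topspace Y \<and> e \<in> E \<and> f x = bproj P e}"
    by (auto simp: Qt)
  have cf: "continuous_map (btotal ?Q) Y fst" and cs: "continuous_map (btotal ?Q) (btotal P) snd"
    unfolding Qt by (auto intro: continuous_map_from_subtopology continuous_map_fst continuous_map_snd)
  show "continuous_map (btotal ?Q) Y (bproj ?Q)" using cf by (simp add: Qp)
  have "continuous_map (prod_topology T (btotal ?Q)) (prod_topology Y (btotal P)) (\<lambda>p. (fst (snd p), bact P (fst p) (snd (snd p))))"
    using continuous_map_compose [OF continuous_map_snd cf] continuous_map_compose [OF continuous_map_snd cs]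
    by (intro continuous_map_pairedI act_comp continuous_map_fst) (simp_all add: o_def)
  then show "continuous_map (prod_topology T (btotal ?Q)) (btotal ?Q) (\<lambda>(g, e). bact ?Q g e)"
    by (auto simp: Qt Qa continuous_map_in_subtopology case_prod_unfold topspace_T proj_act)
  show "bact ?Q \<one> e = e" if "e \<in> topspace (btotal ?Q)" for e
    using that unfolding QE by (auto simp: Qa act_one)
  show "bproj ?Q (bact ?Q g e) = bproj ?Q e" if "e \<in> topspace (btotal ?Q)" "g \<in> carrier G" for e g
    by (auto simp: Qa Qp case_prod_unfold)
  show "bact ?Q (h \<otimes> g) e = bact ?Q h (bact ?Q g e)"
    if "e \<in> topspace (btotal ?Q)" "g \<in> carrier G" "h \<in> carrier G" for e g h
    using that unfolding QE by (auto simp: Qa act_mult)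
  fix y assume y: "y \<in> topspace Y"
  then have "f y \<in> topspace X" using f continuous_map_image_subset_topspace by fast
  then obtain U s where U: "openin X U" "f y \<in> U" and s: "continuous_map (subtopology X U) (btotal P) s"
    "\<And>u. u \<in> U \<Longrightarrow> s u \<in> E" "\<And>u. u \<in> U \<Longrightarrow> bproj P (s u) = u" by (rule local_section) blast
  define V where "V = {y \<in> topspace Y. f y \<in> U}"
  have V: "openin Y V" unfolding V_def using f U(1) by (rule openin_continuous_map_preimage)
  have fV: "continuous_map (subtopology Y V) (subtopology X U) f"
    using f by (auto simp: continuous_map_in_subtopology V_def continuous_map_from_subtopology)
  have sf: "continuous_map (subtopology Y V) (btotal P) (\<lambda>y. s (f y))"
    using continuous_map_compose [OF fV s(1)] by (simp add: o_def)
  define \<sigma> where "\<sigma> y = (y, s (f y))" for y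
  define \<theta> where "\<theta> p = bdiv (snd p) (s (f (fst p)))" for p
  have "continuous_map (subtopology Y V) (prod_topology Y (btotal P)) \<sigma>"
    unfolding \<sigma>_def using sf by (intro continuous_map_pairedI) (auto simp: continuous_map_from_subtopology)
  then have c\<sigma>: "continuous_map (subtopology Y V) (btotal ?Q) \<sigma>"
    using s(3) by (auto simp: Qt continuous_map_in_subtopology \<sigma>_def V_def)
  have "continuous_map (subtopology (btotal ?Q) {e \<in> topspace (btotal ?Q). bproj ?Q e \<in> V}) T \<theta>"
    unfolding \<theta>_def
  proof (rule bdiv_cont)
    show "continuous_map (subtopology (btotal ?Q) {e \<in> topspace (btotal ?Q). bproj ?Q e \<in> V}) (btotal P) snd"
      by (intro continuous_map_from_subtopology cs)
    have "continuous_map (subtopology (btotal ?Q) {e \<in> topspace (btotal ?Q). bproj ?Q e \<in> V}) (subtopology Y V) fst"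
      by (auto simp: continuous_map_in_subtopology Qp intro: continuous_map_from_subtopology cf)
    from continuous_map_compose [OF this sf]
    show "continuous_map (subtopology (btotal ?Q) {e \<in> topspace (btotal ?Q). bproj ?Q e \<in> V}) (btotal P) (\<lambda>x. s (f (fst x)))"
      by (simp add: o_def)
    show "bproj P (snd z) = bproj P (s (f (fst z)))"
      if "z \<in> topspace (subtopology (btotal ?Q) {e \<in> topspace (btotal ?Q). bproj ?Q e \<in> V})" for z
    proof -
      have "z \<in> topspace (btotal ?Q)" "bproj ?Q z \<in> V" using that by auto
      then show ?thesis unfolding QE using s(3) by (auto simp: Qp V_def)
    qed
  qed
  moreover have "\<forall>u\<in>V. bproj ?Q (\<sigma> u) = u" by (simp add: Qp \<sigma>_def)
  moreover have "\<forall>e\<in>topspace (btotal ?Q). bproj ?Q e \<in> V \<longrightarrow> bact ?Q (\<theta> e) (\<sigma> (bproj ?Q e)) = e"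
    using s(2,3) bdiv(2) unfolding QE by (auto simp: Qp Qa \<sigma>_def \<theta>_def V_def)
  moreover have "\<forall>u\<in>V. \<forall>g\<in>carrier G. \<theta> (bact ?Q g (\<sigma> u)) = g"
    using s(2) by (auto simp: Qa \<sigma>_def \<theta>_def V_def intro: bdiv_eqI)
  moreover have "y \<in> V" using y U by (simp add: V_def)
  ultimately show "\<exists>U s \<theta>. openin Y U \<and> y \<in> U \<and>
        continuous_map (subtopology Y U) (btotal ?Q) s \<and>
        continuous_map (subtopology (btotal ?Q) {e \<in> topspace (btotal ?Q). bproj ?Q e \<in> U}) T \<theta> \<and>
        (\<forall>u\<in>U. bproj ?Q (s u) = u) \<and>
        (\<forall>e\<in>topspace (btotal ?Q). bproj ?Q e \<in> U \<longrightarrow> bact ?Q (\<theta> e) (s (bproj ?Q e)) = e) \<and>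
        (\<forall>u\<in>U. \<forall>g\<in>carrier G. \<theta> (bact ?Q g (s u)) = g)"
    using V c\<sigma> by blast
qed

text \<open>Equivariance over the identity of the base forces bijectivity on each fibre. The inverse
  divides \<open>q\<close> by the image of a local section and applies the quotient to that section,
  so it is continuous because division is.\<close>

lemma bundle_isoI:
  assumes tg: "topological_group G T" and P: "principal_bundle G T X P" and Q: "principal_bundle G T X Q"
    and F: "continuous_map (btotal P) (btotal Q) F"
    and proj: "\<And>e. e \<in> topspace (btotal P) \<Longrightarrow> bproj Q (F e) = bproj P e"
    and equi: "\<And>e g. e \<in> topspace (btotal P) \<Longrightarrow> g \<in> carrier G \<Longrightarrow> F (bact P g e) = bact Q g (F e)"
  shows "bundle_iso G P Q"
proof -
  interpret P: principal_bundle_on G T X P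
    using tg P by (simp add: principal_bundle_on_def principal_bundle_on_axioms_def top_group_iff)
  interpret Q: principal_bundle_on G T X Q
    using tg Q by (simp add: principal_bundle_on_def principal_bundle_on_axioms_def top_group_iff)
  have FE: "F e \<in> Q.E" if "e \<in> P.E" for e using F that continuous_map_image_subset_topspace by blast
  have inj: "inj_on F P.E"
  proof (rule inj_onI)
    fix e e' assume e: "e \<in> P.E" "e' \<in> P.E" "F e = F e'"
    then have pe: "bproj P e = bproj P e'" using proj by metis
    let ?g = "P.bdiv e e'"
    have g: "?g \<in> carrier G" "bact P ?g e' = e" using P.bdiv e pe by auto
    then have "bact Q ?g (F e') = F e'" using equi e by metis
    then have "?g = \<one>\<^bsub>G\<^esub>" using Q.bdiv_eqI [of "F e'"] g FE e Q.act_one by (metis P.one_closed)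
    then show "e = e'" using g P.act_one e by simp
  qed
  have inv_eq: "inv_into P.E F q = bact P (Q.bdiv q (F e)) e"
    if "q \<in> Q.E" "e \<in> P.E" "bproj Q q = bproj P e" for q e
  proof -
    have d: "Q.bdiv q (F e) \<in> carrier G" "bact Q (Q.bdiv q (F e)) (F e) = q"
      using Q.bdiv that FE proj by auto
    then have "F (bact P (Q.bdiv q (F e)) e) = q" using equi that by simp
    then show ?thesis using inj d that P.act_in by (metis inv_into_f_f)
  qed
  have surj: "F ` P.E = Q.E"
  proof
    show "F ` P.E \<subseteq> Q.E" using FE by blast
    show "Q.E \<subseteq> F ` P.E"
    proof
      fix q assume q: "q \<in> Q.E"
      then obtain e where e: "e \<in> P.E" "bproj P e = bproj Q q" using P.proj_surj Q.proj_in by metis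
      have d: "Q.bdiv q (F e) \<in> carrier G" "bact Q (Q.bdiv q (F e)) (F e) = q"
        using Q.bdiv q e FE proj by auto
      then have "q = F (bact P (Q.bdiv q (F e)) e)" using equi e by simp
      moreover have "bact P (Q.bdiv q (F e)) e \<in> P.E" using P.act_in d(1) e(1) by simp
      ultimately show "q \<in> F ` P.E" by (rule image_eqI)
    qed
  qed
  have "continuous_map (btotal Q) (btotal P) (inv_into P.E F)"
  proof (rule continuous_map_local)
    fix q assume q: "q \<in> Q.E"
    obtain U s where U: "openin X U" "bproj Q q \<in> U" and s: "continuous_map (subtopology X U) (btotal P) s"
      "\<And>u. u \<in> U \<Longrightarrow> s u \<in> P.E" "\<And>u. u \<in> U \<Longrightarrow> bproj P (s u) = u"
      by (rule P.local_section [OF Q.proj_in [OF q]]) blast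
    define N where "N = {y \<in> Q.E. bproj Q y \<in> U}"
    have N: "openin (btotal Q) N" unfolding N_def using Q.proj_cont U(1) by (rule openin_continuous_map_preimage)
    have "continuous_map (subtopology (btotal Q) N) (subtopology X U) (bproj Q)"
      by (auto simp: continuous_map_in_subtopology N_def intro: continuous_map_from_subtopology Q.proj_cont)
    from continuous_map_compose [OF this s(1)]
    have cs: "continuous_map (subtopology (btotal Q) N) (btotal P) (\<lambda>y. s (bproj Q y))" by (simp add: o_def)
    have "continuous_map (subtopology (btotal Q) N) (btotal P)
        (\<lambda>y. bact P (Q.bdiv y (F (s (bproj Q y)))) (s (bproj Q y)))"
      using cs continuous_map_compose [OF cs F] s proj
      by (intro P.act_comp Q.bdiv_cont) (auto simp: o_def N_def continuous_map_from_subtopology)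
    then have "continuous_map (subtopology (btotal Q) N) (btotal P) (inv_into P.E F)"
    proof (rule continuous_map_eq)
      fix y assume "y \<in> topspace (subtopology (btotal Q) N)"
      then have "y \<in> Q.E" "bproj Q y \<in> U" by (auto simp: N_def)
      then show "bact P (Q.bdiv y (F (s (bproj Q y)))) (s (bproj Q y)) = inv_into P.E F y"
        using inv_eq [of y "s (bproj Q y)"] s by simp
    qed
    then show "\<exists>U. openin (btotal Q) U \<and> q \<in> U \<and> continuous_map (subtopology (btotal Q) U) (btotal P) (inv_into P.E F)"
      using N q U by (auto simp: N_def)
  qed
  then have "homeomorphic_maps (btotal P) (btotal Q) F (inv_into P.E F)"
    unfolding homeomorphic_maps_def using F inj surj
    by (metis f_inv_into_f inv_into_f_f)
  then have "homeomorphic_map (btotal P) (btotal Q) F" using homeomorphic_map_maps by blast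
  then show ?thesis using proj equi unfolding bundle_iso_def by blast
qed

section \<open>Ordered composition along a partition of unity\<close>

text \<open>The composed steps do not commute and the set of active indices changes from point to
  point. Listing every finite set along one global order makes the list of a subset a sublist, so
  that neighbouring points use compatible compositions.\<close>

lemma ex_consistent_listing:
  "\<exists>sl :: 'i set \<Rightarrow> 'i list. \<forall>A. finite A \<longrightarrow>
     set (sl A) = A \<and> distinct (sl A) \<and> (\<forall>B\<subseteq>A. sl B = filter (\<lambda>i. i \<in> B) (sl A))"
proof -
  obtain r :: "'i rel" where r: "well_order_on UNIV r" using well_order_on by blast
  define le where "le x y \<longleftrightarrow> (x, y) \<in> r" for x y
  have refl: "refl_on UNIV r" and trans: "trans r" and anti: "antisym r" and tot: "total_on UNIV r"
    using r by (auto simp: well_order_on_def linear_order_on_def partial_order_on_def preorder_on_def)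
  interpret L: linorder le "\<lambda>x y. le x y \<and> x \<noteq> y"
  proof
    show "(le x y \<and> x \<noteq> y) = (le x y \<and> \<not> le y x)" for x y
      using anti refl by (auto simp: le_def antisym_def refl_on_def)
    show "le x x" for x using refl by (simp add: le_def refl_on_def)
    show "le x y \<Longrightarrow> le y z \<Longrightarrow> le x z" for x y z using trans unfolding le_def by (rule transD)
    show "le x y \<Longrightarrow> le y x \<Longrightarrow> x = y" for x y using anti unfolding le_def by (rule antisymD)
    show "le x y \<or> le y x" for x y using tot refl by (cases "x = y") (auto simp: le_def total_on_def refl_on_def)
  qed
  have "L.sorted_list_of_set B = filter (\<lambda>i. i \<in> B) (L.sorted_list_of_set A)" if "finite A" "B \<subseteq> A" for A B
  proof (rule L.sorted_distinct_set_unique)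
    have "finite B" using that by (rule finite_subset [rotated])
    then show "L.sorted (L.sorted_list_of_set B)" "distinct (L.sorted_list_of_set B)" 
      "set (L.sorted_list_of_set B) = set (filter (\<lambda>i. i \<in> B) (L.sorted_list_of_set A))"
      using that by auto
    show "L.sorted (filter (\<lambda>i. i \<in> B) (L.sorted_list_of_set A))"
      by (intro sorted_wrt_filter) simp
    show "distinct (filter (\<lambda>i. i \<in> B) (L.sorted_list_of_set A))" using that by simp
  qed
  moreover have "set (L.sorted_list_of_set A) = A \<and> distinct (L.sorted_list_of_set A)" if "finite A" for A
    using that by simp
  ultimately show ?thesis by (intro exI [of _ L.sorted_list_of_set] allI impI conjI ballI) metis+
qed

text \<open>The state pairs the weight consumed so far with the current value. A step receives the
  weight before it, which acts as the time at which it starts.\<close>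

definition run ::
    "('i \<Rightarrow> 'x \<Rightarrow> real) \<Rightarrow> ('i \<Rightarrow> 'x \<Rightarrow> real \<Rightarrow> 'e \<Rightarrow> 'e) \<Rightarrow> ('x \<Rightarrow> 'e) \<Rightarrow> 'x \<Rightarrow> 'i list \<Rightarrow> real \<times> 'e" where
  "run lam step init x js =
     foldl (\<lambda>(a, e) i. if lam i x = 0 then (a, e) else (a + lam i x, step i x a e)) (0, init x) js"

lemma run_Nil [simp]: "run lam step init x [] = (0, init x)"
  by (simp add: run_def)

lemma run_snoc:
  "run lam step init x (js @ [i]) = (if lam i x = 0 then run lam step init x js
     else (fst (run lam step init x js) + lam i x, step i x (fst (run lam step init x js)) (snd (run lam step init x js))))"
  by (simp add: run_def case_prod_unfold)

lemma fst_run: "fst (run lam step init x js) = (\<Sum>i\<leftarrow>js. lam i x)"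
  by (induction js rule: rev_induct) (simp_all add: run_snoc)

lemma run_filter: "run lam step init x (filter (\<lambda>i. i \<in> {i\<in>I. lam i x \<noteq> 0}) js) = run lam step init x js"
  if "set js \<subseteq> I"
  using that by (induction js rule: rev_induct) (simp_all add: run_snoc)

text \<open>Indices are kept apart from the sets \<open>V i\<close>, so that a partition can be
  pulled back along a map to a bundle's total space without changing the indices or their listing
  \<open>sl\<close>.\<close>

locale partition =
  fixes X :: "'x topology" and I :: "'i set" and V :: "'i \<Rightarrow> 'x set"
    and lam :: "'i \<Rightarrow> 'x \<Rightarrow> real" and sl :: "'i set \<Rightarrow> 'i list"
  assumes openV: "\<And>i. i \<in> I \<Longrightarrow> openin X (V i)"
    and lam_cont: "\<And>i. i \<in> I \<Longrightarrow> continuous_map X euclideanreal (lam i)"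
    and lam_nonneg: "\<And>i x. 0 \<le> lam i x"
    and lam_supp: "\<And>i. i \<in> I \<Longrightarrow> X closure_of {x \<in> topspace X. lam i x \<noteq> 0} \<subseteq> V i"
    and lam_lf: "\<And>x. x \<in> topspace X \<Longrightarrow> \<exists>N. openin X N \<and> x \<in> N \<and> finite {i \<in> I. \<exists>y\<in>N. lam i y \<noteq> 0}"
    and lam_sum: "\<And>x. x \<in> topspace X \<Longrightarrow> (\<Sum>i\<in>{i\<in>I. lam i x \<noteq> 0}. lam i x) = 1"
    and sl: "\<And>A. finite A \<Longrightarrow> set (sl A) = A \<and> distinct (sl A) \<and> (\<forall>B\<subseteq>A. sl B = filter (\<lambda>i. i \<in> B) (sl A))"
begin

lemma supp_in: "i \<in> I \<Longrightarrow> x \<in> topspace X \<Longrightarrow> lam i x \<noteq> 0 \<Longrightarrow> x \<in> V i"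
  using lam_supp [of i] closure_of_subset [of "{x \<in> topspace X. lam i x \<noteq> 0}" X] by blast

lemma pullback:
  assumes q: "continuous_map Z X q"
  shows "partition Z I (\<lambda>i. {z \<in> topspace Z. q z \<in> V i}) (\<lambda>i z. lam i (q z)) sl"
proof
  have qX: "q z \<in> topspace X" if "z \<in> topspace Z" for z
    using q that continuous_map_image_subset_topspace by blast
  fix i assume i: "i \<in> I"
  show "openin Z {z \<in> topspace Z. q z \<in> V i}"
    using q openV [OF i] by (rule openin_continuous_map_preimage)
  show "continuous_map Z euclideanreal (\<lambda>z. lam i (q z))"
    using continuous_map_compose [OF q lam_cont [OF i]] by (simp add: o_def)
  have "closedin Z {z \<in> topspace Z. q z \<in> X closure_of {x \<in> topspace X. lam i x \<noteq> 0}}"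
    using q closedin_closure_of by (rule closedin_continuous_map_preimage)
  then have "Z closure_of {z \<in> topspace Z. lam i (q z) \<noteq> 0} \<subseteq>
      {z \<in> topspace Z. q z \<in> X closure_of {x \<in> topspace X. lam i x \<noteq> 0}}"
    using closure_of_subset [of "{x \<in> topspace X. lam i x \<noteq> 0}" X] qX
    by (intro closure_of_minimal) auto
  then show "Z closure_of {z \<in> topspace Z. lam i (q z) \<noteq> 0} \<subseteq> {z \<in> topspace Z. q z \<in> V i}"
    using lam_supp [OF i] by blast
next
  fix z assume z: "z \<in> topspace Z"
  then have qz: "q z \<in> topspace X" using q continuous_map_image_subset_topspace by blast
  from lam_lf [OF qz] obtain N where N: "openin X N" "q z \<in> N" and fin: "finite {i \<in> I. \<exists>y\<in>N. lam i y \<noteq> 0}"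
    by blast
  have "finite {i \<in> I. \<exists>y\<in>{z \<in> topspace Z. q z \<in> N}. lam i (q y) \<noteq> 0}"
    by (rule finite_subset [OF _ fin]) blast
  moreover have "openin Z {z \<in> topspace Z. q z \<in> N}" using q N(1) by (rule openin_continuous_map_preimage)
  ultimately show "\<exists>N. openin Z N \<and> z \<in> N \<and> finite {i \<in> I. \<exists>y\<in>N. lam i (q y) \<noteq> 0}"
    using z N(2) by blast
  show "(\<Sum>i\<in>{i\<in>I. lam i (q z) \<noteq> 0}. lam i (q z)) = 1" by (rule lam_sum [OF qz])
qed (use lam_nonneg sl in blast)+

end

lemma ex_partition:
  fixes X :: "'x topology"
  assumes X: "paracompact_space X" and \<U>: "\<And>U. U \<in> \<U> \<Longrightarrow> openin X U" "\<Union>\<U> = topspace X"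
  obtains \<V> lam sl where "partition X (\<V> :: 'x set set) (\<lambda>V. V) lam sl" "\<And>V. V \<in> \<V> \<Longrightarrow> \<exists>U\<in>\<U>. V \<subseteq> U"
proof -
  obtain sl :: "'x set set \<Rightarrow> 'x set list" where sl: "\<forall>A. finite A \<longrightarrow>
     set (sl A) = A \<and> distinct (sl A) \<and> (\<forall>B\<subseteq>A. sl B = filter (\<lambda>i. i \<in> B) (sl A))"
    using ex_consistent_listing by (rule exE)
  show thesis
  proof (rule paracompact_partition_of_unity [OF X \<U>])
    fix \<V> :: "'x set set" and lam :: "'x set \<Rightarrow> 'x \<Rightarrow> real"
    assume 1: "\<And>V. V \<in> \<V> \<Longrightarrow> openin X V" and sub: "\<And>V. V \<in> \<V> \<Longrightarrow> \<exists>U\<in>\<U>. V \<subseteq> U"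
      and 2: "\<And>V. V \<in> \<V> \<Longrightarrow> continuous_map X euclideanreal (lam V)"
      and 3: "\<And>V x. 0 \<le> lam V x"
      and 4: "\<And>V. V \<in> \<V> \<Longrightarrow> X closure_of {x \<in> topspace X. lam V x \<noteq> 0} \<subseteq> V"
      and 5: "\<And>x. x \<in> topspace X \<Longrightarrow> \<exists>N. openin X N \<and> x \<in> N \<and> finite {V \<in> \<V>. \<exists>y\<in>N. lam V y \<noteq> 0}"
      and 6: "\<And>x. x \<in> topspace X \<Longrightarrow> (\<Sum>V\<in>{V\<in>\<V>. lam V x \<noteq> 0}. lam V x) = 1"
    have "partition X \<V> (\<lambda>V. V) lam sl"
      by (rule partition.intro; (erule 1 2 4 5 6 sl [THEN spec, THEN mp] | rule 3))
    then show thesis using sub by (rule that)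
  qed
qed

text \<open>Indices with \<open>lam i x = 0\<close> are skipped, so that the outcome at \<open>x\<close> depends only on the finitely many active
  ones; \<open>step_0\<close> reconciles this with continuity at the points of \<open>V i\<close> where \<open>lam i\<close> vanishes.\<close>

locale partitioned_steps = partition X I V lam sl
  for X :: "'x topology" and I :: "'i set" and V lam sl +
  fixes Y :: "'e topology" and step :: "'i \<Rightarrow> 'x \<Rightarrow> real \<Rightarrow> 'e \<Rightarrow> 'e" and init :: "'x \<Rightarrow> 'e"
    and Inv :: "'x \<Rightarrow> real \<Rightarrow> 'e \<Rightarrow> bool"
  assumes init_cont: "continuous_map X Y init"
    and Inv_init: "\<And>x. x \<in> topspace X \<Longrightarrow> Inv x 0 (init x)"
    and Inv_step: "\<And>i x a e. i \<in> I \<Longrightarrow> x \<in> topspace X \<Longrightarrow> x \<in> V i \<Longrightarrow> 0 \<le> a \<Longrightarrow> a + lam i x \<le> 1 \<Longrightarrow> e \<in> topspace Y \<Longrightarrow>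
        Inv x a e \<Longrightarrow> Inv x (a + lam i x) (step i x a e)"
    and step_0: "\<And>i x a e. i \<in> I \<Longrightarrow> x \<in> topspace X \<Longrightarrow> x \<in> V i \<Longrightarrow> 0 \<le> a \<Longrightarrow> a \<le> 1 \<Longrightarrow> e \<in> topspace Y \<Longrightarrow>
        Inv x a e \<Longrightarrow> lam i x = 0 \<Longrightarrow> step i x a e = e"
    and step_cont: "\<And>i a F. i \<in> I \<Longrightarrow> continuous_map (subtopology X (V i)) euclideanreal a \<Longrightarrow>
        continuous_map (subtopology X (V i)) Y F \<Longrightarrow>
        (\<And>x. x \<in> V i \<Longrightarrow> 0 \<le> a x \<and> a x + lam i x \<le> 1 \<and> Inv x (a x) (F x)) \<Longrightarrow>
        continuous_map (subtopology X (V i)) Y (\<lambda>x. step i x (a x) (F x))"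
begin

definition active where "active x = {i\<in>I. lam i x \<noteq> 0}"

abbreviation total where "total x \<equiv> snd (run lam step init x (sl (active x)))"

lemma finite_active: "x \<in> topspace X \<Longrightarrow> finite (active x)"
  using lam_lf [of x] by (auto simp: active_def intro: finite_subset rev_finite_subset)

lemma sum_le_1:
  assumes x: "x \<in> topspace X" and js: "distinct js" "set js \<subseteq> I"
  shows "(\<Sum>i\<leftarrow>js. lam i x) \<le> 1" "0 \<le> (\<Sum>i\<leftarrow>js. lam i x)"
proof -
  have "(\<Sum>i\<leftarrow>js. lam i x) = (\<Sum>i\<in>set js. lam i x)"
    using js by (simp add: sum_list_distinct_conv_sum_set)
  also have "\<dots> = (\<Sum>i\<in>set js \<inter> active x. lam i x)"
    using js by (intro sum.mono_neutral_right) (auto simp: active_def)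
  also have "\<dots> \<le> (\<Sum>i\<in>active x. lam i x)"
    using finite_active [OF x] lam_nonneg by (intro sum_mono2) auto
  also have "\<dots> = 1" using lam_sum [OF x] by (simp add: active_def)
  finally show "(\<Sum>i\<leftarrow>js. lam i x) \<le> 1" .
  show "0 \<le> (\<Sum>i\<leftarrow>js. lam i x)" using lam_nonneg by (intro sum_list_nonneg) auto
qed

text \<open>The last step is continuous on \<open>V i\<close>, where by \<open>step_0\<close>
  skipping it at zero weight makes no difference, and absent off the closed support of
  \<open>lam i\<close>. These two open sets cover the space because the support lies in
  \<open>V i\<close>.\<close>

lemma run_cont_Inv:
  assumes "distinct js" "set js \<subseteq> I"
  shows "continuous_map X Y (\<lambda>x. snd (run lam step init x js)) \<and>
    (\<forall>x\<in>topspace X. Inv x (\<Sum>i\<leftarrow>js. lam i x) (snd (run lam step init x js)))"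
  using assms
proof (induction js rule: rev_induct)
  case Nil
  then show ?case using init_cont Inv_init by (simp add: eta_contract_eq)
next
  case (snoc i js)
  let ?F = "\<lambda>x. snd (run lam step init x js)" and ?a = "\<lambda>x. \<Sum>i\<leftarrow>js. lam i x"
  have js: "distinct js" "set js \<subseteq> I" and i: "i \<in> I" using snoc.prems by auto
  have c: "continuous_map X Y ?F" and Inv: "\<forall>x\<in>topspace X. Inv x (?a x) (?F x)"
    using snoc.IH [OF js] by auto
  have FY: "?F x \<in> topspace Y" if "x \<in> topspace X" for x
    using continuous_map_image_subset_topspace [OF c] that by blast
  have ac: "continuous_map X euclideanreal ?a"
    unfolding sum_list_distinct_conv_sum_set [OF js(1)] using js lam_cont by (intro continuous_map_sum) auto
  have bd: "0 \<le> ?a x" "?a x + lam i x \<le> 1" if "x \<in> topspace X" for x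
    using sum_le_1 [OF that js] sum_le_1(1) [OF that snoc.prems] by auto
  have VX: "V i \<subseteq> topspace X" using openV [OF i] by (rule openin_subset)
  have new: "snd (run lam step init x (js @ [i])) = (if lam i x = 0 then ?F x else step i x (?a x) (?F x))" for x
    by (simp add: run_snoc fst_run)
  have V_eq: "snd (run lam step init x (js @ [i])) = step i x (?a x) (?F x)" if "x \<in> V i" for x
    unfolding new using step_0 [OF i _ that, of "?a x" "?F x"] bd [of x] FY [of x] Inv that VX
    by auto
  have cV: "continuous_map (subtopology X (V i)) Y (\<lambda>x. snd (run lam step init x (js @ [i])))"
  proof (rule continuous_map_eq)
    show "continuous_map (subtopology X (V i)) Y (\<lambda>x. step i x (?a x) (?F x))"
      using bd Inv VX by (intro step_cont i continuous_map_from_subtopology ac c) auto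
  qed (use V_eq in auto)
  let ?O = "topspace X - X closure_of {x \<in> topspace X. lam i x \<noteq> 0}"
  have cO: "continuous_map (subtopology X ?O) Y (\<lambda>x. snd (run lam step init x (js @ [i])))"
  proof (rule continuous_map_eq)
    show "continuous_map (subtopology X ?O) Y ?F" by (intro continuous_map_from_subtopology c)
    show "?F x = snd (run lam step init x (js @ [i]))" if "x \<in> topspace (subtopology X ?O)" for x
      using that closure_of_subset [of "{x \<in> topspace X. lam i x \<noteq> 0}" X] by (auto simp: new)
  qed
  have "continuous_map X Y (\<lambda>x. snd (run lam step init x (js @ [i])))"
  proof (rule continuous_map_local)
    fix x assume x: "x \<in> topspace X"
    show "\<exists>U. openin X U \<and> x \<in> U \<and> continuous_map (subtopology X U) Y (\<lambda>x. snd (run lam step init x (js @ [i])))"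
    proof (cases "x \<in> V i")
      case True then show ?thesis using cV openV [OF i] by blast
    next
      case False
      then have "x \<in> ?O" using lam_supp [OF i] x by blast
      moreover have "openin X ?O" by (intro openin_diff openin_topspace closedin_closure_of)
      ultimately show ?thesis using cO by blast
    qed
  qed
  moreover have "Inv x (\<Sum>i\<leftarrow>js @ [i]. lam i x) (snd (run lam step init x (js @ [i])))" if x: "x \<in> topspace X" for x
    using Inv_step [OF i x supp_in [OF i x], of "?a x" "?F x"] bd [OF x] FY [OF x] Inv x by (simp add: new)
  ultimately show ?case by blast
qed

text \<open>Near a point, one finite list of all indices that are active somewhere in the
  neighbourhood computes \<open>total\<close>, since at each point the inactive ones are skipped and
  the rest come in the order of \<open>sl (active y)\<close>.\<close>

lemma total_cont: "continuous_map X Y total"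
proof (rule continuous_map_local)
  fix x assume x: "x \<in> topspace X"
  obtain N where N: "openin X N" "x \<in> N" and fin: "finite {i \<in> I. \<exists>y\<in>N. lam i y \<noteq> 0}"
    using lam_lf [OF x] by blast
  let ?J = "{i \<in> I. \<exists>y\<in>N. lam i y \<noteq> 0}"
  have J: "distinct (sl ?J)" "set (sl ?J) \<subseteq> I" using sl [OF fin] by blast+
  have "continuous_map (subtopology X N) Y (\<lambda>y. snd (run lam step init y (sl ?J)))"
    using run_cont_Inv [OF J] by (intro continuous_map_from_subtopology) blast
  moreover have "snd (run lam step init y (sl ?J)) = total y" if "y \<in> N" for y
  proof -
    have "active y \<subseteq> ?J" using that by (auto simp: active_def)
    then have "sl (active y) = filter (\<lambda>i. i \<in> active y) (sl ?J)" using sl [OF fin] by blast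
    then show ?thesis
      using run_filter [OF J(2), where lam = lam and x = y and step = step and init = init]
      unfolding active_def by simp
  qed
  ultimately have "continuous_map (subtopology X N) Y total" by (rule continuous_map_eq) auto
  then show "\<exists>U. openin X U \<and> x \<in> U \<and> continuous_map (subtopology X U) Y total" using N by blast
qed

lemma total_Inv: "Inv x 1 (total x)" if x: "x \<in> topspace X"
proof -
  have J: "distinct (sl (active x))" "set (sl (active x)) = active x" using sl [OF finite_active [OF x]] by blast+
  then have "(\<Sum>i\<leftarrow>sl (active x). lam i x) = 1"
    using lam_sum [OF x] by (simp add: sum_list_distinct_conv_sum_set active_def)
  then show ?thesis using run_cont_Inv [of "sl (active x)"] J x by (auto simp: active_def)
qed

text \<open>An induction principle for comparing the runs at two points with equal weights. It is
  used for a point of a bundle and its translate, to show that the total is equivariant. The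
  relation may depend on the weight consumed.\<close>

lemma total_rel:
  assumes x: "x \<in> topspace X" "x' \<in> topspace X" and eq: "\<And>i. i \<in> I \<Longrightarrow> lam i x' = lam i x"
    and R0: "R 0 (init x) (init x')"
    and Rs: "\<And>i a e e'. i \<in> I \<Longrightarrow> x \<in> V i \<Longrightarrow> x' \<in> V i \<Longrightarrow> 0 \<le> a \<Longrightarrow> a + lam i x \<le> 1 \<Longrightarrow>
      e \<in> topspace Y \<Longrightarrow> e' \<in> topspace Y \<Longrightarrow> Inv x a e \<Longrightarrow> Inv x' a e' \<Longrightarrow> R a e e' \<Longrightarrow>
      R (a + lam i x) (step i x a e) (step i x' a e')"
  shows "R 1 (total x) (total x')"
proof -
  have *: "R (\<Sum>i\<leftarrow>js. lam i x) (snd (run lam step init x js)) (snd (run lam step init x' js))"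
    if "distinct js" "set js \<subseteq> I" for js
    using that
  proof (induction js rule: rev_induct)
    case Nil
    then show ?case using R0 by simp
  next
    case (snoc i js)
    have js: "distinct js" "set js \<subseteq> I" and i: "i \<in> I" using snoc.prems by auto
    have c: "continuous_map X Y (\<lambda>x. snd (run lam step init x js))"
      and Inv: "\<forall>x\<in>topspace X. Inv x (\<Sum>i\<leftarrow>js. lam i x) (snd (run lam step init x js))"
      using run_cont_Inv [OF js] by auto
    have FY: "snd (run lam step init x js) \<in> topspace Y" if "x \<in> topspace X" for x
      using continuous_map_image_subset_topspace [OF c] that by blast
    have eqs: "(\<Sum>i\<leftarrow>js. lam i x') = (\<Sum>i\<leftarrow>js. lam i x)"
      using eq js by (intro arg_cong [where f = sum_list] map_cong) auto
    show ?case
    proof (cases "lam i x = 0")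
      case True
      then show ?thesis using snoc.IH [OF js] eq [OF i] by (simp add: run_snoc)
    next
      case False
      have "R ((\<Sum>i\<leftarrow>js. lam i x) + lam i x)
         (step i x (\<Sum>i\<leftarrow>js. lam i x) (snd (run lam step init x js)))
         (step i x' (\<Sum>i\<leftarrow>js. lam i x) (snd (run lam step init x' js)))"
      proof (rule Rs [OF i])
        show "x \<in> V i" "x' \<in> V i" using False eq [OF i] supp_in [OF i] x by auto
        show "0 \<le> (\<Sum>i\<leftarrow>js. lam i x)" using sum_le_1 [OF x(1) js] by blast
        show "(\<Sum>i\<leftarrow>js. lam i x) + lam i x \<le> 1" using sum_le_1(1) [OF x(1) snoc.prems] by simp
        show "Inv x' (\<Sum>i\<leftarrow>js. lam i x) (snd (run lam step init x' js))" using Inv x eqs by metis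
      qed (use x FY Inv snoc.IH [OF js] in blast)+
      then show ?thesis using False eq [OF i] by (simp add: run_snoc fst_run eqs)
    qed
  qed
  have act: "active x' = active x" using eq by (auto simp: active_def)
  have J: "distinct (sl (active x))" "set (sl (active x)) = active x" using sl [OF finite_active [OF x(1)]] by blast+
  then have "(\<Sum>i\<leftarrow>sl (active x). lam i x) = 1"
    using lam_sum [OF x(1)] by (simp add: sum_list_distinct_conv_sum_set active_def)
  then show ?thesis using * [of "sl (active x)"] J act by (auto simp: active_def)
qed

end

section \<open>Homotopy invariance of pullbacks\<close>

lemma continuous_map_pair_subtopologies:
  assumes "continuous_map Z euclidean p" "continuous_map Z Y q"
    and "\<And>z. z \<in> topspace Z \<Longrightarrow> p z \<in> S \<and> q z \<in> W"
  shows "continuous_map Z (prod_topology (top_of_set S) (subtopology Y W)) (\<lambda>z. (p z, q z))"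
  using assms by (intro continuous_map_pairedI) (auto simp: continuous_map_in_subtopology)

text \<open>Near one point of \<open>Y\<close> the homotopy lifts for all times at once. Lifts exist
  for short times by local sections, adjacent ones can be glued, and compactness of the interval is
  used in the form of Bolzano's bisection.\<close>

lemma (in principal_bundle_on) local_lift:
  fixes Y :: "'y topology"
  assumes h: "continuous_map (prod_topology (top_of_set {0..1::real}) Y) X h" and y: "y \<in> topspace Y"
  shows "\<exists>W s. openin Y W \<and> y \<in> W \<and>
    continuous_map (prod_topology (top_of_set {0..1}) (subtopology Y W)) (btotal P) s \<and>
    (\<forall>t\<in>{0..1}. \<forall>w\<in>W. bproj P (s (t, w)) = h (t, w))"
proof -
  \<comment> \<open>Bisection speaks of arbitrary real intervals, so they are intersected with
    \<open>{0..1}\<close>. If the common end point falls outside, one of the two halves already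
    covers everything.\<close>
  define L where "L a b \<longleftrightarrow> (\<exists>W s. openin Y W \<and> y \<in> W \<and>
      continuous_map (prod_topology (top_of_set ({a..b} \<inter> {0..1})) (subtopology Y W)) (btotal P) s \<and>
      (\<forall>t\<in>{a..b} \<inter> {0..1}. \<forall>w\<in>W. bproj P (s (t, w)) = h (t, w)))" for a b :: real
  have "(0::real) \<le> 1" by simp
  then have "L 0 1"
  proof (induction rule: Bolzano)
    case (trans a b c)
    consider "b < 0" | "b > 1" | "0 \<le> b" "b \<le> 1" by linarith
    then show ?case
    proof cases
      case 1
      then have eq: "{a..c} \<inter> {0..1} = {b..c} \<inter> {0..1}" using trans by auto
      show ?thesis using trans(2) unfolding L_def eq .
    next
      case 2
      then have eq: "{a..c} \<inter> {0..1} = {a..b} \<inter> {0..1}" using trans by auto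
      show ?thesis using trans(1) unfolding L_def eq .
    next
      case 3
      obtain W1 s1 where 1: "openin Y W1" "y \<in> W1"
        and c1: "continuous_map (prod_topology (top_of_set ({a..b} \<inter> {0..1})) (subtopology Y W1)) (btotal P) s1"
        and p1: "\<forall>t\<in>{a..b} \<inter> {0..1}. \<forall>w\<in>W1. bproj P (s1 (t, w)) = h (t, w)"
        using trans(1) unfolding L_def by (elim exE conjE) (rule that)
      obtain W2 s2 where 2: "openin Y W2" "y \<in> W2"
        and c2: "continuous_map (prod_topology (top_of_set ({b..c} \<inter> {0..1})) (subtopology Y W2)) (btotal P) s2"
        and p2: "\<forall>t\<in>{b..c} \<inter> {0..1}. \<forall>w\<in>W2. bproj P (s2 (t, w)) = h (t, w)"
        using trans(2) unfolding L_def by (elim exE conjE) (rule that)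
      define W where "W = W1 \<inter> W2"
      let ?Z = "prod_topology (top_of_set ({a..c} \<inter> {0..1})) (subtopology Y W)"
      have W: "openin Y W" "y \<in> W" using 1 2 by (auto simp: W_def)
      have WY: "W \<subseteq> topspace Y" using W(1) by (rule openin_subset)
      have E1: "s1 (t, w) \<in> E" if "t \<in> {a..b} \<inter> {0..1}" "w \<in> W" for t w
      proof -
        have "(t, w) \<in> topspace (prod_topology (top_of_set ({a..b} \<inter> {0..1})) (subtopology Y W1))"
          using that WY by (auto simp: W_def)
        then show ?thesis using continuous_map_image_subset_topspace [OF c1] by blast
      qed
      have E2: "s2 (t, w) \<in> E" if "t \<in> {b..c} \<inter> {0..1}" "w \<in> W" for t w
      proof -
        have "(t, w) \<in> topspace (prod_topology (top_of_set ({b..c} \<inter> {0..1})) (subtopology Y W2))"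
          using that WY by (auto simp: W_def)
        then show ?thesis using continuous_map_image_subset_topspace [OF c2] by blast
      qed
      \<comment> \<open>From time \<open>b\<close> on, the second lift is translated within its
        fibres by the quotient at time \<open>b\<close>, which makes it agree with the first lift
        there.\<close>
      define s where "s p = (if fst p \<le> b then s1 p
          else bact P (bdiv (s1 (b, snd p)) (s2 (b, snd p))) (s2 p))" for p
      have cfst: "continuous_map ?Z euclideanreal fst"
        using continuous_map_fst continuous_map_into_fulltopology by blast
      have csnd: "continuous_map ?Z Y snd"
        using continuous_map_snd continuous_map_into_fulltopology by blast
      have s1': "continuous_map Z' (btotal P) (\<lambda>z. s1 (p z, q z))"
        if "continuous_map Z' euclidean p" "continuous_map Z' Y q"
          "\<And>z. z \<in> topspace Z' \<Longrightarrow> p z \<in> {a..b} \<inter> {0..1} \<and> q z \<in> W1" for Z' :: "(real \<times> 'y) topology" and p q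
        using continuous_map_compose [OF continuous_map_pair_subtopologies [OF that] c1] by (simp add: o_def)
      have s2': "continuous_map Z' (btotal P) (\<lambda>z. s2 (p z, q z))"
        if "continuous_map Z' euclidean p" "continuous_map Z' Y q"
          "\<And>z. z \<in> topspace Z' \<Longrightarrow> p z \<in> {b..c} \<inter> {0..1} \<and> q z \<in> W2" for Z' :: "(real \<times> 'y) topology" and p q
        using continuous_map_compose [OF continuous_map_pair_subtopologies [OF that] c2] by (simp add: o_def)
      have "continuous_map ?Z (btotal P) s"
        unfolding s_def
      proof (rule continuous_map_cases_le)
        show "continuous_map ?Z euclideanreal fst" by (rule cfst)
        show "continuous_map (subtopology ?Z {x \<in> topspace ?Z. fst x \<le> b}) (btotal P) s1"
          using s1' [OF continuous_map_from_subtopology [OF cfst] continuous_map_from_subtopology [OF csnd],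
              of "{x \<in> topspace ?Z. fst x \<le> b}"] WY
          by (auto simp: W_def)
        have "continuous_map (subtopology ?Z {x \<in> topspace ?Z. b \<le> fst x}) (btotal P)
            (\<lambda>p. bact P (bdiv (s1 (b, snd p)) (s2 (b, snd p))) (s2 (fst p, snd p)))"
        proof (intro act_comp bdiv_cont s1' s2' continuous_map_from_subtopology cfst csnd)
          fix z assume "z \<in> topspace (subtopology ?Z {x \<in> topspace ?Z. b \<le> fst x})"
          then show "bproj P (s1 (b, snd z)) = bproj P (s2 (b, snd z))"
            using p1 p2 3 trans by (auto simp: W_def)
        qed (use 3 trans in \<open>auto simp: W_def\<close>)
        then show "continuous_map (subtopology ?Z {x \<in> topspace ?Z. b \<le> fst x}) (btotal P)
            (\<lambda>p. bact P (bdiv (s1 (b, snd p)) (s2 (b, snd p))) (s2 p))" by simp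
        fix z assume z: "z \<in> topspace ?Z" "fst z = b"
        then obtain w where w: "z = (b, w)" "w \<in> W" by (cases z) auto
        show "s1 z = bact P (bdiv (s1 (b, snd z)) (s2 (b, snd z))) (s2 z)"
          using bdiv(2) [of "s1 (b, w)" "s2 (b, w)"] E1 [of b w] E2 [of b w] w p1 p2 3 trans
          by (auto simp: W_def)
      qed auto
      moreover have "bproj P (s (t, w)) = h (t, w)" if t: "t \<in> {a..c} \<inter> {0..1}" and w: "w \<in> W" for t w
      proof (cases "t \<le> b")
        case True
        then show ?thesis using t w p1 by (simp add: s_def W_def)
      next
        case False
        have "bdiv (s1 (b, w)) (s2 (b, w)) \<in> carrier G"
          using bdiv(1) [of "s1 (b, w)" "s2 (b, w)"] E1 [of b w] E2 [of b w] w p1 p2 3 trans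
          by (auto simp: W_def)
        then show ?thesis using False t w p2 E2 [of t w] by (simp add: s_def W_def proj_act)
      qed
      ultimately show ?thesis using W unfolding L_def by blast
    qed
  next
    case (local x)
    then have x: "x \<in> {0..1}" by simp
    let ?Z = "prod_topology (top_of_set {0..1}) Y"
    have "h (x, y) \<in> topspace X" using continuous_map_image_subset_topspace [OF h] x y by auto
    then obtain U \<sigma> where U: "openin X U" "h (x, y) \<in> U" and c\<sigma>: "continuous_map (subtopology X U) (btotal P) \<sigma>"
      and \<sigma>: "\<And>u. u \<in> U \<Longrightarrow> \<sigma> u \<in> E" "\<And>u. u \<in> U \<Longrightarrow> bproj P (\<sigma> u) = u"
      by (rule local_section) blast
    have "openin ?Z {p \<in> topspace ?Z. h p \<in> U}" using h U(1) by (rule openin_continuous_map_preimage)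
    moreover have "(x, y) \<in> {p \<in> topspace ?Z. h p \<in> U}" using x y U by simp
    ultimately obtain A W where A: "openin (top_of_set {0..1}) A" "x \<in> A" and W: "openin Y W" "y \<in> W"
      and AW: "A \<times> W \<subseteq> {p \<in> topspace ?Z. h p \<in> U}"
      unfolding openin_prod_topology_alt by meson
    obtain d where d: "d > 0" "\<And>t. t \<in> {0..1} \<Longrightarrow> dist t x < d \<Longrightarrow> t \<in> A"
      using A unfolding openin_euclidean_subtopology_iff by meson
    have "L a b" if ab: "a \<le> x \<and> x \<le> b \<and> b - a < d" for a b
    proof -
      let ?Z' = "prod_topology (top_of_set ({a..b} \<inter> {0..1})) (subtopology Y W)"
      have hU: "h (t, w) \<in> U" if "t \<in> {a..b} \<inter> {0..1}" "w \<in> W" for t w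
      proof -
        have "t \<in> A" using d(2) [of t] that ab by (auto simp: dist_real_def)
        then show ?thesis using AW that by blast
      qed
      have "continuous_map ?Z' ?Z (\<lambda>z. (fst z, snd z))"
      proof (rule continuous_map_pairedI)
        have "continuous_map ?Z' euclideanreal fst"
          using continuous_map_fst continuous_map_into_fulltopology by blast
        then show "continuous_map ?Z' (top_of_set {0..1}) fst" by (auto simp: continuous_map_in_subtopology)
        show "continuous_map ?Z' Y snd"
          using continuous_map_snd continuous_map_into_fulltopology by blast
      qed
      from continuous_map_compose [OF this h]
      have "continuous_map ?Z' X h" by (simp add: o_def)
      then have "continuous_map ?Z' (subtopology X U) h"
        using hU by (auto simp: continuous_map_in_subtopology)
      from continuous_map_compose [OF this c\<sigma>]
      have "continuous_map ?Z' (btotal P) (\<lambda>z. \<sigma> (h z))" by (simp add: o_def)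
      then show ?thesis using W hU \<sigma> unfolding L_def by blast
    qed
    then show ?case using d(1) by blast
  qed
  then show ?thesis by (simp add: L_def)
qed

text \<open>A point \<open>(y, e)\<close> is carried along the homotopy from time 0 to time 1. Each
  active set moves it for a time equal to its weight at \<open>y\<close>, and the weights add up to
  1. The run takes place over the total space of the pullback, so that dependence on the starting
  point \<open>e\<close> is covered by the same continuity statement.\<close>

lemma (in principal_bundle_on) homotopic_imp_bundle_iso:
  fixes Y :: "'y topology"
  assumes Y: "paracompact_space Y" and hom: "homotopic_with (\<lambda>_. True) Y X f f'"
  shows "bundle_iso G (pullback Y f P) (pullback Y f' P)"
proof -
  obtain h where h: "continuous_map (prod_topology (top_of_set {0..1::real}) Y) X h"
    and h0: "\<And>x. h (0, x) = f x" and h1: "\<And>x. h (1, x) = f' x"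
    using hom unfolding homotopic_with_def by blast
  have f: "continuous_map Y X f" and f': "continuous_map Y X f'"
    using homotopic_with_imp_continuous_maps [OF hom] by auto
  define lift where "lift W s \<longleftrightarrow> continuous_map (prod_topology (top_of_set {0..1::real}) (subtopology Y W)) (btotal P) s \<and>
    (\<forall>t\<in>{0..1}. \<forall>w\<in>W. bproj P (s (t, w)) = h (t, w))" for W s
  define \<U> where "\<U> = {W. openin Y W \<and> (\<exists>s. lift W s)}"
  have \<U>: "\<And>U. U \<in> \<U> \<Longrightarrow> openin Y U" by (simp add: \<U>_def)
  have "\<Union>\<U> = topspace Y"
  proof
    show "\<Union>\<U> \<subseteq> topspace Y" using \<U> openin_subset by blast
    show "topspace Y \<subseteq> \<Union>\<U>"
    proof
      fix y assume "y \<in> topspace Y"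
      from local_lift [OF h this] show "y \<in> \<Union>\<U>" unfolding \<U>_def lift_def by blast
    qed
  qed
  from ex_partition [OF Y \<U> this] obtain \<V> lam sl where part: "partition Y \<V> (\<lambda>V. V) lam sl"
    and sub: "\<And>V. V \<in> \<V> \<Longrightarrow> \<exists>U\<in>\<U>. V \<subseteq> U" by metis
  have "\<exists>s. lift V s" if V: "V \<in> \<V>" for V
  proof -
    obtain U s where U: "V \<subseteq> U" "lift U s" using sub [OF V] unfolding \<U>_def by blast
    have "continuous_map (prod_topology (top_of_set {0..1::real}) (subtopology Y V)) (prod_topology (top_of_set {0..1::real}) (subtopology Y U)) (\<lambda>z. (fst z, snd z))"
    proof (rule continuous_map_pair_subtopologies)
      show "continuous_map (prod_topology (top_of_set {0..1::real}) (subtopology Y V)) euclideanreal fst"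
        using continuous_map_fst continuous_map_into_fulltopology by blast
      show "continuous_map (prod_topology (top_of_set {0..1::real}) (subtopology Y V)) Y snd"
        using continuous_map_snd continuous_map_into_fulltopology by blast
    qed (use U(1) in auto)
    then have "continuous_map (prod_topology (top_of_set {0..1::real}) (subtopology Y V)) (btotal P) s"
      using continuous_map_compose [of _ _ "\<lambda>z. (fst z, snd z)" "btotal P" s] U(2) by (fastforce simp: lift_def o_def)
    then show ?thesis using U unfolding lift_def by blast
  qed
  then obtain S where S: "\<And>V. V \<in> \<V> \<Longrightarrow> lift V (S V)" by metis
  define Q where "Q = pullback Y f P"
  have Qt: "btotal Q = subtopology (prod_topology Y (btotal P)) {(x, e). f x = bproj P e}"
    and Qp: "bproj Q = fst" and Qa: "bact Q = (\<lambda>g (x, e). (x, bact P g e))"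
    by (simp_all add: pullback_def Q_def)
  have QE: "topspace (btotal Q) = {(x, e). x \<in> topspace Y \<and> e \<in> E \<and> f x = bproj P e}"
    by (auto simp: Qt)
  have cf: "continuous_map (btotal Q) Y fst" and cs: "continuous_map (btotal Q) (btotal P) snd"
    unfolding Qt by (auto intro: continuous_map_from_subtopology continuous_map_fst continuous_map_snd)
  have S_cont: "continuous_map Z (btotal P) (\<lambda>z. S V (p z, q z))"
    if "V \<in> \<V>" "continuous_map Z euclidean p" "continuous_map Z Y q"
      "\<And>z. z \<in> topspace Z \<Longrightarrow> p z \<in> {0..1} \<and> q z \<in> V" for V p q and Z :: "('y \<times> 'e) topology"
    using continuous_map_compose [OF continuous_map_pair_subtopologies [OF that(2-4)], of "btotal P" "S V"] S [OF that(1)]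
    by (simp add: lift_def o_def)
  have S_proj: "bproj P (S V (t, w)) = h (t, w)" if "V \<in> \<V>" "t \<in> {0..1}" "w \<in> V" for V t w
    using S [OF that(1)] that(2,3) by (simp add: lift_def)
  have VY: "V \<subseteq> topspace Y" if "V \<in> \<V>" for V
    using partition.openV [OF part that] by (rule openin_subset)
  have S_E: "S V (t, w) \<in> E" if V: "V \<in> \<V>" and "t \<in> {0..1}" "w \<in> V" for V t w
  proof -
    have "continuous_map (prod_topology (top_of_set {0..1::real}) (subtopology Y V)) (btotal P) (S V)"
      using S [OF V] by (simp add: lift_def)
    moreover have "(t, w) \<in> topspace (prod_topology (top_of_set {0..1::real}) (subtopology Y V))"
      using that VY [OF V] by auto
    ultimately show ?thesis using continuous_map_image_subset_topspace by blast
  qed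
  \<comment> \<open>The equivariant motion that takes \<open>S V (a, y)\<close> to
    \<open>S V (a + lam V y, y)\<close> with \<open>y = fst z\<close>, applied to
    \<open>e\<close>.\<close>
  define step where "step V z a e = bact P (bdiv e (S V (a, fst z))) (S V (a + lam V (fst z), fst z))" for V and z :: "'y \<times> 'e" and a e
  \<comment> \<open>With weight \<open>a\<close> consumed, the point has been carried to time
    \<open>a\<close> of the homotopy.\<close>
  define Inv where "Inv z a e \<longleftrightarrow> bproj P e = h (a, fst z)" for z :: "'y \<times> 'e" and a e
  have bd: "bdiv e (S V (a, y)) \<in> carrier G" "bact P (bdiv e (S V (a, y))) (S V (a, y)) = e"
    if "V \<in> \<V>" "a \<in> {0..1}" "y \<in> V" "e \<in> E" "bproj P e = h (a, y)" for V a y e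
    using bdiv [of e "S V (a, y)"] S_proj [OF that(1-3)] S_E [OF that(1-3)] that(4,5) by auto
  interpret Z: partition "btotal Q" \<V> "\<lambda>V. {z \<in> topspace (btotal Q). fst z \<in> V}" "\<lambda>V z. lam V (fst z)" sl
    using partition.pullback [OF part cf] .
  interpret Z: partitioned_steps "btotal Q" \<V> "\<lambda>V. {z \<in> topspace (btotal Q). fst z \<in> V}" "\<lambda>V z. lam V (fst z)" sl
    "btotal P" step snd Inv
  proof
    show "continuous_map (btotal Q) (btotal P) snd" by (rule cs)
    show "Inv z 0 (snd z)" if "z \<in> topspace (btotal Q)" for z
      using that unfolding QE by (auto simp: Inv_def h0)
  next
    fix V z a e assume A: "V \<in> \<V>" "z \<in> {z \<in> topspace (btotal Q). fst z \<in> V}" "0 \<le> a" "a + lam V (fst z) \<le> 1"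
      "e \<in> E" "Inv z a e"
    have a: "a \<in> {0..1}" "a + lam V (fst z) \<in> {0..1}" using A Z.lam_nonneg [of V z] by auto
    show "Inv z (a + lam V (fst z)) (step V z a e)"
      using A a bd(1) [of V a "fst z" e] S_E [of V "a + lam V (fst z)" "fst z"] S_proj [of V "a + lam V (fst z)" "fst z"]
      by (simp add: Inv_def step_def proj_act)
  next
    fix V z a e assume A: "V \<in> \<V>" "z \<in> {z \<in> topspace (btotal Q). fst z \<in> V}" "0 \<le> a" "a \<le> 1"
      "e \<in> E" "Inv z a e" "lam V (fst z) = 0"
    then show "step V z a e = e" using bd(2) [of V a "fst z" e] by (simp add: Inv_def step_def)
  next
    fix V a F
    assume V: "V \<in> \<V>" and a: "continuous_map (subtopology (btotal Q) {z \<in> topspace (btotal Q). fst z \<in> V}) euclideanreal a"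
      and F: "continuous_map (subtopology (btotal Q) {z \<in> topspace (btotal Q). fst z \<in> V}) (btotal P) F"
      and inv: "\<And>z. z \<in> {z \<in> topspace (btotal Q). fst z \<in> V} \<Longrightarrow> 0 \<le> a z \<and> a z + lam V (fst z) \<le> 1 \<and> Inv z (a z) (F z)"
    let ?Z = "subtopology (btotal Q) {z \<in> topspace (btotal Q). fst z \<in> V}"
    have l: "continuous_map ?Z euclideanreal (\<lambda>z. lam V (fst z))"
      by (intro continuous_map_from_subtopology Z.lam_cont V)
    have a01: "0 \<le> a z \<and> a z \<le> 1 \<and> 0 \<le> a z + lam V (fst z) \<and> a z + lam V (fst z) \<le> 1 \<and> fst z \<in> V \<and> Inv z (a z) (F z)"
      if "z \<in> topspace ?Z" for z
      using inv [of z] that Z.lam_nonneg [of V z] by auto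
    show "continuous_map ?Z (btotal P) (\<lambda>z. step V z (a z) (F z))"
      unfolding step_def
    proof (intro act_comp bdiv_cont S_cont V F continuous_map_add a l continuous_map_from_subtopology cf)
      show "bproj P (F z) = bproj P (S V (a z, fst z))" if "z \<in> topspace ?Z" for z
        using a01 [OF that] S_proj [OF V, of "a z" "fst z"] by (simp add: Inv_def)
      show "a z \<in> {0..1} \<and> fst z \<in> V" "a z + lam V (fst z) \<in> {0..1} \<and> fst z \<in> V" if "z \<in> topspace ?Z" for z
        using a01 [OF that] by simp_all
    qed
  qed
  have tE: "Z.total z \<in> E" if "z \<in> topspace (btotal Q)" for z
    using continuous_map_image_subset_topspace [OF Z.total_cont] that by blast
  have "bundle_iso G Q (pullback Y f' P)"
  proof (rule bundle_isoI [where F = "\<lambda>z. (fst z, Z.total z)"])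
    show "topological_group G T" by (rule topological_group)
    show "principal_bundle G T Y Q" unfolding Q_def by (rule principal_pullback [OF f])
    show "principal_bundle G T Y (pullback Y f' P)" by (rule principal_pullback [OF f'])
    have "continuous_map (btotal Q) (prod_topology Y (btotal P)) (\<lambda>z. (fst z, Z.total z))"
      by (intro continuous_map_pairedI cf Z.total_cont)
    then show "continuous_map (btotal Q) (btotal (pullback Y f' P)) (\<lambda>z. (fst z, Z.total z))"
      using Z.total_Inv by (auto simp: pullback_def continuous_map_in_subtopology Inv_def h1)
    show "bproj (pullback Y f' P) (fst z, Z.total z) = bproj Q z" for z by (simp add: pullback_def Qp)
    fix z g assume z: "z \<in> topspace (btotal Q)" and g: "g \<in> carrier G"
    have z': "bact Q g z \<in> topspace (btotal Q)" "fst (bact Q g z) = fst z" "snd (bact Q g z) = bact P g (snd z)"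
      using z g unfolding QE by (auto simp: Qa act_in proj_act)
    \<comment> \<open>\<open>z\<close> and its translate lie over the same point of
      \<open>Y\<close>, so both runs use the same lifts at the same times, and division commutes
      with translation.\<close>
    have "Z.total (bact Q g z) = bact P g (Z.total z)"
    proof (rule Z.total_rel [where R = "\<lambda>a e e'. e' = bact P g e", OF z z'(1)])
      fix V a e e' assume A: "V \<in> \<V>" "z \<in> {z \<in> topspace (btotal Q). fst z \<in> V}" "0 \<le> a" "a + lam V (fst z) \<le> 1"
        "e \<in> E" "Inv z a e" "e' = bact P g e"
      have a: "a \<in> {0..1}" "a + lam V (fst z) \<in> {0..1}" using A Z.lam_nonneg [of V z] by auto
      have s: "S V (a, fst z) \<in> E" "S V (a + lam V (fst z), fst z) \<in> E" "bproj P (S V (a, fst z)) = bproj P e"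
        using A a S_E S_proj by (auto simp: Inv_def)
      show "step V (bact Q g z) a e' = bact P g (step V z a e)"
        using A a s g bd(1) [of V a "fst z" e] by (simp add: step_def z' bdiv_act act_mult Inv_def)
    qed (use z' in simp_all)
    then show "(fst (bact Q g z), Z.total (bact Q g z)) = bact (pullback Y f' P) g (fst z, Z.total z)"
      by (simp add: pullback_def z')
  qed
  then show ?thesis by (simp add: Q_def)
qed

section \<open>Principal bundles with an equivariant mixing\<close>

text \<open>In the intended model \<open>mix s e e'\<close> agrees with \<open>e\<close> on the
  first portion of \<Omega>, of measure \<open>s\<close>, and with \<open>e'\<close> on the rest.
  \<open>mix_mix\<close> says that what lies beyond \<open>s\<close> is forgotten when it is
  overwritten. The classification needs nothing else of random elements.\<close>

locale mixing_bundle = principal_bundle_on G T B U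
  for G :: "('g, 'm) monoid_scheme" (structure) and T :: "'g topology" and B :: "'b topology"
    and U :: "('g, 'e, 'b) gbundle" +
  fixes mix :: "real \<Rightarrow> 'e \<Rightarrow> 'e \<Rightarrow> 'e" and b0 :: 'e
  assumes b0: "b0 \<in> topspace (btotal U)"
    and mix_cont: "continuous_map (prod_topology (top_of_set {0..1::real}) (prod_topology (btotal U) (btotal U))) (btotal U)
        (\<lambda>(s, e, e'). mix s e e')"
    and mix_0: "\<And>e e'. e \<in> topspace (btotal U) \<Longrightarrow> e' \<in> topspace (btotal U) \<Longrightarrow> mix 0 e e' = e'"
    and mix_1: "\<And>e e'. e \<in> topspace (btotal U) \<Longrightarrow> e' \<in> topspace (btotal U) \<Longrightarrow> mix 1 e e' = e"
    and mix_mix: "\<And>s e e' e''. s \<in> {0..1} \<Longrightarrow> e \<in> topspace (btotal U) \<Longrightarrow> e' \<in> topspace (btotal U) \<Longrightarrow>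
        e'' \<in> topspace (btotal U) \<Longrightarrow> mix s (mix s e e') e'' = mix s e e''"
    and act_mix: "\<And>s e e' g. s \<in> {0..1} \<Longrightarrow> g \<in> carrier G \<Longrightarrow> e \<in> topspace (btotal U) \<Longrightarrow> e' \<in> topspace (btotal U) \<Longrightarrow>
        bact U g (mix s e e') = mix s (bact U g e) (bact U g e')"
begin

lemma mix_comp:
  assumes "continuous_map Z euclideanreal s" "\<And>z. z \<in> topspace Z \<Longrightarrow> s z \<in> {0..1}"
    and "continuous_map Z (btotal U) a" "continuous_map Z (btotal U) b"
  shows "continuous_map Z (btotal U) (\<lambda>z. mix (s z) (a z) (b z))"
proof -
  have "continuous_map Z (prod_topology (top_of_set {0..1::real}) (prod_topology (btotal U) (btotal U))) (\<lambda>z. (s z, a z, b z))"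
    using assms by (intro continuous_map_pairedI) (auto simp: continuous_map_in_subtopology)
  from continuous_map_compose [OF this mix_cont] show ?thesis by (simp add: o_def)
qed

lemma mix_in: "s \<in> {0..1} \<Longrightarrow> e \<in> E \<Longrightarrow> e' \<in> E \<Longrightarrow> mix s e e' \<in> E"
  using continuous_map_image_subset_topspace [OF mix_cont] by (force simp: image_subset_iff)

text \<open>The isomorphism gives for every \<open>e\<close> over \<open>f x\<close> a point
  \<open>\<beta> x e\<close> over \<open>f' x\<close>. The path that mixes the two depends
  equivariantly on \<open>e\<close>, so its projection to the base depends on \<open>x\<close>
  only.\<close>

lemma bundle_iso_imp_homotopic:
  assumes f: "continuous_map X B f" and f': "continuous_map X B f'"
    and iso: "bundle_iso G (pullback X f U) (pullback X f' U)"
  shows "homotopic_with (\<lambda>_. True) X B f f'"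
proof -
  define Q where "Q = pullback X f U"
  have Qt: "btotal Q = subtopology (prod_topology X (btotal U)) {(x, e). f x = bproj U e}"
    and Qp: "bproj Q = fst" and Qa: "bact Q = (\<lambda>g (x, e). (x, bact U g e))"
    by (simp_all add: pullback_def Q_def)
  have QE: "topspace (btotal Q) = {(x, e). x \<in> topspace X \<and> e \<in> E \<and> f x = bproj U e}"
    by (auto simp: Qt)
  obtain \<alpha> where \<alpha>: "homeomorphic_map (btotal Q) (btotal (pullback X f' U)) \<alpha>"
    and p\<alpha>: "\<forall>e\<in>topspace (btotal Q). bproj (pullback X f' U) (\<alpha> e) = bproj Q e \<and>
        (\<forall>g\<in>carrier G. \<alpha> (bact Q g e) = bact (pullback X f' U) g (\<alpha> e))"
    using iso [folded Q_def] unfolding bundle_iso_def by (elim exE conjE) (rule that)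
  define \<beta> where "\<beta> x e = snd (\<alpha> (x, e))" for x e
  have c\<alpha>: "continuous_map (btotal Q) (prod_topology X (btotal U)) \<alpha>"
    using homeomorphic_imp_continuous_map [OF \<alpha>] by (simp add: pullback_def continuous_map_in_subtopology)
  have \<beta>: "\<beta> x e \<in> E" "bproj U (\<beta> x e) = f' x" if "x \<in> topspace X" "e \<in> E" "f x = bproj U e" for x e
  proof -
    have xe: "(x, e) \<in> topspace (btotal Q)" using that by (simp add: QE)
    have "\<alpha> (x, e) \<in> topspace (btotal (pullback X f' U))"
      using continuous_map_image_subset_topspace [OF homeomorphic_imp_continuous_map [OF \<alpha>]] xe by blast
    moreover have "fst (\<alpha> (x, e)) = x" using p\<alpha> xe by (simp add: pullback_def Qp)
    ultimately show "\<beta> x e \<in> E" "bproj U (\<beta> x e) = f' x"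
      by (auto simp: \<beta>_def pullback_def)
  qed
  have \<beta>g: "\<beta> x (bact U g e) = bact U g (\<beta> x e)" if "x \<in> topspace X" "e \<in> E" "f x = bproj U e" "g \<in> carrier G" for x e g
  proof -
    have "(x, e) \<in> topspace (btotal Q)" using that by (simp add: QE)
    then have "\<alpha> (bact Q g (x, e)) = bact (pullback X f' U) g (\<alpha> (x, e))" using p\<alpha> that(4) by blast
    then show ?thesis by (simp add: \<beta>_def Qa pullback_def case_prod_unfold)
  qed
  \<comment> \<open>An arbitrary, discontinuous choice in the fibres. By \<open>h_eq\<close> the
    homotopy does not depend on it, so continuity can be checked with local sections in its
    place.\<close>
  define c where "c x = (SOME e. e \<in> E \<and> bproj U e = f x)" for x
  have fB: "f x \<in> topspace B" if "x \<in> topspace X" for x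
    using f that continuous_map_image_subset_topspace by blast
  have c: "c x \<in> E" "bproj U (c x) = f x" if "x \<in> topspace X" for x
  proof -
    have "\<exists>e. e \<in> E \<and> bproj U e = f x" using proj_surj [OF fB [OF that]] by blast
    from someI_ex [OF this] show "c x \<in> E" "bproj U (c x) = f x" by (simp_all add: c_def)
  qed
  \<comment> \<open>The parameter is reversed because \<open>mix 1\<close> returns the first
    argument, which has to appear at time 0.\<close>
  define h where "h = (\<lambda>(t, x). bproj U (mix (1 - t) (c x) (\<beta> x (c x))))"
  have h_eq: "h (t, x) = bproj U (mix (1 - t) e (\<beta> x e))"
    if "t \<in> {0..1}" "x \<in> topspace X" "e \<in> E" "bproj U e = f x" for t x e
  proof -
    let ?g = "bdiv e (c x)"
    have g: "?g \<in> carrier G" "bact U ?g (c x) = e" using bdiv [of e "c x"] c that by auto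
    have "mix (1 - t) e (\<beta> x e) = bact U ?g (mix (1 - t) (c x) (\<beta> x (c x)))"
      using \<beta>g [of x "c x" ?g] g c that \<beta> act_mix [of "1 - t" ?g "c x" "\<beta> x (c x)"] by simp
    moreover have "mix (1 - t) (c x) (\<beta> x (c x)) \<in> E" using c that \<beta> by (intro mix_in) auto
    ultimately show ?thesis using proj_act g by (simp add: h_def)
  qed
  let ?Z = "prod_topology (top_of_set {0..1::real}) X"
  have h: "continuous_map ?Z B h"
  proof (rule continuous_map_local)
    fix z assume z: "z \<in> topspace ?Z"
    then have "f (snd z) \<in> topspace B" using fB by auto
    then obtain N s where N: "openin B N" "f (snd z) \<in> N" and s: "continuous_map (subtopology B N) (btotal U) s"
      "\<And>u. u \<in> N \<Longrightarrow> s u \<in> E" "\<And>u. u \<in> N \<Longrightarrow> bproj U (s u) = u" by (rule local_section) blast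
    define O' where "O' = {z \<in> topspace ?Z. f (snd z) \<in> N}"
    have fs: "continuous_map ?Z B (\<lambda>z. f (snd z))"
      using continuous_map_compose [OF continuous_map_snd f] by (simp add: o_def)
    have O': "openin ?Z O'" unfolding O'_def using fs N(1) by (rule openin_continuous_map_preimage)
    let ?O = "subtopology ?Z O'"
    have "continuous_map ?O (subtopology B N) (\<lambda>z. f (snd z))"
      by (auto simp: continuous_map_in_subtopology O'_def intro: continuous_map_from_subtopology fs)
    from continuous_map_compose [OF this s(1)]
    have sf: "continuous_map ?O (btotal U) (\<lambda>z. s (f (snd z)))" by (simp add: o_def)
    have cfst: "continuous_map ?Z euclideanreal fst"
      using continuous_map_fst continuous_map_into_fulltopology by blast
    have "continuous_map ?O (prod_topology X (btotal U)) (\<lambda>z. (snd z, s (f (snd z))))"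
      by (intro continuous_map_pairedI sf continuous_map_from_subtopology continuous_map_snd)
    then have "continuous_map ?O (btotal Q) (\<lambda>z. (snd z, s (f (snd z))))"
      using s(3) by (auto simp: Qt continuous_map_in_subtopology O'_def)
    from continuous_map_compose [OF continuous_map_compose [OF this c\<alpha>] continuous_map_snd]
    have \<beta>c: "continuous_map ?O (btotal U) (\<lambda>z. \<beta> (snd z) (s (f (snd z))))" by (simp add: o_def \<beta>_def)
    have "continuous_map ?O (btotal U) (\<lambda>z. mix (1 - fst z) (s (f (snd z))) (\<beta> (snd z) (s (f (snd z)))))"
      using cfst by (intro mix_comp sf \<beta>c continuous_map_diff continuous_map_from_subtopology) auto
    from continuous_map_compose [OF this proj_cont]
    have "continuous_map ?O B (\<lambda>z. bproj U (mix (1 - fst z) (s (f (snd z))) (\<beta> (snd z) (s (f (snd z))))))"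
      by (simp add: o_def)
    then have "continuous_map ?O B h"
    proof (rule continuous_map_eq)
      fix w assume "w \<in> topspace ?O"
      then have "fst w \<in> {0..1}" "snd w \<in> topspace X" "f (snd w) \<in> N" by (auto simp: O'_def)
      then show "bproj U (mix (1 - fst w) (s (f (snd w))) (\<beta> (snd w) (s (f (snd w))))) = h w"
        using h_eq [of "fst w" "snd w" "s (f (snd w))"] s by simp
    qed
    moreover have "z \<in> O'" using z N by (simp add: O'_def)
    ultimately show "\<exists>U. openin ?Z U \<and> z \<in> U \<and> continuous_map (subtopology ?Z U) B h" using O' by blast
  qed
  have "h (0, x) = f x" "h (1, x) = f' x" if "x \<in> topspace X" for x
    using c [OF that] \<beta> [of x "c x"] that by (simp_all add: h_def mix_0 mix_1)
  with h show ?thesis by (subst homotopic_with) auto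
qed

text \<open>It suffices to find an equivariant map \<open>F\<close> of total spaces: it descends to
  the classifying map \<open>f\<close>, and together with the projection it maps \<open>P\<close> to
  the pullback. \<open>F\<close> starts at the constant \<open>b0\<close> and lets each active
  trivialisation write its own value on a portion of \<Omega> as large as its weight.\<close>

lemma classifying_map_exists:
  fixes X :: "'x topology" and P :: "('g, 'p, 'x) gbundle"
  assumes X: "paracompact_space X" and P: "principal_bundle G T X P"
  shows "\<exists>f. continuous_map X B f \<and> bundle_iso G P (pullback X f U)"
proof -
  interpret P: principal_bundle_on G T X P by unfold_locales (rule P)
  define sect where "sect V s \<longleftrightarrow> continuous_map (subtopology X V) (btotal P) s \<and>
    (\<forall>x\<in>V. s x \<in> P.E \<and> bproj P (s x) = x)" for V s
  define \<U> where "\<U> = {W. openin X W \<and> (\<exists>s. sect W s)}"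
  have \<U>: "\<And>U. U \<in> \<U> \<Longrightarrow> openin X U" by (simp add: \<U>_def)
  have "\<Union>\<U> = topspace X"
  proof
    show "\<Union>\<U> \<subseteq> topspace X" using \<U> openin_subset by blast
    show "topspace X \<subseteq> \<Union>\<U>"
    proof
      fix x assume "x \<in> topspace X"
      then obtain V s where "openin X V" "x \<in> V" "continuous_map (subtopology X V) (btotal P) s"
        "\<And>u. u \<in> V \<Longrightarrow> s u \<in> P.E" "\<And>u. u \<in> V \<Longrightarrow> bproj P (s u) = u" by (rule P.local_section) blast
      then show "x \<in> \<Union>\<U>" unfolding \<U>_def sect_def by blast
    qed
  qed
  from ex_partition [OF X \<U> this] obtain \<V> lam sl where part: "partition X \<V> (\<lambda>V. V) lam sl"
    and sub: "\<And>V. V \<in> \<V> \<Longrightarrow> \<exists>U\<in>\<U>. V \<subseteq> U" by metis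
  have "\<exists>s. sect V s" if V: "V \<in> \<V>" for V
  proof -
    obtain W s where W: "V \<subseteq> W" "sect W s" using sub [OF V] unfolding \<U>_def by blast
    then have "continuous_map (subtopology X V) (btotal P) s"
      unfolding sect_def using continuous_map_from_subtopology_mono by blast
    then show ?thesis using W unfolding sect_def by blast
  qed
  then obtain S where S: "\<And>V. V \<in> \<V> \<Longrightarrow> sect V (S V)" by metis
  define \<theta> where "\<theta> V p = P.bdiv p (S V (bproj P p))" for V p
  \<comment> \<open>What is written below \<open>a\<close> is kept, everything beyond receives the
    value of the current trivialisation, and the part beyond the new weight is reset to
    \<open>b0\<close>.\<close>
  define step where "step V p a e = mix (a + lam V (bproj P p)) (mix a e (bact U (\<theta> V p) b0)) b0" for V p a e
  \<comment> \<open>The state still equals \<open>b0\<close> beyond \<open>a\<close>. This normal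
    form is what makes a step of weight 0 the identity, as \<open>step_0\<close> demands.\<close>
  define Inv where "Inv p a e \<longleftrightarrow> mix a e b0 = e" for p :: 'p and a e
  have \<theta>: "\<theta> V p \<in> carrier G" if "V \<in> \<V>" "p \<in> P.E" "bproj P p \<in> V" for V p
    using P.bdiv S [OF that(1)] that unfolding \<theta>_def sect_def by metis
  have \<theta>g: "\<theta> V (bact P g p) = g \<otimes> \<theta> V p" if "V \<in> \<V>" "p \<in> P.E" "bproj P p \<in> V" "g \<in> carrier G" for V p g
    using P.bdiv_act [of p "S V (bproj P p)" g] S [OF that(1)] that unfolding \<theta>_def sect_def by (simp add: P.proj_act)
  have \<theta>E: "bact U (\<theta> V p) b0 \<in> E" if "V \<in> \<V>" "p \<in> P.E" "bproj P p \<in> V" for V p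
    using \<theta> [OF that] b0 act_in by blast
  interpret Z: partition "btotal P" \<V> "\<lambda>V. {p \<in> P.E. bproj P p \<in> V}" "\<lambda>V p. lam V (bproj P p)" sl
    using partition.pullback [OF part P.proj_cont] .
  interpret Z: partitioned_steps "btotal P" \<V> "\<lambda>V. {p \<in> P.E. bproj P p \<in> V}" "\<lambda>V p. lam V (bproj P p)" sl
    "btotal U" step "\<lambda>_. b0" Inv
  proof
    show "continuous_map (btotal P) (btotal U) (\<lambda>_. b0)" by (simp add: b0)
    show "Inv p 0 b0" for p by (simp add: Inv_def mix_0 b0)
  next
    fix V p a e assume A: "V \<in> \<V>" "p \<in> P.E" "p \<in> {p \<in> P.E. bproj P p \<in> V}" "0 \<le> a" "a + lam V (bproj P p) \<le> 1" "e \<in> E"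
    have a: "a \<in> {0..1}" "a + lam V (bproj P p) \<in> {0..1}" using A Z.lam_nonneg [of V p] by auto
    have "bact U (\<theta> V p) b0 \<in> E" using \<theta>E A by blast
    then show "Inv p (a + lam V (bproj P p)) (step V p a e)"
      using A a by (simp only: Inv_def step_def mix_mix mix_in b0)
  next
    fix V p a e assume A: "V \<in> \<V>" "p \<in> P.E" "p \<in> {p \<in> P.E. bproj P p \<in> V}" "0 \<le> a" "a \<le> 1" "e \<in> E"
      "Inv p a e" "lam V (bproj P p) = 0"
    then show "step V p a e = e"
      using \<theta>E [of V p] mix_mix [of a e "bact U (\<theta> V p) b0" b0] by (simp add: step_def Inv_def b0)
  next
    fix V a F
    let ?Z = "subtopology (btotal P) {p \<in> P.E. bproj P p \<in> V}"
    assume V: "V \<in> \<V>" and a: "continuous_map ?Z euclideanreal a" and F: "continuous_map ?Z (btotal U) F"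
      and inv: "\<And>p. p \<in> {p \<in> P.E. bproj P p \<in> V} \<Longrightarrow> 0 \<le> a p \<and> a p + lam V (bproj P p) \<le> 1 \<and> Inv p (a p) (F p)"
    have l: "continuous_map ?Z euclideanreal (\<lambda>p. lam V (bproj P p))"
      by (intro continuous_map_from_subtopology Z.lam_cont V)
    have a01: "0 \<le> a p \<and> a p \<le> 1 \<and> 0 \<le> a p + lam V (bproj P p) \<and> a p + lam V (bproj P p) \<le> 1"
      if "p \<in> topspace ?Z" for p
      using inv [of p] that Z.lam_nonneg [of V p] by auto
    have "continuous_map ?Z (subtopology X V) (bproj P)"
      by (auto simp: continuous_map_in_subtopology intro: continuous_map_from_subtopology P.proj_cont)
    then have "continuous_map ?Z (btotal P) (\<lambda>p. S V (bproj P p))"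
      using continuous_map_compose [of ?Z _ "bproj P" "btotal P" "S V"] S [OF V] unfolding sect_def o_def by blast
    moreover have "continuous_map ?Z (btotal P) (\<lambda>p. p)" by (intro continuous_map_from_subtopology) simp
    ultimately have "continuous_map ?Z T (\<theta> V)"
      unfolding \<theta>_def [abs_def] using S [OF V] unfolding sect_def by (intro P.bdiv_cont) auto
    then have "continuous_map ?Z (btotal U) (\<lambda>p. bact U (\<theta> V p) b0)"
      by (intro act_comp) (simp_all add: b0)
    then show "continuous_map ?Z (btotal U) (\<lambda>p. step V p (a p) (F p))"
      unfolding step_def using a01
      by (intro mix_comp continuous_map_add a l F) (auto simp: b0)
  qed
  define F where "F = Z.total"
  have Fc: "continuous_map (btotal P) (btotal U) F" unfolding F_def by (rule Z.total_cont)
  have FE: "F p \<in> E" if "p \<in> P.E" for p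
    using continuous_map_image_subset_topspace [OF Fc] that by blast
  have Fg: "F (bact P g p) = bact U g (F p)" if p: "p \<in> P.E" and g: "g \<in> carrier G" for p g
  proof -
    have gp: "bact P g p \<in> P.E" "bproj P (bact P g p) = bproj P p" using p g by (simp_all add: P.act_in P.proj_act)
    \<comment> \<open>The base point is not fixed by \<open>G\<close>, so unfinished states at
      \<open>p\<close> and at its translate correspond only after the unwritten part has been reset
      to \<open>b0\<close>. At weight 1 nothing is unwritten and the relation becomes
      equivariance.\<close>
    have "F (bact P g p) = mix 1 (bact U g (F p)) b0"
      unfolding F_def
    proof (rule Z.total_rel [where R = "\<lambda>a e e'. e' = mix a (bact U g e) b0", OF p gp(1)])
      show "b0 = mix 0 (bact U g b0) b0" using g b0 by (simp add: mix_0 act_in)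
    next
      fix V a e e' assume A: "V \<in> \<V>" "p \<in> {p \<in> P.E. bproj P p \<in> V}" "0 \<le> a" "a + lam V (bproj P p) \<le> 1"
        "e \<in> E" "e' = mix a (bact U g e) b0"
      have a: "a \<in> {0..1}" "a + lam V (bproj P p) \<in> {0..1}" using A Z.lam_nonneg [of V p] by auto
      let ?b = "a + lam V (bproj P p)" and ?k = "bact U (\<theta> V p) b0"
      have k: "?k \<in> E" "bact U g ?k \<in> E" "bact U g e \<in> E" "bact U g b0 \<in> E" using \<theta>E A g act_in b0 by auto
      have k': "bact U (\<theta> V (bact P g p)) b0 = bact U g ?k"
        using A \<theta>g [of V p g] g \<theta> [of V p] b0 by (simp add: act_mult)
      have m: "mix a e ?k \<in> E" "mix a (bact U g e) (bact U g ?k) \<in> E" using a A k by (auto intro: mix_in)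
      have "step V (bact P g p) a e' = mix ?b (mix a (mix a (bact U g e) b0) (bact U g ?k)) b0"
        using A by (simp add: step_def gp k')
      also have "\<dots> = mix ?b (mix a (bact U g e) (bact U g ?k)) b0"
        using a k b0 by (simp only: mix_mix)
      \<comment> \<open>\<open>mix_mix\<close> read backwards: the translate of the step at
        \<open>p\<close> carries \<open>bact U g b0\<close> beyond \<open>?b\<close>, and the outer
        reset hides it.\<close>
      also have "\<dots> = mix ?b (mix ?b (mix a (bact U g e) (bact U g ?k)) (bact U g b0)) b0"
        using a k b0 m by (simp only: mix_mix)
      also have "\<dots> = mix ?b (bact U g (step V p a e)) b0"
        using a k b0 m A g by (simp only: step_def act_mix)
      finally show "step V (bact P g p) a e' = mix ?b (bact U g (step V p a e)) b0" .
    qed (use gp in auto)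
    then show ?thesis using FE [OF p] g b0 by (simp add: mix_1 act_in)
  qed
  define c where "c x = (SOME p. p \<in> P.E \<and> bproj P p = x)" for x
  have c: "c x \<in> P.E" "bproj P (c x) = x" if "x \<in> topspace X" for x
  proof -
    have "\<exists>p. p \<in> P.E \<and> bproj P p = x" using P.proj_surj [OF that] by blast
    from someI_ex [OF this] show "c x \<in> P.E" "bproj P (c x) = x" by (simp_all add: c_def)
  qed
  define f where "f x = bproj U (F (c x))" for x
  have f_eq: "f (bproj P p) = bproj U (F p)" if p: "p \<in> P.E" for p
  proof -
    let ?g = "P.bdiv p (c (bproj P p))"
    have g: "?g \<in> carrier G" "bact P ?g (c (bproj P p)) = p" using P.bdiv [of p "c (bproj P p)"] c p P.proj_in by auto
    then have "F p = bact U ?g (F (c (bproj P p)))" using Fg [of "c (bproj P p)" ?g] c p P.proj_in by simp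
    then show ?thesis using proj_act FE c p g P.proj_in by (simp add: f_def)
  qed
  have fc: "continuous_map X B f"
  proof (rule continuous_map_local)
    fix x assume "x \<in> topspace X"
    then obtain V s where V: "openin X V" "x \<in> V" and s: "continuous_map (subtopology X V) (btotal P) s"
      "\<And>u. u \<in> V \<Longrightarrow> s u \<in> P.E" "\<And>u. u \<in> V \<Longrightarrow> bproj P (s u) = u" by (rule P.local_section) blast
    have "continuous_map (subtopology X V) B (\<lambda>x. bproj U (F (s x)))"
      using continuous_map_compose [OF continuous_map_compose [OF s(1) Fc] proj_cont] by (simp add: o_def)
    then have "continuous_map (subtopology X V) B f"
    proof (rule continuous_map_eq)
      fix y assume "y \<in> topspace (subtopology X V)"
      then show "bproj U (F (s y)) = f y" using f_eq [of "s y"] s by simp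
    qed
    then show "\<exists>U. openin X U \<and> x \<in> U \<and> continuous_map (subtopology X U) B f" using V by blast
  qed
  have "bundle_iso G P (pullback X f U)"
  proof (rule bundle_isoI [where F = "\<lambda>p. (bproj P p, F p)"])
    show "topological_group G T" by (rule topological_group)
    show "principal_bundle G T X P" by (rule P)
    show "principal_bundle G T X (pullback X f U)" by (rule principal_pullback [OF fc])
    have "continuous_map (btotal P) (prod_topology X (btotal U)) (\<lambda>p. (bproj P p, F p))"
      by (intro continuous_map_pairedI P.proj_cont Fc)
    then show "continuous_map (btotal P) (btotal (pullback X f U)) (\<lambda>p. (bproj P p, F p))"
      by (auto simp: pullback_def continuous_map_in_subtopology f_eq)
  qed (auto simp: pullback_def Fg P.proj_act)
  then show ?thesis using fc by blast
qed

end

section \<open>Random variables on a standard Borel space\<close>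

text \<open>With ratio \<open>1/3\<close> the first term in which two series differ outweighs all later ones.\<close>

lemma base_encoding_inj:
  fixes B :: "nat \<Rightarrow> 'a set"
  assumes "(\<Sum>n. (1/3)^n * indicator (B n) x) = (\<Sum>n. (1/3)^n * indicator (B n) y :: real)"
  shows "x \<in> B n \<longleftrightarrow> y \<in> B n"
proof (induction n rule: less_induct)
  case (less n)
  define a where "a k = (1/3)^k * (indicator (B k) x - indicator (B k) y :: real)" for k
  have bound: "\<bar>a k\<bar> \<le> (1/3)^k" for k by (auto simp: a_def abs_mult indicator_def)
  have sg: "summable (\<lambda>k. (1/3::real)^k)" by (rule summable_geometric) simp
  have sB: "summable (\<lambda>n. (1/3)^n * indicator (B n) z :: real)" for z
    by (rule summable_comparison_test' [OF sg, of 0]) (auto simp: indicator_def)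
  have sa: "summable a" by (rule summable_comparison_test' [OF sg, of 0]) (use bound in auto)
  have "suminf a = 0"
    using suminf_diff [OF sB [of x] sB [of y]] assms by (simp add: a_def [abs_def] right_diff_distrib)
  moreover have "suminf a = (\<Sum>k. a (k + Suc n)) + (\<Sum>k<Suc n. a k)"
    using sa by (rule suminf_split_initial_segment)
  moreover have "(\<Sum>k<n. a k) = 0"
    by (rule sum.neutral) (use less in \<open>auto simp: a_def indicator_def\<close>)
  ultimately have "a n = - (\<Sum>k. a (k + Suc n))" by simp
  then have "\<bar>a n\<bar> = \<bar>\<Sum>k. a (k + Suc n)\<bar>" by simp
  also have "\<dots> \<le> (\<Sum>k. (1/3)^(k + Suc n))"
  proof -
    have sg': "summable (\<lambda>k. (1/3::real)^(k + Suc n))" using sg by (rule summable_ignore_initial_segment)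
    have sabs: "summable (\<lambda>k. \<bar>a (k + Suc n)\<bar>)"
    proof (rule summable_comparison_test' [OF sg', of 0])
      show "norm \<bar>a (k + Suc n)\<bar> \<le> (1/3)^(k + Suc n)" for k
        using bound [of "k + Suc n"] by (simp only: real_norm_def abs_idempotent)
    qed
    have "\<bar>\<Sum>k. a (k + Suc n)\<bar> \<le> (\<Sum>k. \<bar>a (k + Suc n)\<bar>)" by (rule summable_rabs [OF sabs])
    also have "\<dots> \<le> (\<Sum>k. (1/3)^(k + Suc n))" by (rule suminf_le [OF bound sabs sg'])
    finally show ?thesis .
  qed
  also have "\<dots> = (1/3)^Suc n * (\<Sum>k. (1/3)^k)"
    using suminf_mult [OF sg, of "(1/3)^Suc n"] by (simp add: power_add mult.commute)
  also have "\<dots> = (1/3)^n / 2" using suminf_geometric [of "1/3::real"] by simp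
  also have "\<dots> < (1/3)^n" by simp
  finally have "\<bar>a n\<bar> < (1/3)^n" .
  then show ?case by (cases "x \<in> B n"; cases "y \<in> B n") (simp_all add: a_def abs_mult)
qed

section \<open>Measurable maps into the Borel sets of a topology\<close>

lemma sets_borel_of: "openin T U \<Longrightarrow> U \<in> sets (borel_of T)"
  unfolding borel_of_def by (subst sets_measure_of) (auto dest: openin_subset)

lemma space_borel_of [simp]: "space (borel_of T) = topspace T"
  unfolding borel_of_def by (rule space_measure_of) (auto dest: openin_subset)

lemma measurable_borel_ofI:
  assumes "\<And>t. t \<in> space M \<Longrightarrow> f t \<in> topspace T"
    and "\<And>U. openin T U \<Longrightarrow> f -` U \<inter> space M \<in> sets M"
  shows "f \<in> M \<rightarrow>\<^sub>M borel_of T"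
  unfolding borel_of_def
  by (rule measurable_measure_of) (use assms in \<open>auto dest: openin_subset\<close>)

lemma measurable_borel_ofD:
  assumes "f \<in> M \<rightarrow>\<^sub>M borel_of T"
  shows "\<And>t. t \<in> space M \<Longrightarrow> f t \<in> topspace T" "\<And>U. openin T U \<Longrightarrow> f -` U \<inter> space M \<in> sets M"
  using measurable_space [OF assms] measurable_sets [OF assms sets_borel_of] by auto

lemma measurable_borel_of_compose:
  assumes f: "f \<in> M \<rightarrow>\<^sub>M borel_of T" and F: "continuous_map T S F"
  shows "(\<lambda>t. F (f t)) \<in> M \<rightarrow>\<^sub>M borel_of S"
proof (rule measurable_borel_ofI)
  show "F (f t) \<in> topspace S" if "t \<in> space M" for t
    using continuous_map_image_subset_topspace [OF F] measurable_borel_ofD(1) [OF f that] by blast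
  fix U assume U: "openin S U"
  have "(\<lambda>t. F (f t)) -` U \<inter> space M = f -` {x \<in> topspace T. F x \<in> U} \<inter> space M"
    using measurable_borel_ofD(1) [OF f] by auto
  then show "(\<lambda>t. F (f t)) -` U \<inter> space M \<in> sets M"
    using measurable_borel_ofD(2) [OF f openin_continuous_map_preimage [OF F U]] by simp
qed

text \<open>A countable base writes an open set of the product as a countable union of open
  rectangles, whose preimages are measurable because both components are.\<close>

lemma measurable_borel_of_compose_pair:
  assumes f: "f \<in> M \<rightarrow>\<^sub>M borel_of T" and g: "g \<in> M \<rightarrow>\<^sub>M borel_of T" and T: "second_countable T"
    and F: "continuous_map (prod_topology T T) S F"
  shows "(\<lambda>t. F (f t, g t)) \<in> M \<rightarrow>\<^sub>M borel_of S"
proof (rule measurable_borel_ofI)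
  have fT: "f t \<in> topspace T" "g t \<in> topspace T" if "t \<in> space M" for t
    using measurable_borel_ofD(1) [OF f that] measurable_borel_ofD(1) [OF g that] by auto
  show "F (f t, g t) \<in> topspace S" if "t \<in> space M" for t
    using continuous_map_image_subset_topspace [OF F] fT [OF that] by (auto simp: image_subset_iff)
  fix U assume U: "openin S U"
  obtain \<B> where \<B>: "countable \<B>" "\<And>V. V \<in> \<B> \<Longrightarrow> openin T V"
    and base: "\<And>U x. openin T U \<Longrightarrow> x \<in> U \<Longrightarrow> \<exists>V\<in>\<B>. x \<in> V \<and> V \<subseteq> U"
    using T unfolding second_countable_def by metis
  define N where "N = {p \<in> topspace (prod_topology T T). F p \<in> U}"
  have N: "openin (prod_topology T T) N" unfolding N_def using F U by (rule openin_continuous_map_preimage)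
  define \<C> where "\<C> = {(A, B) \<in> \<B> \<times> \<B>. A \<times> B \<subseteq> N}"
  have cC: "countable \<C>" by (rule countable_subset [of _ "\<B> \<times> \<B>"]) (use \<B>(1) in \<open>auto simp: \<C>_def\<close>)
  have "(\<lambda>t. F (f t, g t)) -` U \<inter> space M = (\<Union>(A, B)\<in>\<C>. (f -` A \<inter> space M) \<inter> (g -` B \<inter> space M))"
  proof (intro equalityI subsetI)
    fix t assume t: "t \<in> (\<lambda>t. F (f t, g t)) -` U \<inter> space M"
    then have "(f t, g t) \<in> N" using fT by (auto simp: N_def)
    then obtain A' B' where "openin T A'" "openin T B'" "f t \<in> A'" "g t \<in> B'" "A' \<times> B' \<subseteq> N"
      using N unfolding openin_prod_topology_alt by meson
    moreover obtain A B where "A \<in> \<B>" "f t \<in> A" "A \<subseteq> A'" "B \<in> \<B>" "g t \<in> B" "B \<subseteq> B'"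
      using base calculation by meson
    ultimately have "(A, B) \<in> \<C>" unfolding \<C>_def by blast
    then show "t \<in> (\<Union>(A, B)\<in>\<C>. (f -` A \<inter> space M) \<inter> (g -` B \<inter> space M))"
      using t \<open>f t \<in> A\<close> \<open>g t \<in> B\<close> by blast
  next
    fix t assume "t \<in> (\<Union>(A, B)\<in>\<C>. (f -` A \<inter> space M) \<inter> (g -` B \<inter> space M))"
    then obtain A B where "(A, B) \<in> \<C>" "f t \<in> A" "g t \<in> B" "t \<in> space M" by blast
    then have "(f t, g t) \<in> N" unfolding \<C>_def by blast
    then show "t \<in> (\<lambda>t. F (f t, g t)) -` U \<inter> space M" using \<open>t \<in> space M\<close> by (simp add: N_def)
  qed
  also have "\<dots> \<in> sets M"
  proof (rule sets.countable_UN' [OF cC])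
    show "(\<lambda>(A, B). (f -` A \<inter> space M) \<inter> (g -` B \<inter> space M)) ` \<C> \<subseteq> sets M"
      using measurable_borel_ofD(2) [OF f] measurable_borel_ofD(2) [OF g] \<B>(2) by (auto simp: \<C>_def)
  qed
  finally show "(\<lambda>t. F (f t, g t)) -` U \<inter> space M \<in> sets M" .
qed

lemma borel_of_euclidean: "borel_of euclidean = borel"
  by (simp add: borel_of_def borel_def)

text \<open>The probability integral transform. Membership in a countable base is encoded in an
  injective measurable real function \<open>u\<close>; as the measure has no atoms, the distribution
  function \<open>F\<close> of \<open>u\<close> is continuous, and \<open>F\<close> composed with
  \<open>u\<close> is uniform.\<close>

lemma uniform_variable_exists:
  assumes M: "prob_space M" and sb: "standard_borel M" and na: "nonatomic M"
  shows "\<exists>c\<in>borel_measurable M. (\<forall>t. 0 \<le> c t \<and> c t \<le> (1::real)) \<and>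
    (\<forall>s\<in>{0..1}. measure M {t \<in> space M. c t \<le> s} = s)"
proof -
  interpret M: prob_space M by (rule M)
  obtain S where S: "completely_metrizable_space S" "second_countable S" "topspace S = space M"
    "sets (borel_of S) = sets M" using sb unfolding standard_borel_def by blast
  have haus: "Hausdorff_space S"
    using S(1) completely_metrizable_imp_metrizable_space metrizable_imp_Hausdorff_space by blast
  obtain \<B> where \<B>: "countable \<B>" "\<And>V. V \<in> \<B> \<Longrightarrow> openin S V"
    and base: "\<And>U x. openin S U \<Longrightarrow> x \<in> U \<Longrightarrow> \<exists>V\<in>\<B>. x \<in> V \<and> V \<subseteq> U"
    using S(2) unfolding second_countable_def by metis
  \<comment> \<open>The empty set is added so that the family is nonempty and can be enumerated by
    the natural numbers.\<close>
  have "countable (insert {} \<B>)" "insert {} \<B> \<noteq> {}" using \<B>(1) by auto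
  then obtain B :: "nat \<Rightarrow> 'a set" where B: "range B = insert {} \<B>" by (metis range_from_nat_into)
  have Bs: "B n \<in> sets M" for n
  proof -
    have "B n \<in> insert {} \<B>" using B by blast
    then show ?thesis using \<B>(2) sets_borel_of [of S] S(4) by auto
  qed
  define u where "u t = (\<Sum>n. (1/3)^n * indicator (B n) t :: real)" for t
  have um: "u \<in> borel_measurable M"
    unfolding u_def [abs_def] by (intro borel_measurable_suminf borel_measurable_times borel_measurable_const borel_measurable_indicator Bs)
  have uinj: "t = t'" if t: "t \<in> space M" "t' \<in> space M" "u t = u t'" for t t'
  proof (rule ccontr)
    assume "t \<noteq> t'"
    then obtain V W where "openin S V" "openin S W" "t \<in> V" "t' \<in> W" "disjnt V W"
      using haus t S(3) unfolding Hausdorff_space_def by metis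
    then obtain A where A: "A \<in> \<B>" "t \<in> A" "A \<subseteq> V" using base by meson
    then obtain n where "A = B n" using B by blast
    moreover have "t' \<notin> A" using \<open>t' \<in> W\<close> \<open>disjnt V W\<close> A by (auto simp: disjnt_def)
    ultimately show False using base_encoding_inj [of B t t' n] t A by (simp add: u_def)
  qed
  define D where "D = distr M borel u"
  interpret D: real_distribution D
    unfolding D_def using um by (simp add: M.real_distribution_distr)
  \<comment> \<open>A level set of the injective \<open>u\<close> has at most one point. It has no
    nonempty proper subset, so with positive measure it would be an atom.\<close>
  have null: "measure D {r} = 0" for r
  proof -
    let ?A = "u -` {r} \<inter> space M"
    have A: "?A \<in> sets M" using measurable_sets [OF um] by simp
    have "emeasure M ?A = 0"
    proof (rule ccontr)
      assume "emeasure M ?A \<noteq> 0"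
      then have "emeasure M ?A > 0" by (simp add: zero_less_iff_neq_zero)
      then obtain C where C: "C \<in> sets M" "C \<subseteq> ?A" "0 < emeasure M C" "emeasure M C < emeasure M ?A"
        using na A unfolding nonatomic_def by blast
      then have "C \<noteq> {}" "C \<noteq> ?A" by auto
      then obtain t t' where "t \<in> C" "t' \<in> ?A" "t' \<notin> C" using C(2) by blast
      then show False using uinj [of t t'] C(2) by auto
    qed
    then show ?thesis using um by (simp add: D_def measure_def emeasure_distr)
  qed
  define F where "F = cdf D"
  have Fcont: "isCont F r" for r unfolding F_def using D.isCont_cdf null by blast
  have Fmono: "F r \<le> F r'" if "r \<le> r'" for r r' unfolding F_def using that by (rule D.cdf_nondecreasing)
  have F01: "0 \<le> F r" "F r \<le> 1" for r unfolding F_def by (simp_all add: D.cdf_nonneg D.cdf_bounded_prob)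
  have Fmeas: "measure M {t \<in> space M. u t \<le> r} = F r" for r
    using um by (simp add: F_def cdf_def D_def measure_distr vimage_def Int_def conj_commute)
  have ex: "\<exists>r. F r = s" if s: "0 < s" "s < 1" for s
  proof -
    have "eventually (\<lambda>r. F r < s) at_bot"
      unfolding F_def by (rule order_tendstoD(2) [OF D.cdf_lim_at_bot s(1)])
    then obtain r1 where r1: "F r1 < s" by (metis eventually_at_bot_linorder order_refl)
    have "eventually (\<lambda>r. F r > s) at_top"
      unfolding F_def by (rule order_tendstoD(1) [OF D.cdf_lim_at_top_prob s(2)])
    then obtain r2 where r2: "F r2 > s" by (metis eventually_at_top_linorder order_refl)
    have "r1 \<le> r2" using r1 r2 Fmono by (metis linear not_le order_less_le_trans)
    then show ?thesis using IVT [of F r1 s r2] r1 r2 Fcont by auto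
  qed
  define c where "c t = F (u t)" for t
  have cm: "c \<in> borel_measurable M"
  proof -
    have "continuous_on UNIV F" using Fcont continuous_at_imp_continuous_on by blast
    then have "F \<in> borel_measurable borel" by (rule borel_measurable_continuous_onI)
    then show ?thesis using um unfolding c_def [abs_def] by simp
  qed
  \<comment> \<open>\<open>F\<close> may be constant on intervals, so \<open>F (u t) \<le> s\<close>
    does not bound \<open>u t\<close> by a point where \<open>F\<close> equals \<open>s\<close>. A
    strictly larger value \<open>s'\<close> does give such a bound, and \<open>s'\<close> then tends
    to \<open>s\<close>.\<close>
  have upper: "measure M {t \<in> space M. c t \<le> s} \<le> s'" if ss: "s < s'" "0 < s'" "s' < 1" for s s'
  proof -
    obtain r where r: "F r = s'" using ex [OF ss(2,3)] by blast
    have "{t \<in> space M. c t \<le> s} \<subseteq> {t \<in> space M. u t \<le> r}"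
    proof safe
      fix t assume "c t \<le> s"
      then have "F (u t) < F r" using r ss(1) by (simp add: c_def)
      then show "u t \<le> r" using Fmono [of r "u t"] by linarith
    qed
    moreover have "{t \<in> space M. u t \<le> r} \<in> sets M" using um by simp
    ultimately have "measure M {t \<in> space M. c t \<le> s} \<le> measure M {t \<in> space M. u t \<le> r}"
      by (intro M.finite_measure_mono)
    then show ?thesis using r Fmeas by simp
  qed
  have "measure M {t \<in> space M. c t \<le> s} = s" if s: "s \<in> {0..1}" for s
  proof (cases "s = 1")
    case True
    then have "{t \<in> space M. c t \<le> s} = space M" using F01 by (auto simp: c_def)
    then show ?thesis using True M.prob_space by simp
  next
    case False
    have "s \<le> measure M {t \<in> space M. c t \<le> s}"
    proof (cases "s = 0")
      case False
      then obtain r where r: "F r = s" using ex [of s] s \<open>s \<noteq> 1\<close> by auto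
      have "{t \<in> space M. u t \<le> r} \<subseteq> {t \<in> space M. c t \<le> s}" using Fmono r by (auto simp: c_def)
      moreover have "{t \<in> space M. c t \<le> s} \<in> sets M" using cm by simp
      ultimately have "measure M {t \<in> space M. u t \<le> r} \<le> measure M {t \<in> space M. c t \<le> s}"
        by (intro M.finite_measure_mono)
      then show ?thesis using r Fmeas by simp
    qed simp
    moreover have "measure M {t \<in> space M. c t \<le> s} \<le> s"
    proof (rule dense_ge_bounded [of s 1])
      show "s < 1" using s False by auto
      show "measure M {t \<in> space M. c t \<le> s} \<le> w" if "s < w" "w < 1" for w
        using upper [of s w] that s by auto
    qed
    ultimately show ?thesis by simp
  qed
  then show ?thesis using cm F01 by (intro bexI [of _ c]) (auto simp: c_def)
qed

section \<open>The space of random elements\<close>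

locale compact_metric_group = top_group G T + MS: Metric_space "carrier G" d
  for G :: "('g, 'm) monoid_scheme" (structure) and T :: "'g topology" and d :: "'g \<Rightarrow> 'g \<Rightarrow> real" +
  assumes mtopology_eq: "MS.mtopology = T" and compact: "compact_space T"
    and second_countable: "second_countable T" and bi_inv: "bi_invariant G d"
begin

lemma d_left: "g \<in> carrier G \<Longrightarrow> x \<in> carrier G \<Longrightarrow> y \<in> carrier G \<Longrightarrow> d (g \<otimes> x) (g \<otimes> y) = d x y"
  and d_right: "g \<in> carrier G \<Longrightarrow> x \<in> carrier G \<Longrightarrow> y \<in> carrier G \<Longrightarrow> d (x \<otimes> g) (y \<otimes> g) = d x y"
  using bi_inv by (simp_all add: bi_invariant_def)

lemma d_cont: "continuous_map (prod_topology T T) euclideanreal (\<lambda>(x, y). d x y)"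
proof -
  have "continuous_map (prod_topology T T) euclideanreal (\<lambda>p. mdist MS.Self (fst p) (snd p))"
    by (rule continuous_map_mdist) (simp_all add: MS.Self_def mtopology_eq continuous_map_fst continuous_map_snd)
  then show ?thesis by (simp add: case_prod_unfold)
qed

lemma d_bounded: "\<exists>K>0. \<forall>x\<in>carrier G. \<forall>y\<in>carrier G. d x y \<le> K"
proof -
  have "compactin MS.mtopology (carrier G)" using compact by (simp add: mtopology_eq compact_space_def topspace_T)
  then have "MS.mbounded (carrier G)" by (rule MS.compactin_imp_mbounded)
  then show ?thesis unfolding MS.mbounded_alt_pos by blast
qed

end

locale random_elements = compact_metric_group G T d + prob_space \<Omega>
  for G :: "('g, 'm) monoid_scheme" (structure) and T :: "'g topology" and d :: "'g \<Rightarrow> 'g \<Rightarrow> real"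
    and \<Omega> :: "'w measure" +
  fixes c :: "'w \<Rightarrow> real" and K :: real
  assumes c_meas: "c \<in> borel_measurable \<Omega>" and c01: "\<And>t. 0 \<le> c t \<and> c t \<le> 1"
    and c_uniform: "\<And>s. s \<in> {0..1} \<Longrightarrow> measure \<Omega> {t \<in> space \<Omega>. c t \<le> s} = s"
    and K: "K > 0" "\<And>x y. x \<in> carrier G \<Longrightarrow> y \<in> carrier G \<Longrightarrow> d x y \<le> K"
begin

abbreviation RE where "RE \<equiv> \<Omega> \<rightarrow>\<^sub>M borel_of T"
abbreviation L where "L \<equiv> L_space \<Omega> T"
abbreviation LD where "LD \<equiv> L_dist \<Omega> T d"
abbreviation act where "act \<equiv> L_act G \<Omega> T"

section \<open>The metric on classes of random elements\<close>

definition cls where "cls f = ae_rel \<Omega> T `` {f}"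

definition dist1 where "dist1 f f' = (\<integral>t. d (f t) (f' t) \<partial>\<Omega>)"

lemma RE_in: "f \<in> RE \<Longrightarrow> t \<in> space \<Omega> \<Longrightarrow> f t \<in> carrier G"
  using measurable_borel_ofD(1) [of f \<Omega> T t] by (simp add: topspace_T)

lemma RE_real:
  assumes "f \<in> RE" "f' \<in> RE" "continuous_map (prod_topology T T) euclideanreal F"
  shows "(\<lambda>t. F (f t, f' t)) \<in> borel_measurable \<Omega>"
  using measurable_borel_of_compose_pair [OF assms(1,2) second_countable assms(3)] by (simp add: borel_of_euclidean)

lemma RE_mult:
  assumes "f \<in> RE" "f' \<in> RE"
  shows "(\<lambda>t. f t \<otimes> f' t) \<in> RE"
  using measurable_borel_of_compose_pair [OF assms second_countable, of T "\<lambda>(x, y). x \<otimes> y"] topological_group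
  by (simp add: topological_group_def)

lemma RE_inv: "f \<in> RE \<Longrightarrow> (\<lambda>t. inv (f t)) \<in> RE"
  using measurable_borel_of_compose [of f \<Omega> T T "\<lambda>x. inv x"] topological_group by (simp add: topological_group_def)

lemma RE_const: "g \<in> carrier G \<Longrightarrow> (\<lambda>t. g) \<in> RE"
  by (rule measurable_const) (simp add: topspace_T)

lemma RE_act: "g \<in> carrier G \<Longrightarrow> f \<in> RE \<Longrightarrow> (\<lambda>t. g \<otimes> f t) \<in> RE"
  using RE_mult [OF RE_const] .

lemma RE_If:
  assumes "f \<in> RE" "f' \<in> RE"
  shows "(\<lambda>t. if c t \<le> s then f t else f' t) \<in> RE"
  using assms c_meas by (intro measurable_If) auto

lemma d_measurable: "f \<in> RE \<Longrightarrow> f' \<in> RE \<Longrightarrow> (\<lambda>t. d (f t) (f' t)) \<in> borel_measurable \<Omega>"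
  using RE_real [OF _ _ d_cont] by simp

lemma bounded_integrable:
  assumes "h \<in> borel_measurable \<Omega>" "\<And>t. t \<in> space \<Omega> \<Longrightarrow> \<bar>h t\<bar> \<le> (B::real)"
  shows "integrable \<Omega> h"
  by (rule integrable_const_bound [of _ B]) (use assms in auto)

lemma d_integrable: "f \<in> RE \<Longrightarrow> f' \<in> RE \<Longrightarrow> integrable \<Omega> (\<lambda>t. d (f t) (f' t))"
  by (rule bounded_integrable [of _ K]) (use d_measurable K RE_in in auto)

lemma dist1_commute: "dist1 f f' = dist1 f' f"
  by (simp add: dist1_def MS.commute)

lemma dist1_nonneg: "0 \<le> dist1 f f'"
  by (simp add: dist1_def)

lemma dist1_triangle:
  assumes "f \<in> RE" "f' \<in> RE" "f'' \<in> RE"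
  shows "dist1 f f'' \<le> dist1 f f' + dist1 f' f''"
proof -
  have "dist1 f f'' \<le> (\<integral>t. d (f t) (f' t) + d (f' t) (f'' t) \<partial>\<Omega>)"
    unfolding dist1_def using assms
    by (intro integral_mono Bochner_Integration.integrable_add d_integrable MS.triangle RE_in)
  also have "\<dots> = dist1 f f' + dist1 f' f''"
    unfolding dist1_def using assms by (intro Bochner_Integration.integral_add d_integrable)
  finally show ?thesis .
qed

lemma dist1_eq_0: "f \<in> RE \<Longrightarrow> f' \<in> RE \<Longrightarrow> dist1 f f' = 0 \<longleftrightarrow> (AE t in \<Omega>. f t = f' t)"
  unfolding dist1_def
  by (subst integral_nonneg_eq_0_iff_AE) (auto simp: d_integrable RE_in intro!: AE_cong)

lemma dist1_cong:
  assumes "AE t in \<Omega>. f1 t = f2 t" "AE t in \<Omega>. f1' t = f2' t" "f1 \<in> RE" "f2 \<in> RE" "f1' \<in> RE" "f2' \<in> RE"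
  shows "dist1 f1 f1' = dist1 f2 f2'"
  unfolding dist1_def
  by (rule integral_cong_AE) (use assms d_measurable in auto)

lemma equiv_ae_rel: "equiv RE (ae_rel \<Omega> T)"
proof (rule equivI)
  show "ae_rel \<Omega> T \<subseteq> RE \<times> RE" by (auto simp: ae_rel_def)
  show "refl_on RE (ae_rel \<Omega> T)" by (auto simp: refl_on_def ae_rel_def)
  show "sym (ae_rel \<Omega> T)" unfolding sym_def ae_rel_def by (auto elim: AE_mp)
  show "trans (ae_rel \<Omega> T)"
  proof (rule transI)
    fix x y z assume "(x, y) \<in> ae_rel \<Omega> T" "(y, z) \<in> ae_rel \<Omega> T"
    then have *: "x \<in> RE" "z \<in> RE" "AE t in \<Omega>. x t = y t" "AE t in \<Omega>. y t = z t" by (auto simp: ae_rel_def)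
    have "AE t in \<Omega>. x t = z t" using *(3,4) by eventually_elim simp
    then show "(x, z) \<in> ae_rel \<Omega> T" using * by (simp add: ae_rel_def)
  qed
qed

lemma cls_eq_iff: "f \<in> RE \<Longrightarrow> f' \<in> RE \<Longrightarrow> cls f = cls f' \<longleftrightarrow> (AE t in \<Omega>. f t = f' t)"
  unfolding cls_def using eq_equiv_class_iff [OF equiv_ae_rel, of f f'] by (simp add: ae_rel_def)

lemma in_cls: "f \<in> RE \<Longrightarrow> f' \<in> cls f \<longleftrightarrow> f' \<in> RE \<and> (AE t in \<Omega>. f t = f' t)"
  by (auto simp: cls_def ae_rel_def)

lemma L_eq: "L = cls ` RE"
  unfolding L_space_def quotient_def cls_def [abs_def] by (rule UNION_singleton_eq_range)

lemma cls_in [simp]: "f \<in> RE \<Longrightarrow> cls f \<in> L"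
  by (simp add: L_eq)

lemma LE: "e \<in> L \<Longrightarrow> (\<And>f. f \<in> RE \<Longrightarrow> e = cls f \<Longrightarrow> thesis) \<Longrightarrow> thesis"
  unfolding L_eq by (elim imageE) blast

text \<open>The integral ignores null sets, so the set handed to \<open>the_elem\<close> has one
  element and can be computed on any representatives.\<close>

lemma LD_cls:
  assumes "f \<in> RE" "f' \<in> RE"
  shows "LD (cls f) (cls f') = dist1 f f'"
proof -
  have "(\<Union>f1\<in>cls f. \<Union>f2\<in>cls f'. {\<integral>t. d (f1 t) (f2 t) \<partial>\<Omega>}) = {dist1 f f'}"
  proof
    show "(\<Union>f1\<in>cls f. \<Union>f2\<in>cls f'. {\<integral>t. d (f1 t) (f2 t) \<partial>\<Omega>}) \<subseteq> {dist1 f f'}"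
      using dist1_cong [of f _ f' _] assms by (auto simp: in_cls dist1_def)
    have "f \<in> cls f" "f' \<in> cls f'" using assms by (simp_all add: in_cls)
    then show "{dist1 f f'} \<subseteq> (\<Union>f1\<in>cls f. \<Union>f2\<in>cls f'. {\<integral>t. d (f1 t) (f2 t) \<partial>\<Omega>})"
      by (auto simp: dist1_def)
  qed
  then show ?thesis using assms by (simp add: L_dist_def)
qed

sublocale LM: Metric_space L LD
proof
  show "0 \<le> LD x y" for x y
  proof (cases "x \<in> L \<and> y \<in> L")
    case True then show ?thesis by (auto simp: LD_cls dist1_nonneg elim!: LE)
  qed (auto simp: L_dist_def)
  show "LD x y = LD y x" for x y
  proof (cases "x \<in> L \<and> y \<in> L")
    case True then show ?thesis by (auto simp: LD_cls dist1_commute elim!: LE)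
  qed (auto simp: L_dist_def)
  show "LD x y = 0 \<longleftrightarrow> x = y" if "x \<in> L" "y \<in> L" for x y
    using that by (metis LE LD_cls dist1_eq_0 cls_eq_iff)
  show "LD x z \<le> LD x y + LD y z" if "x \<in> L" "y \<in> L" "z \<in> L" for x y z
    using that by (auto simp: LD_cls dist1_triangle elim!: LE)
qed

lemma L_topology_eq: "L_topology \<Omega> T d = LM.mtopology"
  by (simp add: L_topology_def)

section \<open>The isometric action of the group\<close>

lemma act_cls:
  assumes "g \<in> carrier G" "f \<in> RE"
  shows "act g (cls f) = cls (\<lambda>t. g \<otimes> f t)"
proof -
  have "cls (\<lambda>t. g \<otimes> f' t) = cls (\<lambda>t. g \<otimes> f t)" if "f' \<in> cls f" for f'
  proof -
    have f': "f' \<in> RE" "AE t in \<Omega>. f t = f' t" using that assms by (auto simp: in_cls)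
    from f'(2) have "AE t in \<Omega>. g \<otimes> f' t = g \<otimes> f t" by eventually_elim simp
    then show ?thesis using assms f' by (simp add: cls_eq_iff RE_act)
  qed
  moreover have "f \<in> cls f" using assms by (simp add: in_cls)
  ultimately show ?thesis unfolding L_act_def cls_def [symmetric] by blast
qed

lemma act_in: "g \<in> carrier G \<Longrightarrow> e \<in> L \<Longrightarrow> act g e \<in> L"
  by (auto simp: act_cls RE_act elim!: LE)

lemma act_one: "e \<in> L \<Longrightarrow> act \<one> e = e"
proof (elim LE)
  fix f assume f: "f \<in> RE" "e = cls f"
  have "cls (\<lambda>t. \<one> \<otimes> f t) = cls f" using f RE_in by (subst cls_eq_iff) (auto simp: RE_act)
  then show "act \<one> e = e" using f by (simp add: act_cls)
qed

lemma act_mult: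
  assumes "e \<in> L" "g \<in> carrier G" "h \<in> carrier G"
  shows "act (h \<otimes> g) e = act h (act g e)"
proof -
  obtain f where f: "f \<in> RE" "e = cls f" using assms(1) by (rule LE)
  have "cls (\<lambda>t. h \<otimes> g \<otimes> f t) = cls (\<lambda>t. h \<otimes> (g \<otimes> f t))"
    using f assms RE_in by (subst cls_eq_iff) (auto simp: RE_act m_assoc)
  then show ?thesis using f assms by (simp add: act_cls RE_act)
qed

lemma act_inv: "e \<in> L \<Longrightarrow> g \<in> carrier G \<Longrightarrow> act (inv g) (act g e) = e" "e \<in> L \<Longrightarrow> g \<in> carrier G \<Longrightarrow> act g (act (inv g) e) = e"
  by (simp_all add: act_mult [symmetric] act_one)

lemma LD_act:
  assumes "e \<in> L" "e' \<in> L" "g \<in> carrier G"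
  shows "LD (act g e) (act g e') = LD e e'"
proof -
  obtain f f' where f: "f \<in> RE" "e = cls f" "f' \<in> RE" "e' = cls f'" using assms by (metis LE)
  have "dist1 (\<lambda>t. g \<otimes> f t) (\<lambda>t. g \<otimes> f' t) = dist1 f f'"
    unfolding dist1_def by (rule Bochner_Integration.integral_cong) (use f assms RE_in in \<open>auto simp: d_left\<close>)
  then show ?thesis using f assms by (simp add: act_cls LD_cls RE_act)
qed

text \<open>By right invariance the integrand is the constant \<open>d g h\<close>, and the total
  mass is 1. Every orbit is thus an isometric copy of \<open>G\<close>, which later locates a group
  element from distances in \<open>L\<close>.\<close>

lemma LD_act2:
  assumes "e \<in> L" "g \<in> carrier G" "h \<in> carrier G"
  shows "LD (act g e) (act h e) = d g h"
proof -
  obtain f where f: "f \<in> RE" "e = cls f" using assms(1) by (rule LE)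
  have "dist1 (\<lambda>t. g \<otimes> f t) (\<lambda>t. h \<otimes> f t) = (\<integral>t. d g h \<partial>\<Omega>)"
    unfolding dist1_def by (rule Bochner_Integration.integral_cong) (use f assms RE_in in \<open>auto simp: d_right\<close>)
  also have "\<dots> = d g h" using prob_space by simp
  finally show ?thesis using f assms by (simp add: act_cls LD_cls RE_act)
qed

lemma LD_act_le:
  assumes "e \<in> L" "e' \<in> L" "g \<in> carrier G" "h \<in> carrier G"
  shows "LD (act g e) (act h e') \<le> d g h + LD e e'"
  using LM.triangle [of "act g e" "act g e'" "act h e'"] LD_act [of e e' g] LD_act2 [of e' g h] assms
  by (simp add: act_in)

lemma act_continuous: "continuous_map (prod_topology T LM.mtopology) LM.mtopology (\<lambda>(g, e). act g e)"
  unfolding LM.continuous_map_to_metric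
proof (intro ballI allI impI)
  fix p and \<epsilon> :: real assume p: "p \<in> topspace (prod_topology T LM.mtopology)" and \<epsilon>: "0 < \<epsilon>"
  obtain g e where ge: "p = (g, e)" "g \<in> carrier G" "e \<in> L" using p by (auto simp: topspace_T)
  let ?U = "MS.mball g (\<epsilon>/2) \<times> LM.mball e (\<epsilon>/2)"
  have "openin T (MS.mball g (\<epsilon>/2))" using MS.openin_mball by (simp only: mtopology_eq)
  then have "openin (prod_topology T LM.mtopology) ?U"
    using LM.openin_mball unfolding openin_prod_Times_iff by blast
  moreover have "p \<in> ?U" using ge \<epsilon> by simp
  moreover have "(case y of (g, e) \<Rightarrow> act g e) \<in> LM.mball (case p of (g, e) \<Rightarrow> act g e) \<epsilon>" if yU: "y \<in> ?U" for y
  proof -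
    obtain h e' where y: "y = (h, e')" "h \<in> carrier G" "e' \<in> L" "d g h < \<epsilon>/2" "LD e e' < \<epsilon>/2" using yU by auto
    then show ?thesis using ge LD_act_le [of e e' g h] by (simp add: act_in)
  qed
  ultimately show "\<exists>U. openin (prod_topology T LM.mtopology) U \<and> p \<in> U \<and>
      (\<forall>y\<in>U. (case y of (g, e) \<Rightarrow> act g e) \<in> LM.mball (case p of (g, e) \<Rightarrow> act g e) \<epsilon>)" by blast
qed

section \<open>Mixing two random elements\<close>

definition rep where "rep e = (SOME f. f \<in> RE \<and> e = cls f)"

lemma rep: "e \<in> L \<Longrightarrow> rep e \<in> RE" "e \<in> L \<Longrightarrow> cls (rep e) = e"
proof -
  assume "e \<in> L"
  then have "\<exists>f. f \<in> RE \<and> e = cls f" by (auto elim: LE)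
  from someI_ex [OF this] show "rep e \<in> RE" "cls (rep e) = e" by (simp_all add: rep_def)
qed

definition mixL where "mixL s e e' = cls (\<lambda>t. if c t \<le> s then rep e t else rep e' t)"

lemma mixL_cls:
  assumes f: "f \<in> RE" "f' \<in> RE"
  shows "mixL s (cls f) (cls f') = cls (\<lambda>t. if c t \<le> s then f t else f' t)"
proof -
  have r: "rep (cls f) \<in> RE" "rep (cls f') \<in> RE" using rep f by auto
  have "AE t in \<Omega>. rep (cls f) t = f t" "AE t in \<Omega>. rep (cls f') t = f' t"
    using rep(2) [of "cls f"] rep(2) [of "cls f'"] r f by (simp_all add: cls_eq_iff)
  then have "AE t in \<Omega>. (if c t \<le> s then rep (cls f) t else rep (cls f') t) = (if c t \<le> s then f t else f' t)"
    by eventually_elim simp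
  then show ?thesis unfolding mixL_def using r f by (simp add: cls_eq_iff RE_If)
qed

lemma mixL_in: "e \<in> L \<Longrightarrow> e' \<in> L \<Longrightarrow> mixL s e e' \<in> L"
  by (auto simp: mixL_cls RE_If elim!: LE)

lemma mixL_mixL: "e \<in> L \<Longrightarrow> e' \<in> L \<Longrightarrow> e'' \<in> L \<Longrightarrow> mixL s (mixL s e e') e'' = mixL s e e''"
proof (elim LE)
  fix f f' f'' assume "f \<in> RE" "f' \<in> RE" "f'' \<in> RE" "e = cls f" "e' = cls f'" "e'' = cls f''"
  then show "mixL s (mixL s e e') e'' = mixL s e e''"
    by (auto simp: mixL_cls RE_If intro!: arg_cong [where f = cls])
qed

lemma mixL_1: "e \<in> L \<Longrightarrow> e' \<in> L \<Longrightarrow> mixL 1 e e' = e"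
  using c01 by (auto simp: mixL_cls elim!: LE)

text \<open>The set where \<open>c t \<le> 0\<close> may be nonempty, but it is null by
  uniformity.\<close>

lemma mixL_0: "e \<in> L \<Longrightarrow> e' \<in> L \<Longrightarrow> mixL 0 e e' = e'"
proof (elim LE)
  fix f f' assume f: "f \<in> RE" "f' \<in> RE" "e = cls f" "e' = cls f'"
  have "{t \<in> space \<Omega>. c t \<le> 0} \<in> sets \<Omega>" using c_meas by simp
  then have "AE t in \<Omega>. \<not> c t \<le> 0"
    using c_uniform [of 0] by (subst AE_iff_measurable [of "{t \<in> space \<Omega>. c t \<le> 0}"]) (auto simp: emeasure_eq_measure)
  then have "AE t in \<Omega>. (if c t \<le> 0 then f t else f' t) = f' t" by eventually_elim simp
  then have "cls (\<lambda>t. if c t \<le> 0 then f t else f' t) = cls f'" using f by (simp add: cls_eq_iff RE_If)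
  then show "mixL 0 e e' = e'" using f by (simp add: mixL_cls)
qed

lemma act_mixL:
  assumes "g \<in> carrier G" "e \<in> L" "e' \<in> L"
  shows "act g (mixL s e e') = mixL s (act g e) (act g e')"
proof -
  obtain f f' where f: "f \<in> RE" "e = cls f" "f' \<in> RE" "e' = cls f'" using assms by (metis LE)
  have "(\<lambda>t. g \<otimes> (if c t \<le> s then f t else f' t)) = (\<lambda>t. if c t \<le> s then g \<otimes> f t else g \<otimes> f' t)" by auto
  then show ?thesis using f assms by (simp add: mixL_cls act_cls RE_If RE_act)
qed

text \<open>The mixtures for \<open>s \<le> s'\<close> differ only where
  \<open>s < c t \<le> s'\<close>. This set has measure \<open>s' - s\<close>, and on it the values
  are at most \<open>K\<close> apart.\<close>

lemma mixL_dist_parameter: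
  assumes s: "s \<in> {0..1}" "s' \<in> {0..1}" and e: "e \<in> L" "e' \<in> L"
  shows "LD (mixL s e e') (mixL s' e e') \<le> K * \<bar>s - s'\<bar>"
proof -
  have *: "LD (mixL s e e') (mixL s' e e') \<le> K * (s' - s)" if s: "s \<in> {0..1}" "s' \<in> {0..1}" "s \<le> s'" for s s'
  proof -
    obtain f f' where f: "f \<in> RE" "e = cls f" "f' \<in> RE" "e' = cls f'" using e by (metis LE)
    let ?A = "{t \<in> space \<Omega>. c t \<le> s}" and ?A' = "{t \<in> space \<Omega>. c t \<le> s'}"
    have A: "?A \<in> sets \<Omega>" "?A' \<in> sets \<Omega>" using c_meas by simp_all
    have "dist1 (\<lambda>t. if c t \<le> s then f t else f' t) (\<lambda>t. if c t \<le> s' then f t else f' t) \<le> (\<integral>t. K * indicator (?A' - ?A) t \<partial>\<Omega>)"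
      unfolding dist1_def
    proof (rule integral_mono)
      show "integrable \<Omega> (\<lambda>t. d (if c t \<le> s then f t else f' t) (if c t \<le> s' then f t else f' t))"
        using d_integrable [OF RE_If RE_If] f by blast
      show "integrable \<Omega> (\<lambda>t. K * indicator (?A' - ?A) t)"
        using A by (intro integrable_mult_right integrable_real_indicator) (auto simp: emeasure_eq_measure)
      fix t assume "t \<in> space \<Omega>"
      then show "d (if c t \<le> s then f t else f' t) (if c t \<le> s' then f t else f' t) \<le> K * indicator (?A' - ?A) t"
        using K f RE_in s(3) by (auto simp: indicator_def)
    qed
    also have "\<dots> = K * measure \<Omega> (?A' - ?A)" using A by simp
    also have "measure \<Omega> (?A' - ?A) = s' - s"
      using A s c_uniform by (subst finite_measure_Diff) auto
    finally show ?thesis using f by (simp add: mixL_cls LD_cls RE_If)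
  qed
  show ?thesis
  proof (cases "s \<le> s'")
    case True then show ?thesis using * [of s s'] s by simp
  next
    case False then show ?thesis using * [of s' s] s LM.commute by simp
  qed
qed

lemma mixL_dist_args:
  assumes e: "e1 \<in> L" "e2 \<in> L" "e1' \<in> L" "e2' \<in> L"
  shows "LD (mixL s e1 e2) (mixL s e1' e2') \<le> LD e1 e1' + LD e2 e2'"
proof -
  obtain f1 f2 f1' f2' where f: "f1 \<in> RE" "f2 \<in> RE" "f1' \<in> RE" "f2' \<in> RE"
    "e1 = cls f1" "e2 = cls f2" "e1' = cls f1'" "e2' = cls f2'" using e by (metis LE)
  have "dist1 (\<lambda>t. if c t \<le> s then f1 t else f2 t) (\<lambda>t. if c t \<le> s then f1' t else f2' t) \<le>
      (\<integral>t. d (f1 t) (f1' t) + d (f2 t) (f2' t) \<partial>\<Omega>)"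
    unfolding dist1_def
  proof (rule integral_mono)
    show "integrable \<Omega> (\<lambda>t. d (if c t \<le> s then f1 t else f2 t) (if c t \<le> s then f1' t else f2' t))"
      using d_integrable [OF RE_If RE_If] f by blast
  qed (use f d_integrable in auto)
  also have "\<dots> = dist1 f1 f1' + dist1 f2 f2'"
    unfolding dist1_def using f by (intro Bochner_Integration.integral_add d_integrable)
  finally show ?thesis using f by (simp add: mixL_cls LD_cls RE_If)
qed

lemma mixL_continuous:
  "continuous_map (prod_topology (top_of_set {0..1::real}) (prod_topology LM.mtopology LM.mtopology)) LM.mtopology
     (\<lambda>(s, e, e'). mixL s e e')"
  unfolding LM.continuous_map_to_metric
proof (intro ballI allI impI)
  let ?Z = "prod_topology (top_of_set {0..1::real}) (prod_topology LM.mtopology LM.mtopology)"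
  fix p and \<epsilon> :: real assume p: "p \<in> topspace ?Z" and \<epsilon>: "0 < \<epsilon>"
  obtain s e e' where se: "p = (s, e, e')" "s \<in> {0..1}" "e \<in> L" "e' \<in> L" using p by auto
  let ?I = "{0..1} \<inter> ball s (\<epsilon> / (3 * K))"
  let ?U = "?I \<times> LM.mball e (\<epsilon>/3) \<times> LM.mball e' (\<epsilon>/3)"
  have "openin (top_of_set {0..1}) ?I" by (simp add: openin_open_Int)
  then have "openin ?Z ?U" unfolding openin_prod_Times_iff by auto
  moreover have "p \<in> ?U" using se \<epsilon> K by simp
  moreover have "(case y of (s, e, e') \<Rightarrow> mixL s e e') \<in> LM.mball (case p of (s, e, e') \<Rightarrow> mixL s e e') \<epsilon>" if yU: "y \<in> ?U" for y
  proof -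
    obtain s1 e1 e1' where y: "y = (s1, e1, e1')" "s1 \<in> {0..1}" "e1 \<in> L" "e1' \<in> L"
      "dist s s1 < \<epsilon> / (3 * K)" "LD e e1 < \<epsilon>/3" "LD e' e1' < \<epsilon>/3" using yU by auto
    have "LD (mixL s e e') (mixL s1 e1 e1') \<le> LD (mixL s e e') (mixL s1 e e') + LD (mixL s1 e e') (mixL s1 e1 e1')"
      using se y by (intro LM.triangle mixL_in)
    moreover have "LD (mixL s1 e e') (mixL s1 e1 e1') \<le> LD e e1 + LD e' e1'"
      using se y by (intro mixL_dist_args)
    moreover have "LD (mixL s e e') (mixL s1 e e') \<le> K * \<bar>s - s1\<bar>"
      using se y by (intro mixL_dist_parameter)
    moreover have "K * \<bar>s - s1\<bar> < \<epsilon> / 3"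
      using y(5) K(1) by (simp add: dist_real_def field_simps)
    ultimately show ?thesis using y se by (simp add: mixL_in)
  qed
  ultimately show "\<exists>U. openin ?Z U \<and> p \<in> U \<and>
      (\<forall>y\<in>U. (case y of (s, e, e') \<Rightarrow> mixL s e e') \<in> LM.mball (case p of (s, e, e') \<Rightarrow> mixL s e e') \<epsilon>)" by blast
qed

end

section \<open>The orbit space\<close>

context random_elements
begin

section \<open>The metric of the orbit space\<close>

abbreviation orbit where "orbit \<equiv> L_orbit G \<Omega> T"
abbreviation LG where "LG \<equiv> LG_space G \<Omega> T"
abbreviation LGD where "LGD \<equiv> LG_dist G \<Omega> T d"

definition rho where "rho e e' = (INF g\<in>carrier G. LD (act g e) e')"

lemma LD_nonneg [simp]: "0 \<le> LD e e'"
  by (rule LM.nonneg)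

lemma rho_le: "g \<in> carrier G \<Longrightarrow> rho e e' \<le> LD (act g e) e'"
  unfolding rho_def by (rule cINF_lower) (auto intro: bdd_belowI2 [of _ 0])

text \<open>Compactness of \<open>G\<close> turns the infimum into a minimum. The metric axioms, and
  later the continuity of sections, can then be argued with one optimal translate instead of
  approximations.\<close>

lemma rho_attained:
  assumes "e \<in> L" "e' \<in> L"
  obtains g where "g \<in> carrier G" "LD (act g e) e' = rho e e'"
proof -
  have "continuous_map T (prod_topology T LM.mtopology) (\<lambda>g. (g, e))"
    using assms by (intro continuous_map_pairedI) simp_all
  from continuous_map_compose [OF this act_continuous]
  have c: "continuous_map T LM.mtopology (\<lambda>g. act g e)" by (simp add: o_def)
  have "continuous_map T euclideanreal (\<lambda>g. mdist LM.Self (act g e) e')"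
    by (rule continuous_map_mdist) (use c assms in \<open>simp_all add: LM.Self_def\<close>)
  then have "continuous_map T euclideanreal (\<lambda>g. LD (act g e) e')" by simp
  then have "compactin euclideanreal ((\<lambda>g. LD (act g e) e') ` carrier G)"
    using compact image_compactin by (metis compact_space_def topspace_T)
  then have "compact ((\<lambda>g. LD (act g e) e') ` carrier G)" by simp
  then obtain g where g: "g \<in> carrier G" "\<And>h. h \<in> carrier G \<Longrightarrow> LD (act g e) e' \<le> LD (act h e) e'"
    using compact_attains_inf [of "(\<lambda>g. LD (act g e) e') ` carrier G"] one_closed by blast
  then have "LD (act g e) e' \<le> rho e e'" unfolding rho_def by (intro cINF_greatest) auto
  then show thesis using that g rho_le by (meson antisym)
qed

lemma rho_le_shift:
  assumes "e \<in> L" "e' \<in> L" "h \<in> carrier G" "k \<in> carrier G"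
  shows "rho (act h e) (act k e') \<le> rho e e'"
proof -
  obtain g where g: "g \<in> carrier G" "LD (act g e) e' = rho e e'" using assms(1,2) by (rule rho_attained)
  have "act (k \<otimes> g \<otimes> inv h) (act h e) = act k (act g e)"
    using assms g by (simp add: act_mult act_in act_inv)
  then have "LD (act (k \<otimes> g \<otimes> inv h) (act h e)) (act k e') = rho e e'"
    using LD_act [of "act g e" e' k] assms g by (simp add: act_in)
  then show ?thesis using rho_le [of "k \<otimes> g \<otimes> inv h" "act h e" "act k e'"] assms g by simp
qed

lemma rho_act:
  assumes "e \<in> L" "e' \<in> L" "h \<in> carrier G" "k \<in> carrier G"
  shows "rho (act h e) (act k e') = rho e e'"
  using rho_le_shift [OF assms] rho_le_shift [of "act h e" "act k e'" "inv h" "inv k"] assms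
  by (simp add: act_in act_inv)

lemma orbit_eq_iff:
  assumes "e \<in> L" "e' \<in> L"
  shows "orbit e = orbit e' \<longleftrightarrow> (\<exists>g\<in>carrier G. e' = act g e)"
proof
  assume "orbit e = orbit e'"
  moreover have "e' \<in> orbit e'" unfolding L_orbit_def using act_one [OF assms(2)] one_closed by force
  ultimately show "\<exists>g\<in>carrier G. e' = act g e" unfolding L_orbit_def by blast
next
  assume "\<exists>g\<in>carrier G. e' = act g e"
  then obtain g where g: "g \<in> carrier G" "e' = act g e" by blast
  have "act h e' \<in> orbit e" if "h \<in> carrier G" for h
    using act_mult [of e g h] g that assms unfolding L_orbit_def by auto
  moreover have "act h e \<in> orbit e'" if "h \<in> carrier G" for h
  proof -
    have "act h e = act (h \<otimes> inv g) e'" using g that assms by (simp add: act_mult act_in act_inv)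
    then show ?thesis using that g unfolding L_orbit_def by auto
  qed
  ultimately show "orbit e = orbit e'" unfolding L_orbit_def by blast
qed

lemma orbit_act: "e \<in> L \<Longrightarrow> g \<in> carrier G \<Longrightarrow> orbit (act g e) = orbit e"
  using orbit_eq_iff [of e "act g e"] act_in by blast

lemma LG_eq: "LG = orbit ` L"
  by (simp add: LG_space_def)

lemma LGE: "u \<in> LG \<Longrightarrow> (\<And>e. e \<in> L \<Longrightarrow> u = orbit e \<Longrightarrow> thesis) \<Longrightarrow> thesis"
  unfolding LG_eq by (elim imageE) blast

lemma orbit_in [simp]: "e \<in> L \<Longrightarrow> orbit e \<in> LG"
  by (simp add: LG_eq)

lemma LGD_orbit:
  assumes "e \<in> L" "e' \<in> L"
  shows "LGD (orbit e) (orbit e') = rho e e'"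
proof -
  have "(\<Union>c1\<in>orbit e. \<Union>c2\<in>orbit e'. {INF g\<in>carrier G. LD (act g c1) c2}) = {rho e e'}"
  proof -
    have "(INF g\<in>carrier G. LD (act g c1) c2) = rho e e'" if "c1 \<in> orbit e" "c2 \<in> orbit e'" for c1 c2
      using that rho_act [OF assms] by (auto simp: L_orbit_def rho_def [symmetric])
    moreover have "orbit e \<noteq> {}" "orbit e' \<noteq> {}" unfolding L_orbit_def using one_closed by blast+
    ultimately show ?thesis by auto
  qed
  then show ?thesis using assms by (simp add: LG_dist_def)
qed

lemma rho_commute:
  assumes "e \<in> L" "e' \<in> L"
  shows "rho e e' = rho e' e"
proof -
  have *: "rho e' e \<le> rho e e'" if eL: "e \<in> L" "e' \<in> L" for e e'
  proof -
    obtain g where g: "g \<in> carrier G" "LD (act g e) e' = rho e e'" using eL by (rule rho_attained)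
    have "LD (act (inv g) e') e = LD e' (act g e)"
      using LD_act [of "act (inv g) e'" e g] g eL by (simp add: act_in act_inv)
    then show ?thesis using rho_le [of "inv g" e' e] g by (simp add: LM.commute)
  qed
  show ?thesis using * [OF assms] * [OF assms(2,1)] by simp
qed

lemma rho_triangle:
  assumes "e \<in> L" "e' \<in> L" "e'' \<in> L"
  shows "rho e e'' \<le> rho e e' + rho e' e''"
proof -
  obtain g where g: "g \<in> carrier G" "LD (act g e) e' = rho e e'" using assms(1,2) by (rule rho_attained)
  obtain h where h: "h \<in> carrier G" "LD (act h e') e'' = rho e' e''" using assms(2,3) by (rule rho_attained)
  have "rho e e'' \<le> LD (act (h \<otimes> g) e) e''" using g h by (intro rho_le) simp
  also have "\<dots> \<le> LD (act h (act g e)) (act h e') + LD (act h e') e''"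
    using assms g h LM.triangle [of "act h (act g e)" "act h e'" e''] by (simp add: act_mult act_in)
  also have "LD (act h (act g e)) (act h e') = rho e e'" using LD_act g h assms by (simp add: act_in)
  finally show ?thesis using h by simp
qed

sublocale LGM: Metric_space LG LGD
proof
  show "0 \<le> LGD x y" for x y
  proof (cases "x \<in> LG \<and> y \<in> LG")
    case True
    then obtain e e' where e: "e \<in> L" "x = orbit e" "e' \<in> L" "y = orbit e'" by (metis LGE)
    then obtain g where "g \<in> carrier G" "LD (act g e) e' = rho e e'" by (metis rho_attained)
    then show ?thesis using e by (metis LGD_orbit LD_nonneg)
  qed (auto simp: LG_dist_def)
  show "LGD x y = LGD y x" for x y
  proof (cases "x \<in> LG \<and> y \<in> LG")
    case True
    then show ?thesis by (metis LGE LGD_orbit rho_commute)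
  qed (auto simp: LG_dist_def)
  show "LGD x y = 0 \<longleftrightarrow> x = y" if xy: "x \<in> LG" "y \<in> LG" for x y
  proof -
    obtain e e' where e: "e \<in> L" "x = orbit e" "e' \<in> L" "y = orbit e'" using xy by (metis LGE)
    obtain g where g: "g \<in> carrier G" "LD (act g e) e' = rho e e'" using e by (metis rho_attained)
    show ?thesis
    proof
      assume "LGD x y = 0"
      then have "act g e = e'" using g e LGD_orbit by (simp add: act_in)
      then show "x = y" using orbit_act [OF e(1) g(1)] e by simp
    next
      assume "x = y"
      then obtain h where "h \<in> carrier G" "e' = act h e" using e orbit_eq_iff by blast
      then have "rho e e' \<le> 0" using rho_le [of h e e'] e by simp
      moreover have "0 \<le> rho e e'" using g(2) LD_nonneg [of "act g e" e'] by simp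
      ultimately show "LGD x y = 0" using e by (simp add: LGD_orbit)
    qed
  qed
  show "LGD x z \<le> LGD x y + LGD y z" if x: "x \<in> LG" and y: "y \<in> LG" and z: "z \<in> LG" for x y z
  proof -
    obtain e where "e \<in> L" "x = orbit e" using x by (rule LGE)
    moreover obtain e' where "e' \<in> L" "y = orbit e'" using y by (rule LGE)
    moreover obtain e'' where "e'' \<in> L" "z = orbit e''" using z by (rule LGE)
    ultimately show ?thesis by (simp add: LGD_orbit rho_triangle)
  qed
qed

lemma LG_topology_eq: "LG_topology G \<Omega> T d = LGM.mtopology"
  by (simp add: LG_topology_def)

lemma LGD_orbit_le: "e \<in> L \<Longrightarrow> e' \<in> L \<Longrightarrow> LGD (orbit e) (orbit e') \<le> LD e e'"
  using rho_le [of \<one> e e'] by (simp add: LGD_orbit act_one)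

lemma orbit_continuous: "continuous_map LM.mtopology LGM.mtopology orbit"
  unfolding LM.metric_continuous_map [OF LGM.Metric_space_axioms]
proof (intro conjI ballI allI impI)
  show "orbit ` L \<subseteq> LG" by (simp add: LG_eq)
  show "\<exists>\<delta>>0. \<forall>x. x \<in> L \<and> LD a x < \<delta> \<longrightarrow> LGD (orbit a) (orbit x) < \<epsilon>" if "a \<in> L" "0 < \<epsilon>" for a \<epsilon>
    using that LGD_orbit_le by (intro exI [of _ \<epsilon>]) (meson order_le_less_trans)
qed

text \<open>The union of all translates of a ball around \<open>e0\<close>; by
  \<open>tube_eq\<close> it is the preimage of a ball of the orbit space, hence open and
  invariant.\<close>

definition tube where "tube \<epsilon> e0 = {e \<in> L. \<exists>h\<in>carrier G. LD (act h e) e0 < \<epsilon>}"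

lemma tube_eq: "e0 \<in> L \<Longrightarrow> tube \<epsilon> e0 = {e \<in> L. orbit e \<in> LGM.mball (orbit e0) \<epsilon>}"
proof -
  assume e0: "e0 \<in> L"
  have iff: "(\<exists>h\<in>carrier G. LD (act h e) e0 < \<epsilon>) \<longleftrightarrow> rho e0 e < \<epsilon>" if e: "e \<in> L" for e
  proof
    assume "\<exists>h\<in>carrier G. LD (act h e) e0 < \<epsilon>"
    then obtain h where "h \<in> carrier G" "LD (act h e) e0 < \<epsilon>" by blast
    then show "rho e0 e < \<epsilon>" using rho_le [of h e e0] rho_commute [OF e e0] by simp
  next
    assume *: "rho e0 e < \<epsilon>"
    obtain h where "h \<in> carrier G" "LD (act h e) e0 = rho e e0" using e e0 by (rule rho_attained)
    then have "h \<in> carrier G" "LD (act h e) e0 < \<epsilon>" using * rho_commute [OF e e0] by simp_all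
    then show "\<exists>h\<in>carrier G. LD (act h e) e0 < \<epsilon>" by (rule bexI [rotated])
  qed
  have "tube \<epsilon> e0 = {e \<in> L. rho e0 e < \<epsilon>}"
    unfolding tube_def by (intro Collect_cong conj_cong refl) (rule iff)
  also have "\<dots> = {e \<in> L. orbit e \<in> LGM.mball (orbit e0) \<epsilon>}"
  proof (intro Collect_cong conj_cong refl)
    fix e assume "e \<in> L"
    then show "rho e0 e < \<epsilon> \<longleftrightarrow> orbit e \<in> LGM.mball (orbit e0) \<epsilon>"
      using e0 by (simp only: LGM.in_mball LGD_orbit orbit_in simp_thms)
  qed
  finally show ?thesis .
qed

text \<open>An equivariant continuous \<open>\<theta>\<close> from an invariant neighbourhood to
  \<open>G\<close> is a fibre coordinate. The points where it takes the value \<open>\<one>\<close>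
  form a slice that meets every orbit of the tube exactly once, and the slice provides the local
  section.\<close>

theorem principal_bundle_LG:
  assumes slice: "\<And>e0. e0 \<in> L \<Longrightarrow> \<exists>\<epsilon>>0. \<exists>\<theta>. (\<forall>e\<in>tube \<epsilon> e0. \<theta> e \<in> carrier G) \<and>
      (\<forall>e\<in>tube \<epsilon> e0. \<forall>h\<in>carrier G. \<theta> (act h e) = h \<otimes> \<theta> e) \<and>
      continuous_map (subtopology LM.mtopology (tube \<epsilon> e0)) T \<theta>"
  shows "principal_bundle G T (LG_topology G \<Omega> T d) (LG_bundle G \<Omega> T d)"
proof (rule principal_bundleI)
  let ?P = "LG_bundle G \<Omega> T d"
  have P: "btotal ?P = LM.mtopology" "bproj ?P = orbit" "bact ?P = act"
    by (simp_all add: LG_bundle_def L_topology_eq)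
  show "continuous_map (btotal ?P) (LG_topology G \<Omega> T d) (bproj ?P)"
    unfolding P LG_topology_eq by (rule orbit_continuous)
  show "continuous_map (prod_topology T (btotal ?P)) (btotal ?P) (\<lambda>(g, e). bact ?P g e)"
    unfolding P by (rule act_continuous)
  show "bact ?P \<one> e = e" if "e \<in> topspace (btotal ?P)" for e
    using that by (simp add: P act_one)
  show "bproj ?P (bact ?P g e) = bproj ?P e" if "e \<in> topspace (btotal ?P)" "g \<in> carrier G" for e g
    using that by (simp add: P orbit_act)
  show "bact ?P (h \<otimes> g) e = bact ?P h (bact ?P g e)"
    if "e \<in> topspace (btotal ?P)" "g \<in> carrier G" "h \<in> carrier G" for e g h
    using that by (simp add: P act_mult)
  fix x assume "x \<in> topspace (LG_topology G \<Omega> T d)"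
  then have "x \<in> LG" by (simp add: LG_topology_eq)
  then obtain e0 where e0: "e0 \<in> L" "x = orbit e0" by (rule LGE)
  obtain \<epsilon> \<theta> where \<epsilon>: "\<epsilon> > 0" and \<theta>: "\<And>e. e \<in> tube \<epsilon> e0 \<Longrightarrow> \<theta> e \<in> carrier G"
    and \<theta>g: "\<And>e h. e \<in> tube \<epsilon> e0 \<Longrightarrow> h \<in> carrier G \<Longrightarrow> \<theta> (act h e) = h \<otimes> \<theta> e"
    and \<theta>c: "continuous_map (subtopology LM.mtopology (tube \<epsilon> e0)) T \<theta>"
    using slice [OF e0(1)] by blast
  define U where "U = LGM.mball x \<epsilon>"
  have N: "tube \<epsilon> e0 = {e \<in> L. orbit e \<in> U}" using tube_eq [OF e0(1)] by (simp add: U_def e0)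
  let ?N = "tube \<epsilon> e0"
  have NL: "?N \<subseteq> L" by (auto simp: N)
  have Nact: "act g e \<in> ?N" if "e \<in> ?N" "g \<in> carrier G" for e g
    using that by (auto simp: N act_in orbit_act)
  have UL: "U \<subseteq> LG" by (auto simp: U_def)
  define r where "r u = (SOME e. e \<in> L \<and> orbit e = u)" for u
  have r: "r u \<in> ?N" "orbit (r u) = u" if "u \<in> U" for u
  proof -
    have "\<exists>e. e \<in> L \<and> orbit e = u" using that UL by (metis LGE subsetD)
    from someI_ex [OF this] show "r u \<in> ?N" "orbit (r u) = u" using that by (auto simp: r_def N)
  qed
  \<comment> \<open>The projection of the tube to the slice along orbits. It is constant on orbits,
    so the value \<open>s u\<close> does not depend on the representative chosen by
    \<open>r\<close>.\<close>
  define \<sigma> where "\<sigma> e = act (inv (\<theta> e)) e" for e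
  define s where "s u = \<sigma> (r u)" for u
  have \<sigma>g: "\<sigma> (act g e) = \<sigma> e" if "e \<in> ?N" "g \<in> carrier G" for e g
  proof -
    have eL: "e \<in> L" using that NL by blast
    have "act (inv (g \<otimes> \<theta> e)) (act g e) = act (inv (\<theta> e)) (act (inv g) (act g e))"
      using that \<theta> eL by (simp add: inv_mult_group act_mult act_in)
    then show ?thesis using that \<theta>g eL by (simp add: \<sigma>_def act_inv)
  qed
  have s_eq: "s (orbit e) = \<sigma> e" if e: "e \<in> ?N" for e
  proof -
    have u: "orbit e \<in> U" "e \<in> L" using e by (auto simp: N)
    obtain g where "g \<in> carrier G" "e = act g (r (orbit e))"
      using orbit_eq_iff [of "r (orbit e)" e] r [OF u(1)] u NL by blast
    then show ?thesis using \<sigma>g [of "r (orbit e)" g] r [OF u(1)] by (simp add: s_def)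
  qed
  have \<sigma>N: "\<sigma> e \<in> ?N" "orbit (\<sigma> e) = orbit e" "\<theta> (\<sigma> e) = \<one>" if "e \<in> ?N" for e
    using that \<theta> \<theta>g Nact orbit_act NL by (auto simp: \<sigma>_def subset_iff)
  have \<sigma>c: "continuous_map (subtopology LM.mtopology ?N) LM.mtopology \<sigma>"
  proof -
    have "continuous_map (subtopology LM.mtopology ?N) (prod_topology T LM.mtopology) (\<lambda>e. (inv (\<theta> e), e))"
      by (intro continuous_map_pairedI continuous_map_inv \<theta>c continuous_map_from_subtopology) simp
    from continuous_map_compose [OF this act_continuous] show ?thesis by (simp add: o_def \<sigma>_def [abs_def])
  qed
  have Nopen: "openin LM.mtopology ?N"
    using openin_continuous_map_preimage [OF orbit_continuous, of U] by (simp add: N U_def)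
  have sc: "continuous_map (subtopology LGM.mtopology U) LM.mtopology s"
    unfolding LM.continuous_map_to_metric
  proof (intro ballI allI impI)
    fix u and \<eta> :: real assume "u \<in> topspace (subtopology LGM.mtopology U)" and \<eta>: "0 < \<eta>"
    then have u: "u \<in> U" by auto
    let ?e = "s u"
    have e: "?e \<in> ?N" "orbit ?e = u" "\<sigma> ?e = ?e"
      using \<sigma>N [OF r(1) [OF u]] r [OF u] NL by (auto simp: s_def \<sigma>_def [of "\<sigma> (r u)"] act_one)
    have "?e \<in> topspace (subtopology LM.mtopology ?N)" using e(1) NL by auto
    from \<sigma>c [unfolded LM.continuous_map_to_metric, THEN bspec, OF this, THEN spec, THEN mp, OF \<eta>]
    obtain W where W: "openin (subtopology LM.mtopology ?N) W" "?e \<in> W" "\<forall>y\<in>W. \<sigma> y \<in> LM.mball (\<sigma> ?e) \<eta>"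
      by (elim exE conjE) (rule that)
    have WN: "openin LM.mtopology W" "W \<subseteq> ?N"
      using W(1) Nopen openin_open_subtopology by blast+
    then obtain \<delta> where \<delta>: "\<delta> > 0" "LM.mball ?e \<delta> \<subseteq> W"
      using W(2) unfolding LM.openin_mtopology by blast
    let ?O = "U \<inter> LGM.mball u \<delta>"
    have "openin (subtopology LGM.mtopology U) ?O" by (simp add: openin_subtopology_Int2)
    moreover have "u \<in> ?O" using u \<delta> UL by auto
    moreover have "s y \<in> LM.mball (s u) \<eta>" if y: "y \<in> ?O" for y
    proof -
      have yU: "y \<in> U" and yd: "LGD u y < \<delta>" using y by auto
      have L': "r y \<in> L" "?e \<in> L" using r [OF yU] e NL by auto
      \<comment> \<open>Of all representatives of the orbit \<open>y\<close>, the nearest to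
        \<open>s u\<close> is taken. Its distance to \<open>s u\<close> equals the distance of the
        orbits, so continuity of \<open>\<sigma>\<close> at \<open>s u\<close> applies to
        it.\<close>
      obtain g where g: "g \<in> carrier G" "LD (act g (r y)) ?e = rho (r y) ?e"
        using L' by (rule rho_attained)
      have "rho (r y) ?e = LGD y u" using LGD_orbit [OF L'] r [OF yU] e by simp
      then have "LD ?e (act g (r y)) < \<delta>" using g yd LM.commute LGM.commute by metis
      then have "act g (r y) \<in> LM.mball ?e \<delta>" using L' g act_in by simp
      then have "\<sigma> (act g (r y)) \<in> LM.mball (\<sigma> ?e) \<eta>" using \<delta> W by blast
      moreover have "\<sigma> (act g (r y)) = s y" using \<sigma>g [OF r(1) [OF yU] g(1)] by (simp add: s_def)
      ultimately show ?thesis using e by simp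
    qed
    ultimately show "\<exists>W. openin (subtopology LGM.mtopology U) W \<and> u \<in> W \<and> (\<forall>y\<in>W. s y \<in> LM.mball (s u) \<eta>)"
      by blast
  qed
  have p1: "openin LGM.mtopology U" by (simp add: U_def)
  have p2: "x \<in> U" using e0 \<epsilon> by (simp add: U_def)
  have p3: "\<forall>u\<in>U. orbit (s u) = u" using r \<sigma>N by (simp add: s_def)
  have p4: "\<forall>e\<in>L. orbit e \<in> U \<longrightarrow> act (\<theta> e) (s (orbit e)) = e"
    using s_eq \<theta> NL by (auto simp: N \<sigma>_def act_inv)
  have p5: "\<forall>u\<in>U. \<forall>g\<in>carrier G. \<theta> (act g (s u)) = g"
    using \<sigma>N r \<theta>g by (simp add: s_def)
  show "\<exists>U s \<theta>. openin (LG_topology G \<Omega> T d) U \<and> x \<in> U \<and>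
        continuous_map (subtopology (LG_topology G \<Omega> T d) U) (btotal ?P) s \<and>
        continuous_map (subtopology (btotal ?P) {e \<in> topspace (btotal ?P). bproj ?P e \<in> U}) T \<theta> \<and>
        (\<forall>u\<in>U. bproj ?P (s u) = u) \<and>
        (\<forall>e\<in>topspace (btotal ?P). bproj ?P e \<in> U \<longrightarrow> bact ?P (\<theta> e) (s (bproj ?P e)) = e) \<and>
        (\<forall>u\<in>U. \<forall>g\<in>carrier G. \<theta> (bact ?P g (s u)) = g)"
    unfolding P LG_topology_eq LM.topspace_mtopology
    by (rule exI [of _ U], rule exI [of _ s], rule exI [of _ \<theta>], intro conjI)
      (fact p1 p2 p3 p4 p5 sc \<theta>c [unfolded N])+
qed

end

section \<open>Equivariant averages near a random element\<close>

text \<open>The sum norm is chosen because estimates and integrals can be handled coordinate by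
  coordinate, and because the norm of a concatenation is the sum of the two norms.\<close>

definition norm1 :: "nat \<Rightarrow> (nat \<Rightarrow> real) \<Rightarrow> real" where
  "norm1 n x = (\<Sum>i<n. \<bar>x i\<bar>)"

definition box1 :: "nat \<Rightarrow> real \<Rightarrow> (nat \<Rightarrow> real) set" where
  "box1 n r = {x. (\<forall>i\<ge>n. x i = 0) \<and> norm1 n x \<le> r}"

lemma norm1_nonneg [simp]: "0 \<le> norm1 n x"
  by (simp add: norm1_def sum_nonneg)

lemma norm1_triangle: "norm1 n (\<lambda>i. x i + y i) \<le> norm1 n x + norm1 n y"
  unfolding norm1_def sum.distrib [symmetric] by (rule sum_mono) (rule abs_triangle_ineq)

lemma norm1_minus: "norm1 n (\<lambda>i. x i - y i) = norm1 n (\<lambda>i. y i - x i)"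
  by (simp add: norm1_def abs_minus_commute)

lemma norm1_triangle_diff: "norm1 n (\<lambda>i. x i - z i) \<le> norm1 n (\<lambda>i. x i - y i) + norm1 n (\<lambda>i. y i - z i)"
  using norm1_triangle [of n "\<lambda>i. x i - y i" "\<lambda>i. y i - z i"] by simp

lemma norm1_triangle_sub: "norm1 n (\<lambda>i. x i - y i) \<le> norm1 n x + norm1 n y"
  unfolding norm1_def sum.distrib [symmetric] by (rule sum_mono) (rule abs_triangle_ineq4)

lemma norm1_component: "i < n \<Longrightarrow> \<bar>x i\<bar> \<le> norm1 n x"
  unfolding norm1_def by (rule member_le_sum) auto

lemma norm1_eq_0: "norm1 n x = 0 \<longleftrightarrow> (\<forall>i<n. x i = 0)"
  by (auto simp: norm1_def sum_nonneg_eq_0_iff)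

lemma norm1_zero [simp]: "norm1 n (\<lambda>_. 0) = 0"
  by (simp add: norm1_def)

lemma box1_mono: "r \<le> s \<Longrightarrow> box1 n r \<subseteq> box1 n s"
  by (auto simp: box1_def)

lemma Metric_space_box1: "Metric_space (box1 n r) (\<lambda>x y. norm1 n (\<lambda>i. x i - y i))"
proof
  fix x y assume xy: "x \<in> box1 n r" "y \<in> box1 n r"
  show "norm1 n (\<lambda>i. x i - y i) = 0 \<longleftrightarrow> x = y"
  proof
    assume "norm1 n (\<lambda>i. x i - y i) = 0"
    then have "x i = y i" if "i < n" for i using that by (auto simp: norm1_eq_0)
    moreover have "x i = y i" if "\<not> i < n" for i using that xy by (auto simp: box1_def)
    ultimately show "x = y" by blast
  qed simp
next
  show "norm1 n (\<lambda>i. x i - y i) = norm1 n (\<lambda>i. y i - x i)" for x y by (rule norm1_minus)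
  show "norm1 n (\<lambda>i. x i - z i) \<le> norm1 n (\<lambda>i. x i - y i) + norm1 n (\<lambda>i. y i - z i)" for x y z
    by (rule norm1_triangle_diff)
qed simp

text \<open>Provides the completeness for Banach's fixed-point theorem: coordinatewise limits stay
  in the ball because it is closed.\<close>

lemma mcomplete_box1: "Metric_space.mcomplete (box1 n r) (\<lambda>x y. norm1 n (\<lambda>i. x i - y i))"
proof -
  interpret M: Metric_space "box1 n r" "\<lambda>x y. norm1 n (\<lambda>i. x i - y i)" by (rule Metric_space_box1)
  show ?thesis
    unfolding M.mcomplete_def
  proof (intro allI impI)
    fix \<sigma> :: "nat \<Rightarrow> nat \<Rightarrow> real" assume \<sigma>: "M.MCauchy \<sigma>"
    then have in_box: "\<sigma> k \<in> box1 n r" for k by (auto simp: M.MCauchy_def)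
    have C: "\<exists>N. \<forall>k k'. N \<le> k \<longrightarrow> N \<le> k' \<longrightarrow> norm1 n (\<lambda>i. \<sigma> k i - \<sigma> k' i) < \<epsilon>" if "\<epsilon> > 0" for \<epsilon>
      using \<sigma> that unfolding M.MCauchy_def by blast
    have "Cauchy (\<lambda>k. \<sigma> k i)" if "i < n" for i
    proof (rule CauchyI)
      fix \<epsilon> :: real assume "0 < \<epsilon>"
      then obtain N where N: "\<forall>k k'. N \<le> k \<longrightarrow> N \<le> k' \<longrightarrow> norm1 n (\<lambda>i. \<sigma> k i - \<sigma> k' i) < \<epsilon>" using C by blast
      have "norm (\<sigma> k i - \<sigma> k' i) < \<epsilon>" if "N \<le> k" "N \<le> k'" for k k'
        using N that norm1_component [OF \<open>i < n\<close>, of "\<lambda>i. \<sigma> k i - \<sigma> k' i"] by fastforce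
      then show "\<exists>M. \<forall>m\<ge>M. \<forall>k\<ge>M. norm (\<sigma> m i - \<sigma> k i) < \<epsilon>" by blast
    qed
    then have conv: "convergent (\<lambda>k. \<sigma> k i)" if "i < n" for i
      using that Cauchy_convergent_iff by blast
    define y where "y i = (if i < n then lim (\<lambda>k. \<sigma> k i) else 0)" for i
    have lim: "(\<lambda>k. \<sigma> k i) \<longlonglongrightarrow> y i" for i
    proof (cases "i < n")
      case True then show ?thesis using conv by (simp add: y_def convergent_LIMSEQ_iff)
    next
      case False then show ?thesis using in_box by (simp add: y_def box1_def)
    qed
    have "(\<lambda>k. norm1 n (\<sigma> k)) \<longlonglongrightarrow> norm1 n y"
      unfolding norm1_def by (intro tendsto_intros lim)
    then have "norm1 n y \<le> r"
      using in_box by (intro LIMSEQ_le_const2 [of _ "norm1 n y"]) (auto simp: box1_def)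
    then have y: "y \<in> box1 n r" by (simp add: box1_def y_def)
    have "(\<lambda>k. norm1 n (\<lambda>i. \<sigma> k i - y i)) \<longlonglongrightarrow> norm1 n (\<lambda>i. y i - y i)"
      unfolding norm1_def by (intro tendsto_intros lim)
    then have "(\<lambda>k. norm1 n (\<lambda>i. \<sigma> k i - y i)) \<longlonglongrightarrow> 0" by simp
    then have "\<exists>N. \<forall>k\<ge>N. \<sigma> k \<in> box1 n r \<and> norm1 n (\<lambda>i. \<sigma> k i - y i) < \<epsilon>" if "\<epsilon> > 0" for \<epsilon>
      using in_box LIMSEQ_D [OF _ that] by fastforce
    then show "\<exists>x. limitin M.mtopology \<sigma> x sequentially"
      using y unfolding M.limit_metric_sequentially by blast
  qed
qed

text \<open>\<open>v\<close> is a chart at the identity multiplied by a cut-off function, and \<open>\<psi>\<close> the inverse of the chart,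
  both shifted so that the identity has coordinates \<open>0\<close>.\<close>

locale compact_group_chart = compact_metric_group G T d
  for G :: "('g, 'm) monoid_scheme" (structure) and T :: "'g topology" and d :: "'g \<Rightarrow> 'g \<Rightarrow> real" +
  fixes n :: nat and R :: real and \<psi> :: "(nat \<Rightarrow> real) \<Rightarrow> 'g" and v :: "'g \<Rightarrow> nat \<Rightarrow> real"
    and \<delta>W :: real and C :: real
  assumes R: "R > 0" and \<psi>_in: "\<And>y. y \<in> box1 n R \<Longrightarrow> \<psi> y \<in> carrier G" and \<psi>_0: "\<psi> (\<lambda>_. 0) = \<one>"
    and \<psi>_nbhd: "\<exists>\<delta>>0. \<forall>g\<in>carrier G. d \<one> g < \<delta> \<longrightarrow> g \<in> \<psi> ` box1 n R"
    and \<psi>_small: "\<And>\<delta>. \<delta> > 0 \<Longrightarrow> \<exists>r>0. r \<le> R \<and> (\<forall>y\<in>box1 n r. d \<one> (\<psi> y) < \<delta>)"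
    and v_cont: "\<And>i. i < n \<Longrightarrow> continuous_map T euclideanreal (\<lambda>g. v g i)"
    and v_0: "\<And>g i. i \<ge> n \<Longrightarrow> v g i = 0" and v_one: "\<And>i. v \<one> i = 0"
    and \<delta>W: "\<delta>W > 0" and C: "C \<ge> 0"
    and v_near: "\<And>x y y'. x \<in> carrier G \<Longrightarrow> d \<one> x < \<delta>W \<Longrightarrow> y \<in> box1 n R \<Longrightarrow> y' \<in> box1 n R \<Longrightarrow>
       norm1 n (\<lambda>i. v (x \<otimes> \<psi> y) i - v (x \<otimes> \<psi> y') i - (y i - y' i)) \<le> norm1 n (\<lambda>i. y i - y' i) / 4"
    and v_far: "\<And>x y y'. x \<in> carrier G \<Longrightarrow> y \<in> box1 n R \<Longrightarrow> y' \<in> box1 n R \<Longrightarrow>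
       norm1 n (\<lambda>i. v (x \<otimes> \<psi> y) i - v (x \<otimes> \<psi> y') i) \<le> C * norm1 n (\<lambda>i. y i - y' i)"
begin

text \<open>A single bound, affine in \<open>d \<one> x\<close>, replaces the distinction between
  \<open>x\<close> near to and far from the identity. In the far case
  \<open>d \<one> x / \<delta>W\<close> is at least 1, which pays for the crude constant
  \<open>C + 1\<close>, as in Markov's inequality. After integration only the L1 distance is
  left.\<close>

lemma v_near_far:
  assumes x: "x \<in> carrier G" and y: "y \<in> box1 n R" "y' \<in> box1 n R"
  shows "norm1 n (\<lambda>i. v (x \<otimes> \<psi> y) i - v (x \<otimes> \<psi> y') i - (y i - y' i)) \<le>
    (1/4 + (C + 1) * d \<one> x / \<delta>W) * norm1 n (\<lambda>i. y i - y' i)"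
proof (cases "d \<one> x < \<delta>W")
  case True
  have "0 \<le> (C + 1) * d \<one> x / \<delta>W * norm1 n (\<lambda>i. y i - y' i)" using C \<delta>W by simp
  then show ?thesis using v_near [OF x True y] by (simp add: distrib_right)
next
  case False
  then have "1 \<le> d \<one> x / \<delta>W" using \<delta>W by simp
  then have "(C + 1) * 1 \<le> (C + 1) * (d \<one> x / \<delta>W)" using C by (intro mult_left_mono) auto
  then have k: "C + 1 \<le> 1/4 + (C + 1) * d \<one> x / \<delta>W" by simp
  have "norm1 n (\<lambda>i. v (x \<otimes> \<psi> y) i - v (x \<otimes> \<psi> y') i - (y i - y' i)) \<le>
      norm1 n (\<lambda>i. v (x \<otimes> \<psi> y) i - v (x \<otimes> \<psi> y') i) + norm1 n (\<lambda>i. y i - y' i)"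
    by (rule norm1_triangle_sub)
  also have "norm1 n (\<lambda>i. v (x \<otimes> \<psi> y) i - v (x \<otimes> \<psi> y') i) + norm1 n (\<lambda>i. y i - y' i) \<le> (C + 1) * norm1 n (\<lambda>i. y i - y' i)"
    using v_far [OF x y] by (simp add: distrib_right)
  also have "\<dots> \<le> (1/4 + (C + 1) * d \<one> x / \<delta>W) * norm1 n (\<lambda>i. y i - y' i)"
    using k by (intro mult_right_mono) auto
  finally show ?thesis .
qed

lemma v_bounded: "\<exists>B>0. \<forall>i<n. \<forall>g\<in>carrier G. \<bar>v g i\<bar> \<le> B"
proof -
  have "\<exists>B. \<forall>g\<in>carrier G. \<bar>v g i\<bar> \<le> B" if "i < n" for i
  proof -
    have "compactin euclideanreal ((\<lambda>g. v g i) ` topspace T)"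
      using compact v_cont [OF that] image_compactin unfolding compact_space_def by blast
    then have "bounded ((\<lambda>g. v g i) ` carrier G)" by (simp add: topspace_T compact_imp_bounded)
    then show ?thesis unfolding bounded_iff by auto
  qed
  then obtain B where B: "\<And>i g. i < n \<Longrightarrow> g \<in> carrier G \<Longrightarrow> \<bar>v g i\<bar> \<le> B i" by metis
  have "\<bar>v g i\<bar> \<le> 1 + (\<Sum>j<n. \<bar>B j\<bar>)" if "i < n" "g \<in> carrier G" for i g
    using B [OF that] member_le_sum [of i "{..<n}" "\<lambda>j. \<bar>B j\<bar>"] that by auto
  moreover have "0 < 1 + (\<Sum>j<n. \<bar>B j\<bar>)" by (smt (verit) abs_ge_zero sum_nonneg)
  ultimately show ?thesis by blast
qed

text \<open>An affine modulus of continuity, again made for integration: uniform continuity gives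
  \<open>\<eta>\<close> at distances below some \<delta>, and beyond that boundedness by
  \<open>B\<close> gives the slope \<open>2 * B / \<delta>\<close>.\<close>

lemma v_modulus:
  assumes "\<eta> > 0"
  shows "\<exists>A\<ge>0. \<forall>x\<in>carrier G. \<forall>y\<in>carrier G. norm1 n (\<lambda>i. v x i - v y i) \<le> \<eta> + A * d x y"
proof -
  obtain B where B: "B > 0" "\<And>i g. i < n \<Longrightarrow> g \<in> carrier G \<Longrightarrow> \<bar>v g i\<bar> \<le> B" using v_bounded by blast
  \<comment> \<open>The bounds of the \<open>n\<close> coordinates are added up; the summand 1
    admits \<open>n = 0\<close>, the case of a finite group.\<close>
  define \<eta>' where "\<eta>' = \<eta> / (real n + 1)"
  have \<eta>': "\<eta>' > 0" using assms by (simp add: \<eta>'_def)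
  have "\<exists>A\<ge>0. \<forall>x\<in>carrier G. \<forall>y\<in>carrier G. \<bar>v x i - v y i\<bar> \<le> \<eta>' + A * d x y" if i: "i < n" for i
  proof -
    have "uniformly_continuous_map MS.Self euclidean_metric (\<lambda>g. v g i)"
      using continuous_imp_uniformly_continuous_map [of MS.Self euclidean_metric "\<lambda>g. v g i"] compact v_cont [OF i]
      by (simp add: MS.Self_def mtopology_eq)
    then obtain \<delta> where \<delta>: "\<delta> > 0" "\<And>x y. x \<in> carrier G \<Longrightarrow> y \<in> carrier G \<Longrightarrow> d y x < \<delta> \<Longrightarrow> \<bar>v y i - v x i\<bar> < \<eta>'"
      using \<eta>' unfolding uniformly_continuous_map_def by (auto simp: dist_real_def)
    have "\<bar>v x i - v y i\<bar> \<le> \<eta>' + 2 * B / \<delta> * d x y" if "x \<in> carrier G" "y \<in> carrier G" for x y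
    proof (cases "d x y < \<delta>")
      case True
      then have "\<bar>v x i - v y i\<bar> < \<eta>'" using \<delta> that by blast
      moreover have "0 \<le> 2 * B / \<delta> * d x y" using B \<delta> by simp
      ultimately show ?thesis by linarith
    next
      case False
      then have "1 \<le> d x y / \<delta>" using \<delta> by simp
      then have "2 * B * 1 \<le> 2 * B * (d x y / \<delta>)" using B(1) by (intro mult_left_mono) auto
      then show ?thesis using B(2) [OF i that(1)] B(2) [OF i that(2)] \<eta>' by (simp add: abs_if split: if_splits)
    qed
    then show ?thesis using B \<delta> by (intro exI [of _ "2 * B / \<delta>"]) auto
  qed
  then obtain A where A: "\<And>i. i < n \<Longrightarrow> A i \<ge> 0" 
    "\<And>i x y. i < n \<Longrightarrow> x \<in> carrier G \<Longrightarrow> y \<in> carrier G \<Longrightarrow> \<bar>v x i - v y i\<bar> \<le> \<eta>' + A i * d x y" by metis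
  have "norm1 n (\<lambda>i. v x i - v y i) \<le> \<eta> + (\<Sum>i<n. A i) * d x y" if "x \<in> carrier G" "y \<in> carrier G" for x y
  proof -
    have "norm1 n (\<lambda>i. v x i - v y i) \<le> (\<Sum>i<n. \<eta>' + A i * d x y)"
      unfolding norm1_def by (rule sum_mono) (use A that in auto)
    also have "\<dots> = real n * \<eta>' + (\<Sum>i<n. A i) * d x y" by (simp add: sum.distrib sum_distrib_right)
    also have "real n * \<eta>' \<le> \<eta>" using assms by (simp add: \<eta>'_def field_simps)
    finally show ?thesis by simp
  qed
  moreover have "0 \<le> (\<Sum>i<n. A i)" using A by (intro sum_nonneg) auto
  ultimately show ?thesis by blast
qed

end

locale charted_random_elements = random_elements G T d \<Omega> c K + compact_group_chart G T d n R \<psi> v \<delta>W C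
  for G :: "('g, 'm) monoid_scheme" (structure) and T d \<Omega> c K n R \<psi> v \<delta>W C +
  fixes f0 assumes f0: "f0 \<in> \<Omega> \<rightarrow>\<^sub>M borel_of T"
begin

section \<open>The averaged displacement and its zeros\<close>

text \<open>A substitute for the missing mean value in a noncommutative group: a zero
  \<open>g\<close> near the identity plays the part of the average displacement from
  \<open>f0\<close> to \<open>f\<close>.\<close>

definition V where "V f g i = (\<integral>t. v (f0 t \<otimes> inv (f t) \<otimes> g) i \<partial>\<Omega>)"

lemma integrand_RE: "f \<in> RE \<Longrightarrow> g \<in> carrier G \<Longrightarrow> (\<lambda>t. f0 t \<otimes> inv (f t) \<otimes> g) \<in> RE"
  by (intro RE_mult RE_inv RE_const f0)

lemma v_integrable:
  assumes "f \<in> RE"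
  shows "integrable \<Omega> (\<lambda>t. v (f t) i)"
proof (cases "i < n")
  case True
  obtain B where "\<forall>i<n. \<forall>g\<in>carrier G. \<bar>v g i\<bar> \<le> B" using v_bounded by blast
  moreover have "(\<lambda>t. v (f t) i) \<in> borel_measurable \<Omega>"
    using measurable_borel_of_compose [OF assms v_cont [OF True]] by (simp add: borel_of_euclidean)
  ultimately show ?thesis using True assms RE_in by (intro bounded_integrable [of _ B]) auto
next
  case False
  then show ?thesis using v_0 by simp
qed

lemma norm1_integral:
  assumes "\<And>i. i < n \<Longrightarrow> integrable \<Omega> (\<lambda>t. h t i)"
    and k: "integrable \<Omega> k" and le: "\<And>t. t \<in> space \<Omega> \<Longrightarrow> norm1 n (h t) \<le> k t"
  shows "norm1 n (\<lambda>i. \<integral>t. h t i \<partial>\<Omega>) \<le> (\<integral>t. k t \<partial>\<Omega>)"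
proof -
  have "norm1 n (\<lambda>i. \<integral>t. h t i \<partial>\<Omega>) \<le> (\<Sum>i<n. \<integral>t. \<bar>h t i\<bar> \<partial>\<Omega>)"
    unfolding norm1_def by (intro sum_mono integral_abs_bound)
  also have "\<dots> = (\<integral>t. norm1 n (h t) \<partial>\<Omega>)"
    unfolding norm1_def using assms(1) by (intro Bochner_Integration.integral_sum [symmetric]) auto
  also have "\<dots> \<le> (\<integral>t. k t \<partial>\<Omega>)"
    using assms unfolding norm1_def by (intro integral_mono) auto
  finally show ?thesis .
qed

lemma d_one_div:
  assumes "f \<in> RE" "t \<in> space \<Omega>"
  shows "d \<one> (f0 t \<otimes> inv (f t)) = d (f t) (f0 t)"
  using d_right [of "f t" \<one> "f0 t \<otimes> inv (f t)"] RE_in [OF assms] RE_in [OF f0 assms(2)] by (simp add: m_assoc)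

text \<open>Integrating \<open>v_near_far\<close> gives the factor
  \<open>1/4 + (C + 1) * dist1 f f0 / \<delta>W\<close>. The radius
  \<open>\<delta>W / (4 * (C + 1))\<close> is the one for which this is at most 1/2.\<close>

lemma V_contraction:
  assumes f: "f \<in> RE" and close: "dist1 f f0 \<le> \<delta>W / (4 * (C + 1))" and y: "y \<in> box1 n R" "y' \<in> box1 n R"
  shows "norm1 n (\<lambda>i. V f (\<psi> y) i - V f (\<psi> y') i - (y i - y' i)) \<le> norm1 n (\<lambda>i. y i - y' i) / 2"
proof -
  let ?x = "\<lambda>t. f0 t \<otimes> inv (f t)" and ?N = "norm1 n (\<lambda>i. y i - y' i)"
  let ?k = "\<lambda>t. (1/4 + (C + 1) * d (f t) (f0 t) / \<delta>W) * ?N"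
  have int: "integrable \<Omega> (\<lambda>t. v (?x t \<otimes> \<psi> y) i)" if "y \<in> box1 n R" for y i
    using v_integrable [OF integrand_RE [OF f \<psi>_in [OF that]]] .
  have eq: "V f (\<psi> y) i - V f (\<psi> y') i - (y i - y' i) =
      (\<integral>t. v (?x t \<otimes> \<psi> y) i - v (?x t \<otimes> \<psi> y') i - (y i - y' i) \<partial>\<Omega>)" for i
    unfolding V_def using int y prob_space by simp
  have "norm1 n (\<lambda>i. V f (\<psi> y) i - V f (\<psi> y') i - (y i - y' i)) \<le> (\<integral>t. ?k t \<partial>\<Omega>)"
    unfolding eq
  proof (rule norm1_integral)
    show "integrable \<Omega> (\<lambda>t. v (?x t \<otimes> \<psi> y) i - v (?x t \<otimes> \<psi> y') i - (y i - y' i))" for i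
      using int y by simp
    show "integrable \<Omega> ?k" using d_integrable [OF f f0] by simp
    fix t assume t: "t \<in> space \<Omega>"
    show "norm1 n (\<lambda>i. v (?x t \<otimes> \<psi> y) i - v (?x t \<otimes> \<psi> y') i - (y i - y' i)) \<le> ?k t"
      using v_near_far [OF _ y, of "?x t"] RE_in [OF f t] RE_in [OF f0 t] d_one_div [OF f t] by simp
  qed
  also have "(\<integral>t. ?k t \<partial>\<Omega>) = (1/4 + (C + 1) * dist1 f f0 / \<delta>W) * ?N"
    using d_integrable [OF f f0] prob_space by (simp add: dist1_def)
  also have "\<dots> \<le> (1/2) * ?N"
  proof (rule mult_right_mono)
    have "(C + 1) * dist1 f f0 \<le> (C + 1) * (\<delta>W / (4 * (C + 1)))" using close C by (intro mult_left_mono) auto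
    also have "\<dots> = \<delta>W / 4" using C by (simp add: field_simps)
    finally show "1/4 + (C + 1) * dist1 f f0 / \<delta>W \<le> 1/2" using \<delta>W by (simp add: field_simps)
  qed simp
  finally show ?thesis by simp
qed

lemma d_inv:
  assumes "x \<in> carrier G" "y \<in> carrier G"
  shows "d (inv x) (inv y) = d x y"
proof -
  have "d (inv x) (inv y) = d (x \<otimes> inv x \<otimes> y) (x \<otimes> inv y \<otimes> y)"
    using assms d_left [of x "inv x" "inv y"] d_right [of y "x \<otimes> inv x" "x \<otimes> inv y"] by simp
  also have "\<dots> = d y x" using assms by (simp add: m_assoc)
  finally show ?thesis by (simp add: MS.commute)
qed

text \<open>Uniformity in \<open>g\<close> comes from bi-invariance: the distance between the two
  arguments of \<open>v\<close> is \<open>d (f t) (f' t)\<close>, free of \<open>f0\<close> and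
  \<open>g\<close>.\<close>

lemma V_uniform:
  assumes "\<eta> > 0"
  shows "\<exists>\<delta>>0. \<forall>f\<in>RE. \<forall>f'\<in>RE. \<forall>g\<in>carrier G. dist1 f f' < \<delta> \<longrightarrow> norm1 n (\<lambda>i. V f g i - V f' g i) < \<eta>"
proof -
  have "\<eta> / 2 > 0" using assms by simp
  from v_modulus [OF this] obtain A where A: "A \<ge> 0"
    "\<And>x y. x \<in> carrier G \<Longrightarrow> y \<in> carrier G \<Longrightarrow> norm1 n (\<lambda>i. v x i - v y i) \<le> \<eta>/2 + A * d x y" by blast
  have "norm1 n (\<lambda>i. V f g i - V f' g i) < \<eta>"
    if f: "f \<in> RE" "f' \<in> RE" and g: "g \<in> carrier G" and close: "dist1 f f' < \<eta> / (2 * (A + 1))" for f f' g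
  proof -
    let ?x = "\<lambda>f t. f0 t \<otimes> inv (f t) \<otimes> g"
    have int: "integrable \<Omega> (\<lambda>t. v (?x f t) i)" if "f \<in> RE" for f i
      using v_integrable [OF integrand_RE [OF that g]] .
    have eq: "V f g i - V f' g i = (\<integral>t. v (?x f t) i - v (?x f' t) i \<partial>\<Omega>)" for i
      unfolding V_def using int f by simp
    have "norm1 n (\<lambda>i. V f g i - V f' g i) \<le> (\<integral>t. \<eta>/2 + A * d (f t) (f' t) \<partial>\<Omega>)"
      unfolding eq
    proof (rule norm1_integral)
      show "integrable \<Omega> (\<lambda>t. v (?x f t) i - v (?x f' t) i)" for i using int f by simp
      show "integrable \<Omega> (\<lambda>t. \<eta>/2 + A * d (f t) (f' t))" using d_integrable [OF f] by simp
      fix t assume t: "t \<in> space \<Omega>"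
      have ft: "f0 t \<in> carrier G" "f t \<in> carrier G" "f' t \<in> carrier G" using RE_in t f f0 by auto
      have "d (?x f t) (?x f' t) = d (f t) (f' t)" using ft g by (simp add: d_left d_right d_inv)
      then show "norm1 n (\<lambda>i. v (?x f t) i - v (?x f' t) i) \<le> \<eta>/2 + A * d (f t) (f' t)"
        using A(2) [of "?x f t" "?x f' t"] ft g by simp
    qed
    also have "\<dots> = \<eta>/2 + A * dist1 f f'" using d_integrable [OF f] prob_space by (simp add: dist1_def)
    also have "\<dots> < \<eta>"
    proof -
      have "A * dist1 f f' \<le> A * (\<eta> / (2 * (A + 1)))" using close A by (intro mult_left_mono) auto
      also have "\<dots> < \<eta> / 2" using A assms by (simp add: field_simps)
      finally show ?thesis by simp
    qed
    finally show ?thesis .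
  qed
  moreover have "\<eta> / (2 * (A + 1)) > 0" using A assms by simp
  ultimately show ?thesis by blast
qed

lemma V_f0: "V f0 \<one> i = 0"
proof -
  have "V f0 \<one> i = (\<integral>t. 0 \<partial>\<Omega>)"
    unfolding V_def by (rule Bochner_Integration.integral_cong) (use RE_in [OF f0] v_one in auto)
  then show ?thesis by simp
qed

text \<open>The integrand contains \<open>f\<close> and \<open>g\<close> only through
  \<open>inv (f t) \<otimes> g\<close>, in which a common left factor cancels.\<close>

lemma V_act:
  assumes "f \<in> RE" "g \<in> carrier G" "h \<in> carrier G"
  shows "V (\<lambda>t. h \<otimes> f t) (h \<otimes> g) i = V f g i"
  unfolding V_def
proof (rule Bochner_Integration.integral_cong)
  fix t assume t: "t \<in> space \<Omega>"
  have "f0 t \<otimes> inv (h \<otimes> f t) \<otimes> (h \<otimes> g) = f0 t \<otimes> inv (f t) \<otimes> g"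
  proof -
    have ft: "f0 t \<in> carrier G" "f t \<in> carrier G" using RE_in t assms f0 by auto
    have "inv h \<otimes> (h \<otimes> g) = g" using assms by (simp add: m_assoc [symmetric])
    then show ?thesis using ft assms by (simp add: inv_mult_group m_assoc)
  qed
  then show "v (f0 t \<otimes> inv (h \<otimes> f t) \<otimes> (h \<otimes> g)) i = v (f0 t \<otimes> inv (f t) \<otimes> g) i" by simp
qed simp

lemma V_cong:
  assumes "f \<in> RE" "f' \<in> RE" "g \<in> carrier G" "AE t in \<Omega>. f t = f' t"
  shows "V f g i = V f' g i"
  unfolding V_def
proof (rule integral_cong_AE)
  show "(\<lambda>t. v (f0 t \<otimes> inv (f t) \<otimes> g) i) \<in> borel_measurable \<Omega>" "(\<lambda>t. v (f0 t \<otimes> inv (f' t) \<otimes> g) i) \<in> borel_measurable \<Omega>"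
    using v_integrable [OF integrand_RE] assms by blast+
  show "AE t in \<Omega>. v (f0 t \<otimes> inv (f t) \<otimes> g) i = v (f0 t \<otimes> inv (f' t) \<otimes> g) i"
    using assms(4) by eventually_elim simp
qed

definition VL where "VL e g i = V (rep e) g i"

lemma VL_cls: "f \<in> RE \<Longrightarrow> g \<in> carrier G \<Longrightarrow> VL (cls f) g i = V f g i"
  unfolding VL_def by (rule V_cong) (use rep [of "cls f"] in \<open>auto simp flip: cls_eq_iff\<close>)

lemma VL_act:
  assumes "e \<in> L" "g \<in> carrier G" "h \<in> carrier G"
  shows "VL (act h e) (h \<otimes> g) i = VL e g i"
proof -
  obtain f where f: "f \<in> RE" "e = cls f" using assms(1) by (rule LE)
  then show ?thesis using assms V_act [OF f(1)] by (simp add: act_cls VL_cls RE_act)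
qed

abbreviation e0 where "e0 \<equiv> cls f0"

lemma e0: "e0 \<in> L"
  using f0 by simp

lemma VL_contraction:
  assumes "e \<in> L" "LD e e0 \<le> \<delta>W / (4 * (C + 1))" "y \<in> box1 n R" "y' \<in> box1 n R"
  shows "norm1 n (\<lambda>i. VL e (\<psi> y) i - VL e (\<psi> y') i - (y i - y' i)) \<le> norm1 n (\<lambda>i. y i - y' i) / 2"
proof -
  obtain f where f: "f \<in> RE" "e = cls f" using assms(1) by (rule LE)
  then show ?thesis using assms V_contraction [OF f(1) _ assms(3,4)] f0 \<psi>_in by (simp add: VL_cls LD_cls)
qed

lemma VL_uniform:
  assumes "\<eta> > 0"
  shows "\<exists>\<delta>>0. \<forall>e\<in>L. \<forall>e'\<in>L. \<forall>g\<in>carrier G. LD e e' < \<delta> \<longrightarrow> norm1 n (\<lambda>i. VL e g i - VL e' g i) < \<eta>"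
proof -
  obtain \<delta> where \<delta>: "\<delta> > 0" "\<forall>f\<in>RE. \<forall>f'\<in>RE. \<forall>g\<in>carrier G. dist1 f f' < \<delta> \<longrightarrow> norm1 n (\<lambda>i. V f g i - V f' g i) < \<eta>"
    using V_uniform [OF assms] by blast
  have "norm1 n (\<lambda>i. VL e g i - VL e' g i) < \<eta>" if e: "e \<in> L" "e' \<in> L" and g: "g \<in> carrier G" and "LD e e' < \<delta>" for e e' g
  proof -
    obtain f where f: "f \<in> RE" "e = cls f" using e(1) by (rule LE)
    obtain f' where f': "f' \<in> RE" "e' = cls f'" using e(2) by (rule LE)
    show ?thesis using \<delta> f f' g \<open>LD e e' < \<delta>\<close> by (simp add: VL_cls LD_cls)
  qed
  then show ?thesis using \<delta>(1) by blast
qed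

text \<open>\<open>\<theta> e\<close> is the zero \<open>g\<close> of \<open>VL e\<close> for which
  \<open>e\<close> is close to the translate of \<open>e0\<close> by \<open>g\<close>. Both
  conditions are invariant under simultaneous translation of \<open>e\<close> and \<open>g\<close>.
  So uniqueness and continuity are proved after moving one solution to \<open>\<one>\<close>, and
  existence after moving \<open>e\<close> near \<open>e0\<close>, where the chart and the
  contraction estimate apply.\<close>

theorem local_equivariant_map:
  "\<exists>\<epsilon>>0. \<exists>\<theta>. (\<forall>e\<in>tube \<epsilon> e0. \<theta> e \<in> carrier G) \<and>
      (\<forall>e\<in>tube \<epsilon> e0. \<forall>h\<in>carrier G. \<theta> (act h e) = h \<otimes> \<theta> e) \<and>
      continuous_map (subtopology LM.mtopology (tube \<epsilon> e0)) T \<theta>"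
proof -
  obtain \<delta>R where \<delta>R: "\<delta>R > 0" "\<And>g. g \<in> carrier G \<Longrightarrow> d \<one> g < \<delta>R \<Longrightarrow> g \<in> \<psi> ` box1 n R"
    using \<psi>_nbhd by blast
  \<comment> \<open>The first bound is the one of \<open>VL_contraction\<close>. The second forces a
    competing solution \<open>g\<close> into the chart: \<open>d \<one> g\<close> is at most the sum
    of the distances of \<open>e\<close> from \<open>e0\<close> and from its translate by
    \<open>g\<close>, hence below \<open>2 * \<delta> \<le> \<delta>R\<close>.\<close>
  define \<delta> where "\<delta> = min (\<delta>W / (4 * (C + 1))) (\<delta>R / 2)"
  have \<delta>: "\<delta> > 0" "\<delta> \<le> \<delta>W / (4 * (C + 1))" "2 * \<delta> \<le> \<delta>R" using \<delta>W C \<delta>R by (auto simp: \<delta>_def)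
  have zero_box: "(\<lambda>_. 0) \<in> box1 n r" if "r \<ge> 0" for r using that by (simp add: box1_def)
  \<comment> \<open>Closeness is measured from the translate of \<open>e0\<close> by
    \<open>g\<close> rather than from \<open>e0\<close>; otherwise the predicate would not be
    equivariant.\<close>
  define Z where "Z e g \<longleftrightarrow> g \<in> carrier G \<and> LD e (act g e0) < \<delta> \<and> (\<forall>i<n. VL e g i = 0)" for e g
  have Z_act: "Z (act h e) (h \<otimes> g) \<longleftrightarrow> Z e g" if "e \<in> L" "h \<in> carrier G" "g \<in> carrier G" for e g h
    using that e0 VL_act [OF that(1,3,2)] LD_act [of e "act g e0" h] by (simp add: Z_def act_mult act_in)
  have near: "\<exists>y\<in>box1 n R. g = \<psi> y" if "e \<in> L" "LD e e0 < \<delta>" "g \<in> carrier G" "LD e (act g e0) < \<delta>" for e g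
  proof -
    have "d \<one> g = LD (act \<one> e0) (act g e0)" using that e0 by (simp only: LD_act2 one_closed)
    also have "\<dots> \<le> LD e e0 + LD e (act g e0)"
      using that e0 LM.triangle'' [of e0 e "act g e0"] by (simp add: act_one act_in)
    finally have "d \<one> g < \<delta>R" using that \<delta> by simp
    then show ?thesis using \<delta>R(2) that by blast
  qed
  have unique1: "g = \<one>" if e: "e \<in> L" and Z1: "Z e \<one>" and Zg: "Z e g" for e g
  proof -
    have c: "LD e e0 < \<delta>" using Z1 e0 by (simp add: Z_def act_one)
    then obtain y where y: "y \<in> box1 n R" "g = \<psi> y" using near [OF e c] Zg unfolding Z_def by blast
    have 0: "(\<lambda>_. 0) \<in> box1 n R" using R by (intro zero_box) simp
    \<comment> \<open>Both values of \<open>VL\<close> vanish, so the contraction estimate bounds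
      \<open>y\<close> by half of itself.\<close>
    have "norm1 n (\<lambda>i. VL e (\<psi> y) i - VL e (\<psi> (\<lambda>_. 0)) i - (y i - 0)) = norm1 n y"
      using Z1 Zg y by (simp add: norm1_def Z_def \<psi>_0)
    then have "norm1 n y \<le> norm1 n y / 2"
      using VL_contraction [OF e _ y(1) 0] c \<delta> by simp
    then have "norm1 n y = 0" using norm1_nonneg [of n y] by linarith
    then have "y = (\<lambda>_. 0)" using y(1) by (auto simp: norm1_eq_0 box1_def fun_eq_iff) (metis not_le)
    then show ?thesis using y \<psi>_0 by simp
  qed
  have unique: "g = g'" if e: "e \<in> L" and Zs: "Z e g" "Z e g'" for e g g'
  proof -
    have gG: "g \<in> carrier G" "g' \<in> carrier G" using Zs by (auto simp: Z_def)
    have "Z (act (inv g) e) \<one>" "Z (act (inv g) e) (inv g \<otimes> g')"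
      using Z_act [OF e, of "inv g" g] Z_act [OF e, of "inv g" g'] Zs gG by simp_all
    then have "inv g \<otimes> g' = \<one>" using unique1 [of "act (inv g) e"] e gG act_in by simp
    then show ?thesis using gG by (metis inv_closed inv_equality inv_inv)
  qed
  obtain r where r: "r > 0" "r \<le> R" "\<And>y. y \<in> box1 n r \<Longrightarrow> d \<one> (\<psi> y) < \<delta> / 2"
    using \<psi>_small [of "\<delta>/2"] \<delta>(1) by auto
  obtain \<epsilon>1 where \<epsilon>1: "\<epsilon>1 > 0" "\<And>e e' g. e \<in> L \<Longrightarrow> e' \<in> L \<Longrightarrow> g \<in> carrier G \<Longrightarrow> LD e e' < \<epsilon>1 \<Longrightarrow>
      norm1 n (\<lambda>i. VL e g i - VL e' g i) < r / 2"
    using VL_uniform [of "r/2"] r by auto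
  \<comment> \<open>\<open>\<epsilon>1\<close> makes \<open>VL e \<one>\<close> small enough to
    start the iteration. The other bound leaves \<delta>/2 for the displacement by
    \<open>\<psi> y\<close>, so that the zero found satisfies the closeness condition of
    \<open>Z\<close>.\<close>
  define \<epsilon> where "\<epsilon> = min \<epsilon>1 (\<delta> / 2)"
  have \<epsilon>: "\<epsilon> > 0" using \<epsilon>1 \<delta> by (simp add: \<epsilon>_def)
  have exists1: "\<exists>g. Z e g" if e: "e \<in> L" "LD e e0 < \<epsilon>" for e
  proof -
    have ed: "LD e e0 < \<epsilon>1" "LD e e0 < \<delta>/2" "LD e e0 \<le> \<delta>W / (4 * (C + 1))" using e \<delta> by (auto simp: \<epsilon>_def)
    have VL0: "norm1 n (VL e \<one>) < r / 2"
      using \<epsilon>1(2) [OF e(1) e0 one_closed ed(1)] f0 by (simp add: VL_cls V_f0 eta_contract_eq)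
    \<comment> \<open>A simplified Newton iteration: fixed points are zeros of \<open>VL e\<close>
      in the chart. It halves distances and moves 0 by less than r/2, hence maps the ball of radius
      \<open>r\<close> into itself.\<close>
    define \<Phi> where "\<Phi> y = (\<lambda>i. y i - VL e (\<psi> y) i)" for y
    have rR: "box1 n r \<subseteq> box1 n R" using r by (intro box1_mono)
    have contr: "norm1 n (\<lambda>i. \<Phi> y i - \<Phi> y' i) \<le> 1/2 * norm1 n (\<lambda>i. y i - y' i)" if "y \<in> box1 n r" "y' \<in> box1 n r" for y y'
    proof -
      have "norm1 n (\<lambda>i. \<Phi> y i - \<Phi> y' i) = norm1 n (\<lambda>i. VL e (\<psi> y) i - VL e (\<psi> y') i - (y i - y' i))"
        unfolding norm1_def \<Phi>_def by (rule sum.cong) auto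
      then show ?thesis using VL_contraction [OF e(1) ed(3), of y y'] that rR by auto
    qed
    have V_high: "VL e g i = 0" if "i \<ge> n" for g i using v_0 that by (simp add: VL_def V_def)
    have 0: "(\<lambda>_. 0) \<in> box1 n r" using r by (intro zero_box) simp
    have maps: "\<Phi> y \<in> box1 n r" if y: "y \<in> box1 n r" for y
    proof -
      have "norm1 n (\<Phi> y) \<le> norm1 n (\<lambda>i. \<Phi> y i - \<Phi> (\<lambda>_. 0) i) + norm1 n (\<Phi> (\<lambda>_. 0))"
        using norm1_triangle [of n "\<lambda>i. \<Phi> y i - \<Phi> (\<lambda>_. 0) i" "\<Phi> (\<lambda>_. 0)"] by simp
      also have "norm1 n (\<lambda>i. \<Phi> y i - \<Phi> (\<lambda>_. 0) i) \<le> r / 2"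
        using contr [OF y 0] y by (simp add: box1_def)
      also have "norm1 n (\<Phi> (\<lambda>_. 0)) \<le> r / 2" using VL0 by (simp add: \<Phi>_def \<psi>_0 norm1_def)
      finally show ?thesis using y V_high by (simp add: box1_def \<Phi>_def)
    qed
    obtain y where y: "y \<in> box1 n r" "\<Phi> y = y"
    proof (rule Metric_space.Banach_fixedpoint_thm [OF Metric_space_box1 mcomplete_box1, of n r \<Phi> "1/2"])
      show "box1 n r \<noteq> {}" using 0 by blast
      show "\<Phi> \<in> box1 n r \<rightarrow> box1 n r" using maps by blast
    qed (use contr in auto)
    have VLy: "VL e (\<psi> y) i = 0" for i using fun_cong [OF y(2), of i] by (simp add: \<Phi>_def)
    have \<psi>y: "\<psi> y \<in> carrier G" using \<psi>_in y rR by blast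
    have "LD e (act (\<psi> y) e0) \<le> LD e e0 + LD e0 (act (\<psi> y) e0)"
      using e e0 \<psi>y by (intro LM.triangle act_in)
    also have "LD e0 (act (\<psi> y) e0) = d \<one> (\<psi> y)"
      using LD_act2 [OF e0 one_closed \<psi>y] e0 by (simp add: act_one)
    finally have "LD e (act (\<psi> y) e0) < \<delta>" using r(3) [OF y(1)] ed by simp
    then show ?thesis using VLy \<psi>y unfolding Z_def by blast
  qed
  have exists: "\<exists>g. Z e g" if "e \<in> tube \<epsilon> e0" for e
  proof -
    obtain h where h: "e \<in> L" "h \<in> carrier G" "LD (act h e) e0 < \<epsilon>" using \<open>e \<in> tube \<epsilon> e0\<close> unfolding tube_def by blast
    then obtain g where g: "Z (act h e) g" using exists1 act_in by blast
    then have gG: "g \<in> carrier G" by (simp add: Z_def)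
    have "g = h \<otimes> (inv h \<otimes> g)" using gG h by (simp add: m_assoc [symmetric])
    then have "Z e (inv h \<otimes> g)" using Z_act [OF h(1,2), of "inv h \<otimes> g"] g gG h by simp
    then show ?thesis by blast
  qed
  define \<theta> where "\<theta> e = (THE g. Z e g)" for e
  have \<theta>: "Z e (\<theta> e)" if "e \<in> tube \<epsilon> e0" for e
  proof -
    have "\<exists>!g. Z e g" using exists [OF that] unique that unfolding tube_def by blast
    then show ?thesis unfolding \<theta>_def by (rule theI')
  qed
  have \<theta>_eq: "\<theta> e = g" if "e \<in> L" "Z e g" for e g
    unfolding \<theta>_def using that unique by (intro the_equality) auto
  have \<theta>G: "\<theta> e \<in> carrier G" if "e \<in> tube \<epsilon> e0" for e using \<theta> [OF that] by (simp add: Z_def)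
  have \<theta>g: "\<theta> (act h e) = h \<otimes> \<theta> e" if "e \<in> tube \<epsilon> e0" "h \<in> carrier G" for e h
  proof -
    have "e \<in> L" using that by (simp add: tube_def)
    then show ?thesis using Z_act [of e h "\<theta> e"] \<theta> \<theta>G that by (intro \<theta>_eq) (simp_all add: act_in)
  qed
  have "continuous_map (subtopology LM.mtopology (tube \<epsilon> e0)) MS.mtopology \<theta>"
    unfolding MS.continuous_map_to_metric
  proof (intro ballI allI impI)
    fix e and \<eta> :: real assume "e \<in> topspace (subtopology LM.mtopology (tube \<epsilon> e0))" and \<eta>: "0 < \<eta>"
    then have e: "e \<in> tube \<epsilon> e0" "e \<in> L" by auto
    define g where "g = \<theta> e"
    have gG: "g \<in> carrier G" using \<theta>G e by (simp add: g_def)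
    \<comment> \<open>Translating by \<open>inv g\<close> moves the solution at \<open>e\<close> to
      \<open>\<one>\<close>, the centre of the chart; left invariance transfers the estimates
      back.\<close>
    define k where "k = act (inv g) e"
    have kL: "k \<in> L" using e gG by (simp add: k_def act_in)
    have Zk: "Z k \<one>" using Z_act [OF e(2), of "inv g" g] \<theta> [OF e(1)] gG by (simp add: k_def g_def)
    then have kd: "LD k e0 < \<delta>" using e0 by (simp add: Z_def act_one)
    obtain r1 where r1: "r1 > 0" "r1 \<le> R" "\<And>y. y \<in> box1 n r1 \<Longrightarrow> d \<one> (\<psi> y) < \<eta>"
      using \<psi>_small [OF \<eta>] by blast
    obtain \<delta>1 where \<delta>1: "\<delta>1 > 0" "\<And>e e' g. e \<in> L \<Longrightarrow> e' \<in> L \<Longrightarrow> g \<in> carrier G \<Longrightarrow> LD e e' < \<delta>1 \<Longrightarrow>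
        norm1 n (\<lambda>i. VL e g i - VL e' g i) < r1 / 2"
      using VL_uniform [of "r1/2"] r1 by auto
    \<comment> \<open>The second bound keeps the translated point \<open>k'\<close> within \<delta>
      of \<open>e0\<close>, so that its solution lies in the chart and the contraction estimate
      holds for \<open>k'\<close> too.\<close>
    define \<delta>3 where "\<delta>3 = min \<delta>1 (\<delta> - LD k e0)"
    have \<delta>3: "\<delta>3 > 0" using \<delta>1 kd by (simp add: \<delta>3_def)
    let ?O = "tube \<epsilon> e0 \<inter> LM.mball e \<delta>3"
    have "openin (subtopology LM.mtopology (tube \<epsilon> e0)) ?O" by (simp add: openin_subtopology_Int2)
    moreover have "e \<in> ?O" using e \<delta>3 by simp
    moreover have "\<theta> e' \<in> MS.mball (\<theta> e) \<eta>" if e': "e' \<in> ?O" for e'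
    proof -
      have e'': "e' \<in> tube \<epsilon> e0" "e' \<in> L" "LD e e' < \<delta>3" using e' by auto
      define k' where "k' = act (inv g) e'"
      have k'L: "k' \<in> L" using e'' gG by (simp add: k'_def act_in)
      have kk': "LD k k' < \<delta>3" using LD_act [OF e(2) e''(2), of "inv g"] e'' gG by (simp add: k_def k'_def)
      have k'd: "LD k' e0 < \<delta>" using LM.triangle'' [of k' k e0] kk' k'L kL e0 by (simp add: \<delta>3_def)
      define g' where "g' = inv g \<otimes> \<theta> e'"
      have g'G: "g' \<in> carrier G" using gG \<theta>G e'' by (simp add: g'_def)
      have Zk': "Z k' g'" using Z_act [OF e''(2), of "inv g" "\<theta> e'"] \<theta> [OF e''(1)] gG \<theta>G [OF e''(1)]
        by (simp add: k'_def g'_def)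
      then obtain y where y: "y \<in> box1 n R" "g' = \<psi> y" using near [OF k'L k'd g'G] unfolding Z_def by blast
      have 0: "(\<lambda>_. 0) \<in> box1 n R" using R by (intro zero_box) simp
      have small: "norm1 n (VL k' \<one>) < r1 / 2"
      proof -
        have "norm1 n (\<lambda>i. VL k' \<one> i - VL k \<one> i) < r1 / 2"
          using \<delta>1(2) [OF k'L kL one_closed] kk' by (simp add: \<delta>3_def LM.commute)
        also have "norm1 n (\<lambda>i. VL k' \<one> i - VL k \<one> i) = norm1 n (VL k' \<one>)"
          using Zk by (simp add: norm1_def Z_def)
        finally show ?thesis .
      qed
      \<comment> \<open>As \<open>VL k'\<close> vanishes at \<open>\<psi> y\<close>, the estimate
        shows that \<open>norm1 n y\<close> is at most twice \<open>norm1 n (VL k' \<one>)\<close>,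
        hence below \<open>r1\<close>.\<close>
      have "norm1 n (\<lambda>i. VL k' (\<psi> y) i - VL k' (\<psi> (\<lambda>_. 0)) i - (y i - 0)) \<le> norm1 n y / 2"
        using VL_contraction [OF k'L _ y(1) 0] k'd \<delta> by simp
      moreover have "norm1 n (\<lambda>i. VL k' (\<psi> y) i - VL k' (\<psi> (\<lambda>_. 0)) i - (y i - 0)) = norm1 n (\<lambda>i. VL k' \<one> i + y i)"
        using Zk' y unfolding norm1_def Z_def \<psi>_0 by (intro sum.cong) auto
      moreover have "norm1 n y \<le> norm1 n (\<lambda>i. VL k' \<one> i + y i) + norm1 n (VL k' \<one>)"
        using norm1_triangle_sub [of n "\<lambda>i. VL k' \<one> i + y i" "VL k' \<one>"] by simp
      ultimately have "norm1 n y < r1" using small by linarith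
      then have "y \<in> box1 n r1" using y by (simp add: box1_def)
      then have "d \<one> g' < \<eta>" using r1(3) y by simp
      moreover have "d (\<theta> e) (\<theta> e') = d \<one> g'"
        using d_left [of "inv g" g "\<theta> e'"] gG \<theta>G [OF e''(1)] by (simp add: g'_def g_def)
      ultimately show ?thesis using \<theta>G e e'' by simp
    qed
    ultimately show "\<exists>U. openin (subtopology LM.mtopology (tube \<epsilon> e0)) U \<and> e \<in> U \<and> (\<forall>y\<in>U. \<theta> y \<in> MS.mball (\<theta> e) \<eta>)"
      by blast
  qed
  then have "continuous_map (subtopology LM.mtopology (tube \<epsilon> e0)) T \<theta>" unfolding mtopology_eq .
  then show ?thesis using \<epsilon> \<theta>G \<theta>g by blast
qed

end

section \<open>Charts of a compact Lie group\<close>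

text \<open>The topology is inherited from an infinite product, where a basic open set restricts
  only finitely many coordinates. A norm ball within the model space therefore fits into it.\<close>

lemma openin_Euclidean_space_box:
  assumes S: "openin (Euclidean_space n) S" and a: "a \<in> S"
  shows "\<exists>r>0. \<forall>x\<in>topspace (Euclidean_space n). norm1 n (\<lambda>i. x i - a i) \<le> r \<longrightarrow> x \<in> S"
proof -
  obtain O' where O': "openin (powertop_real UNIV) O'" "S = O' \<inter> {x. \<forall>i\<ge>n. x i = 0}"
    using S unfolding Euclidean_space_def openin_subtopology by blast
  have aO: "a \<in> O'" using a O' by blast
  have "\<forall>x\<in>O'. \<exists>U. finite {i \<in> UNIV. U i \<noteq> topspace euclideanreal} \<and>
      (\<forall>i\<in>UNIV. openin euclideanreal (U i)) \<and> x \<in> Pi\<^sub>E UNIV U \<and> Pi\<^sub>E UNIV U \<subseteq> O'"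
    using O'(1) unfolding openin_product_topology_alt .
  from bspec [OF this aO] obtain U where U: "finite {i. U i \<noteq> UNIV}" "\<And>i. open (U i)" "a \<in> Pi\<^sub>E UNIV U" "Pi\<^sub>E UNIV U \<subseteq> O'"
    by auto
  have "\<exists>r>0. \<forall>t. \<bar>t - a i\<bar> \<le> r \<longrightarrow> t \<in> U i" for i
  proof -
    have "a i \<in> U i" using U(3) by (auto simp: PiE_def)
    then obtain e where e: "e > 0" "cball (a i) e \<subseteq> U i" using U(2) open_contains_cball by blast
    then have "t \<in> U i" if "\<bar>t - a i\<bar> \<le> e" for t
      using that by (auto simp: dist_real_def abs_minus_commute subset_iff)
    then show ?thesis using e(1) by blast
  qed
  then obtain r where r: "\<And>i. r i > 0" "\<And>i t. \<bar>t - a i\<bar> \<le> r i \<Longrightarrow> t \<in> U i" by metis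
  \<comment> \<open>The element 1 keeps the minimum meaningful when no coordinate is
    restricted.\<close>
  define s where "s = Min (insert 1 (r ` {i. U i \<noteq> UNIV}))"
  have s: "s > 0" using U(1) r(1) by (auto simp: s_def)
  have sr: "s \<le> r i" if "U i \<noteq> UNIV" for i unfolding s_def using U(1) that by (intro Min_le) auto
  have "x \<in> S" if x: "x \<in> topspace (Euclidean_space n)" "norm1 n (\<lambda>i. x i - a i) \<le> s" for x
  proof -
    have x0: "\<forall>i\<ge>n. x i = 0" using x by (simp add: topspace_Euclidean_space)
    have a0: "\<forall>i\<ge>n. a i = 0" using a O' by blast
    have "x i \<in> U i" for i
    proof (cases "U i = UNIV")
      case False
      have "\<bar>x i - a i\<bar> \<le> s"
      proof (cases "i < n")
        case True then show ?thesis using norm1_component [OF True, of "\<lambda>i. x i - a i"] x(2) by simp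
      next
        case False then show ?thesis using x0 a0 s by simp
      qed
      then show ?thesis using sr [OF False] r(2) by (meson order_trans)
    qed simp
    then have "x \<in> O'" using U(4) by (auto simp: PiE_def)
    then show ?thesis using O'(2) x0 by blast
  qed
  then show ?thesis using s by blast
qed

text \<open>The coordinates that \<open>prod_atlas\<close> gives to a pair of points.\<close>

definition pair_coords :: "nat \<Rightarrow> (nat \<Rightarrow> real) \<Rightarrow> (nat \<Rightarrow> real) \<Rightarrow> nat \<Rightarrow> real" where
  "pair_coords n w y = (\<lambda>i. if i < n then w i else y (i - n))"

lemma norm1_pair_coords:
  "norm1 (n + n) (\<lambda>i. pair_coords n w y i - pair_coords n w' y' i) =
     norm1 n (\<lambda>i. w i - w' i) + norm1 n (\<lambda>i. y i - y' i)"
proof -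
  have "(\<Sum>i<n + n. \<bar>pair_coords n w y i - pair_coords n w' y' i\<bar>) =
      (\<Sum>i<n. \<bar>pair_coords n w y i - pair_coords n w' y' i\<bar>) +
      (\<Sum>i<n. \<bar>pair_coords n w y (i + n) - pair_coords n w' y' (i + n)\<bar>)"
    (is "?l = ?r1 + ?r2")
  proof -
    let ?f = "\<lambda>i. \<bar>pair_coords n w y i - pair_coords n w' y' i\<bar>"
    have "?l = sum ?f {0..<n} + sum ?f {n..<n + n}"
      by (simp add: lessThan_atLeast0 sum.atLeastLessThan_concat)
    also have "sum ?f {n..<n + n} = (\<Sum>i = 0..<n. ?f (i + n))"
      using sum.shift_bounds_nat_ivl [of ?f 0 n n] by simp
    finally show ?thesis by (simp only: lessThan_atLeast0)
  qed
  then show ?thesis by (simp add: norm1_def pair_coords_def)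
qed

lemma pair_coords_upd: "i < n \<Longrightarrow> (pair_coords n w y)(n + i := t) = pair_coords n w (y(i := t))"
  by (auto simp: pair_coords_def fun_eq_iff)

lemma pair_coords_in:
  "w \<in> topspace (Euclidean_space n) \<Longrightarrow> y \<in> topspace (Euclidean_space n) \<Longrightarrow>
    pair_coords n w y \<in> topspace (Euclidean_space (n + n))"
  by (auto simp: topspace_Euclidean_space pair_coords_def)

lemma pair_coords_inj:
  assumes "w \<in> topspace (Euclidean_space n)" "w' \<in> topspace (Euclidean_space n)"
    and eq: "pair_coords n w y = pair_coords n w' y'"
  shows "w = w' \<and> y = y'"
proof
  have "w i = w' i" for i
    using fun_cong [OF eq, of i] assms(1,2) by (cases "i < n") (auto simp: pair_coords_def topspace_Euclidean_space)
  then show "w = w'" by blast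
  have "y i = y' i" for i using fun_cong [OF eq, of "i + n"] by (simp add: pair_coords_def)
  then show "y = y'" by blast
qed

text \<open>The segment from \<open>y'\<close> to \<open>y\<close> is replaced by a path along the coordinate axes, which may leave the
  ball of radius \<open>r\<close> but not the one of radius \<open>2 * r\<close>.\<close>

lemma coordinatewise_Lipschitz:
  fixes F :: "(nat \<Rightarrow> real) \<Rightarrow> real" and a :: "nat \<Rightarrow> real"
  assumes der: "\<And>q i. i < n \<Longrightarrow> q \<in> topspace (Euclidean_space n) \<Longrightarrow> norm1 n (\<lambda>i. q i - a i) \<le> 2 * r \<Longrightarrow>
      ((\<lambda>t. F (q(i := t))) has_field_derivative F' i q) (at (q i)) \<and> \<bar>F' i q\<bar> \<le> \<eta>"
    and y: "y \<in> topspace (Euclidean_space n)" "norm1 n (\<lambda>i. y i - a i) \<le> r"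
      "y' \<in> topspace (Euclidean_space n)" "norm1 n (\<lambda>i. y' i - a i) \<le> r"
  shows "\<bar>F y - F y'\<bar> \<le> \<eta> * norm1 n (\<lambda>i. y i - y' i)"
proof -
  define q where "q k = (\<lambda>i. if i < k then y i else y' i)" for k
  have step: "\<bar>F (q (Suc k)) - F (q k)\<bar> \<le> \<eta> * \<bar>y k - y' k\<bar>" if k: "k < n" for k
  proof -
    define p where "p t = (q k)(k := t)" for t
    have p: "p (y k) = q (Suc k)" "p (y' k) = q k" by (auto simp: p_def q_def fun_eq_iff)
    let ?S = "closed_segment (y k) (y' k)"
    have "norm (F (p (y k)) - F (p (y' k))) \<le> \<eta> * norm (y k - y' k)"
    proof (rule field_differentiable_bound [of ?S "\<lambda>t. F (p t)" "\<lambda>t. F' k (p t)"])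
      fix t assume t: "t \<in> ?S"
      have pt: "p t \<in> topspace (Euclidean_space n)"
        using y k by (auto simp: topspace_Euclidean_space p_def q_def)
      have "\<bar>t - a k\<bar> \<le> \<bar>y k - a k\<bar> + \<bar>y' k - a k\<bar>"
        using t by (auto simp: closed_segment_eq_real_ivl split: if_splits)
      then have "\<bar>p t i - a i\<bar> \<le> \<bar>y i - a i\<bar> + \<bar>y' i - a i\<bar>" for i by (auto simp: p_def q_def)
      then have "norm1 n (\<lambda>i. p t i - a i) \<le> norm1 n (\<lambda>i. y i - a i) + norm1 n (\<lambda>i. y' i - a i)"
        unfolding norm1_def sum.distrib [symmetric] by (intro sum_mono)
      then have "norm1 n (\<lambda>i. p t i - a i) \<le> 2 * r" using y by simp
      from der [OF k pt this]
      have d: "((\<lambda>s. F ((p t)(k := s))) has_field_derivative F' k (p t)) (at (p t k))" "\<bar>F' k (p t)\<bar> \<le> \<eta>" by auto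
      have "(p t)(k := s) = p s" "p t k = t" for s by (auto simp: p_def)
      then show "((\<lambda>t. F (p t)) has_field_derivative F' k (p t)) (at t within ?S)"
        using d(1) has_field_derivative_at_within by simp
      show "norm (F' k (p t)) \<le> \<eta>" using d(2) by simp
    qed auto
    then show ?thesis by (simp add: p)
  qed
  have qn: "q n = y" "q 0 = y'" using y by (auto simp: q_def fun_eq_iff topspace_Euclidean_space)
  have "F y - F y' = (\<Sum>k<n. F (q (Suc k)) - F (q k))"
    using sum_lessThan_telescope [of "\<lambda>k. F (q k)" n] qn by simp
  also have "\<bar>\<dots>\<bar> \<le> (\<Sum>k<n. \<bar>F (q (Suc k)) - F (q k)\<bar>)" by (rule sum_abs)
  also have "\<dots> \<le> (\<Sum>k<n. \<eta> * \<bar>y k - y' k\<bar>)" using step by (intro sum_mono) auto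
  also have "\<dots> = \<eta> * norm1 n (\<lambda>i. y i - y' i)" by (simp add: norm1_def sum_distrib_left)
  finally show ?thesis .
qed

text \<open>The constant is 1 + 2: the factor \<kappa> is at most 1, and its slope
  \<open>2 / \<rho>\<close> is multiplied by a vector of norm at most \<rho>. For the latter the
  product rule is applied with the vector of smaller norm; if even that one has norm beyond \<rho>,
  both terms vanish.\<close>

lemma cutoff_Lipschitz:
  fixes z z' :: "nat \<Rightarrow> real"
  assumes \<rho>: "\<rho> > 0"
  defines "\<kappa> \<equiv> \<lambda>s. max 0 (min 1 (2 - 2 * s / \<rho> :: real))"
  shows "norm1 n (\<lambda>i. \<kappa> (norm1 n z) * z i - \<kappa> (norm1 n z') * z' i) \<le> 3 * norm1 n (\<lambda>i. z i - z' i)"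
proof -
  have nn: "\<bar>norm1 n z - norm1 n z'\<bar> \<le> norm1 n (\<lambda>i. z i - z' i)" for z z'
    using norm1_triangle [of n "\<lambda>i. z i - z' i" z'] norm1_triangle [of n "\<lambda>i. z' i - z i" z] norm1_minus [of n z z']
    by simp
  have lip: "\<bar>\<kappa> s - \<kappa> s'\<bar> \<le> 2 / \<rho> * \<bar>s - s'\<bar>" for s s'
  proof -
    have "\<bar>\<kappa> s - \<kappa> s'\<bar> \<le> \<bar>(2 - 2 * s / \<rho>) - (2 - 2 * s' / \<rho>)\<bar>" unfolding \<kappa>_def by linarith
    also have "\<dots> = \<bar>2 / \<rho> * (s' - s)\<bar>" by (simp add: algebra_simps diff_divide_distrib)
    also have "\<dots> = 2 / \<rho> * \<bar>s - s'\<bar>" 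
      using \<rho> by (simp only: abs_mult abs_minus_commute [of s' s]) simp
    finally show ?thesis .
  qed
  have \<kappa>01: "0 \<le> \<kappa> s" "\<kappa> s \<le> 1" for s by (auto simp: \<kappa>_def)
  have *: "norm1 n (\<lambda>i. \<kappa> (norm1 n z) * z i - \<kappa> (norm1 n z') * z' i) \<le> 3 * norm1 n (\<lambda>i. z i - z' i)"
    if le: "norm1 n z' \<le> norm1 n z" for z z'
  proof (cases "norm1 n z' \<le> \<rho>")
    case True
    let ?D = "norm1 n (\<lambda>i. z i - z' i)"
    have "norm1 n (\<lambda>i. \<kappa> (norm1 n z) * z i - \<kappa> (norm1 n z') * z' i) =
        norm1 n (\<lambda>i. \<kappa> (norm1 n z) * (z i - z' i) + (\<kappa> (norm1 n z) - \<kappa> (norm1 n z')) * z' i)"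
      by (simp add: algebra_simps)
    also have "\<dots> \<le> norm1 n (\<lambda>i. \<kappa> (norm1 n z) * (z i - z' i)) + norm1 n (\<lambda>i. (\<kappa> (norm1 n z) - \<kappa> (norm1 n z')) * z' i)"
      by (rule norm1_triangle)
    also have "\<dots> = \<kappa> (norm1 n z) * ?D + \<bar>\<kappa> (norm1 n z) - \<kappa> (norm1 n z')\<bar> * norm1 n z'"
      using \<kappa>01 by (simp add: norm1_def abs_mult sum_distrib_left)
    also have "\<dots> \<le> 1 * ?D + (2 / \<rho> * ?D) * \<rho>"
    proof (intro add_mono mult_mono \<kappa>01 True)
      have "\<bar>\<kappa> (norm1 n z) - \<kappa> (norm1 n z')\<bar> \<le> 2 / \<rho> * \<bar>norm1 n z - norm1 n z'\<bar>" by (rule lip)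
      also have "\<dots> \<le> 2 / \<rho> * ?D" using nn \<rho> by (intro mult_left_mono) auto
      finally show "\<bar>\<kappa> (norm1 n z) - \<kappa> (norm1 n z')\<bar> \<le> 2 / \<rho> * ?D" .
    qed (use \<rho> in auto)
    also have "\<dots> = 3 * ?D" using \<rho> by simp
    finally show ?thesis .
  next
    case False
    have "\<kappa> s = 0" if "s \<ge> \<rho>" for s
    proof -
      have "2 - 2 * s / \<rho> \<le> 0" using that \<rho> by (simp add: field_simps)
      then show ?thesis by (simp add: \<kappa>_def)
    qed
    then show ?thesis using False le by simp
  qed
  show ?thesis
  proof (cases "norm1 n z' \<le> norm1 n z")
    case True then show ?thesis by (rule *)
  next
    case False
    then have "norm1 n (\<lambda>i. \<kappa> (norm1 n z') * z' i - \<kappa> (norm1 n z) * z i) \<le> 3 * norm1 n (\<lambda>i. z' i - z i)"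
      by (intro *) simp
    then show ?thesis
      using norm1_minus [of n "\<lambda>i. \<kappa> (norm1 n z') * z' i" "\<lambda>i. \<kappa> (norm1 n z) * z i"] norm1_minus [of n z z'] by simp
  qed
qed

locale group_with_chart = compact_metric_group G T d
  for G :: "('g, 'm) monoid_scheme" (structure) and T :: "'g topology" and d :: "'g \<Rightarrow> 'g \<Rightarrow> real" +
  fixes n :: nat and U :: "'g set" and \<phi> :: "'g \<Rightarrow> nat \<Rightarrow> real"
  assumes chart: "is_chart n T (U, \<phi>)" and one_U: "\<one> \<in> U"
    and mult_smooth: "smooth_in_charts (n + n) n (\<lambda>(x, y). x \<otimes> y)
      (U \<times> U, \<lambda>(x, y) i. if i < n then \<phi> x i else \<phi> y (i - n)) (U, \<phi>)"
begin

abbreviation Euc where "Euc \<equiv> topspace (Euclidean_space n)"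

section \<open>The metric compared with a chart at the identity\<close>

definition a where "a = \<phi> \<one>"
definition chi where "chi = inv_into U \<phi>"
definition psi where "psi y = chi (\<lambda>i. a i + y i)"

lemma U_open: "openin T U" and phi_U_open: "openin (Euclidean_space n) (\<phi> ` U)"
  and phi_hom: "homeomorphic_map (subtopology T U) (subtopology (Euclidean_space n) (\<phi> ` U)) \<phi>"
  using chart by (simp_all add: is_chart_def)

lemma U_sub: "U \<subseteq> carrier G"
  using openin_subset [OF U_open] by (simp add: topspace_T)

lemma phi_inj: "inj_on \<phi> U"
  using homeomorphic_imp_injective_map [OF phi_hom] U_sub by (simp add: topspace_T Int_absorb1)

lemma chi_phi [simp]: "x \<in> U \<Longrightarrow> chi (\<phi> x) = x"
  using phi_inj by (simp add: chi_def)

lemma phi_chi [simp]: "z \<in> \<phi> ` U \<Longrightarrow> \<phi> (chi z) = z"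
  by (simp add: chi_def f_inv_into_f)

lemma chi_in: "z \<in> \<phi> ` U \<Longrightarrow> chi z \<in> U"
  by (simp add: chi_def inv_into_into)

lemma phi_in: "x \<in> U \<Longrightarrow> \<phi> x \<in> Euc"
  using openin_subset [OF phi_U_open] by blast

lemma phi_open: "openin T W \<Longrightarrow> openin (Euclidean_space n) (\<phi> ` (W \<inter> U))"
proof -
  assume "openin T W"
  then have "openin (subtopology T U) (W \<inter> U)" by (simp add: openin_subtopology_Int)
  then have "openin (subtopology (Euclidean_space n) (\<phi> ` U)) (\<phi> ` (W \<inter> U))"
    using homeomorphic_map_openness_eq [OF phi_hom] by blast
  then show ?thesis using phi_U_open openin_open_subtopology by blast
qed

lemma chi_near:
  assumes W: "openin T W" "\<one> \<in> W"
  shows "\<exists>r>0. \<forall>z\<in>Euc. norm1 n (\<lambda>i. z i - a i) \<le> r \<longrightarrow> z \<in> \<phi> ` U \<and> chi z \<in> W"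
proof -
  have "a \<in> \<phi> ` (W \<inter> U)" using W one_U by (auto simp: a_def)
  from openin_Euclidean_space_box [OF phi_open [OF W(1)] this]
  obtain r where r: "r > 0" "\<And>z. z \<in> Euc \<Longrightarrow> norm1 n (\<lambda>i. z i - a i) \<le> r \<Longrightarrow> z \<in> \<phi> ` (W \<inter> U)" by blast
  have "z \<in> \<phi> ` U \<and> chi z \<in> W" if "z \<in> Euc" "norm1 n (\<lambda>i. z i - a i) \<le> r" for z
    using r(2) [OF that] by auto
  then show ?thesis using r(1) by blast
qed

lemma phi_coord_cont: "continuous_map (subtopology T U) euclideanreal (\<lambda>g. \<phi> g i)"
proof -
  have "continuous_map (subtopology T U) (powertop_real UNIV) \<phi>"
    using homeomorphic_imp_continuous_map [OF phi_hom]
    by (auto simp: Euclidean_space_def continuous_map_in_subtopology)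
  then show ?thesis unfolding continuous_map_componentwise_UNIV by blast
qed

lemma phi_norm_cont: "continuous_map (subtopology T U) euclideanreal (\<lambda>g. norm1 n (\<lambda>i. \<phi> g i - a i))"
  unfolding norm1_def
  by (intro continuous_map_sum continuous_map_real_abs continuous_map_diff phi_coord_cont) auto

lemma phi_near:
  assumes "r > 0"
  shows "\<exists>\<delta>>0. \<forall>g\<in>carrier G. d \<one> g < \<delta> \<longrightarrow> g \<in> U \<and> norm1 n (\<lambda>i. \<phi> g i - a i) < r"
proof -
  have "openin (subtopology T U) {g \<in> topspace (subtopology T U). norm1 n (\<lambda>i. \<phi> g i - a i) \<in> {..<r}}"
    by (rule openin_continuous_map_preimage [OF phi_norm_cont]) auto
  then have "openin T {g \<in> topspace (subtopology T U). norm1 n (\<lambda>i. \<phi> g i - a i) \<in> {..<r}}"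
    using U_open openin_open_subtopology by blast
  then have "openin MS.mtopology {g \<in> topspace (subtopology T U). norm1 n (\<lambda>i. \<phi> g i - a i) \<in> {..<r}}"
    unfolding mtopology_eq .
  moreover have "\<one> \<in> {g \<in> topspace (subtopology T U). norm1 n (\<lambda>i. \<phi> g i - a i) \<in> {..<r}}"
    using one_U assms by (simp add: topspace_T a_def)
  ultimately obtain \<delta> where \<delta>: "\<delta> > 0" "MS.mball \<one> \<delta> \<subseteq> {g \<in> topspace (subtopology T U). norm1 n (\<lambda>i. \<phi> g i - a i) \<in> {..<r}}"
    unfolding MS.openin_mtopology by blast
  have "g \<in> U \<and> norm1 n (\<lambda>i. \<phi> g i - a i) < r" if "g \<in> carrier G" "d \<one> g < \<delta>" for g
  proof -
    have "g \<in> MS.mball \<one> \<delta>" using that by simp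
    then show ?thesis using \<delta>(2) by auto
  qed
  then show ?thesis using \<delta>(1) by blast
qed

lemma psi_eq: "g \<in> U \<Longrightarrow> g = psi (\<lambda>i. \<phi> g i - a i)"
  by (simp add: psi_def)

lemma shift_in: "y \<in> box1 n r \<Longrightarrow> (\<lambda>i. a i + y i) \<in> Euc"
  using phi_in [OF one_U] by (auto simp: box1_def topspace_Euclidean_space a_def)

lemma unshift_in: "g \<in> U \<Longrightarrow> norm1 n (\<lambda>i. \<phi> g i - a i) \<le> r \<Longrightarrow> (\<lambda>i. \<phi> g i - a i) \<in> box1 n r"
  using phi_in [OF one_U] phi_in [of g] by (auto simp: box1_def topspace_Euclidean_space a_def)

section \<open>The multiplication in coordinates\<close>

definition mm :: "(nat \<Rightarrow> real) \<Rightarrow> (nat \<Rightarrow> real) \<Rightarrow> nat \<Rightarrow> real" where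
  "mm w y = \<phi> (chi w \<otimes> chi y)"

lemma mult_in_U:
  "\<exists>r>0. \<forall>w\<in>Euc. \<forall>y\<in>Euc. norm1 n (\<lambda>i. w i - a i) \<le> r \<longrightarrow> norm1 n (\<lambda>i. y i - a i) \<le> r \<longrightarrow>
     w \<in> \<phi> ` U \<and> y \<in> \<phi> ` U \<and> chi w \<otimes> chi y \<in> U"
proof -
  have m: "continuous_map (prod_topology T T) T (\<lambda>(x, y). x \<otimes> y)"
    using topological_group by (simp add: topological_group_def)
  have "openin (prod_topology T T) {p \<in> topspace (prod_topology T T). (case p of (x, y) \<Rightarrow> x \<otimes> y) \<in> U}"
    using m U_open by (rule openin_continuous_map_preimage)
  moreover have "(\<one>, \<one>) \<in> {p \<in> topspace (prod_topology T T). (case p of (x, y) \<Rightarrow> x \<otimes> y) \<in> U}"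
    using one_U by (simp add: topspace_T)
  ultimately obtain A B where AB: "openin T A" "openin T B" "\<one> \<in> A" "\<one> \<in> B"
    and sub: "A \<times> B \<subseteq> {p \<in> topspace (prod_topology T T). (case p of (x, y) \<Rightarrow> x \<otimes> y) \<in> U}"
    unfolding openin_prod_topology_alt by meson
  obtain r where r: "r > 0" "\<And>z. z \<in> Euc \<Longrightarrow> norm1 n (\<lambda>i. z i - a i) \<le> r \<Longrightarrow> z \<in> \<phi> ` U \<and> chi z \<in> A"
    using chi_near [OF AB(1,3)] by blast
  obtain r' where r': "r' > 0" "\<And>z. z \<in> Euc \<Longrightarrow> norm1 n (\<lambda>i. z i - a i) \<le> r' \<Longrightarrow> z \<in> \<phi> ` U \<and> chi z \<in> B"
    using chi_near [OF AB(2,4)] by blast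
  have "w \<in> \<phi> ` U \<and> y \<in> \<phi> ` U \<and> chi w \<otimes> chi y \<in> U"
    if "w \<in> Euc" "y \<in> Euc" "norm1 n (\<lambda>i. w i - a i) \<le> min r r'" "norm1 n (\<lambda>i. y i - a i) \<le> min r r'" for w y
  proof -
    have *: "w \<in> \<phi> ` U \<and> chi w \<in> A" "y \<in> \<phi> ` U \<and> chi y \<in> B" using r(2) r'(2) that by auto
    then have "(chi w, chi y) \<in> A \<times> B" by simp
    from subsetD [OF sub this] have "chi w \<otimes> chi y \<in> U" by simp
    then show ?thesis using * by simp
  qed
  moreover have "min r r' > 0" using r r' by simp
  ultimately show ?thesis by blast
qed

text \<open>This function and \<open>coord_dom\<close> are spelled exactly as
  \<open>smooth_in_charts\<close> unfolds for the multiplication, so that the smoothness assumption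
  applies literally; \<open>coord_mult_pair\<close> translates them to \<open>mm\<close>.\<close>

definition coord_mult :: "nat \<Rightarrow> (nat \<Rightarrow> real) \<Rightarrow> real" where
  "coord_mult j z = \<phi> (case inv_into (U \<times> U) (\<lambda>(x, y) i. if i < n then \<phi> x i else \<phi> y (i - n)) z of (x, y) \<Rightarrow> x \<otimes> y) j"

definition coord_dom :: "(nat \<Rightarrow> real) set" where
  "coord_dom = (\<lambda>(x, y) i. if i < n then \<phi> x i else \<phi> y (i - n)) ` {p \<in> U \<times> U. (case p of (x, y) \<Rightarrow> x \<otimes> y) \<in> U}"

lemma pair_chart: "(\<lambda>(x, y) i. if i < n then \<phi> x i else \<phi> y (i - n)) = (\<lambda>(x, y). pair_coords n (\<phi> x) (\<phi> y))"
  by (auto simp: pair_coords_def fun_eq_iff)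

lemma coord_mult_pair:
  assumes "w \<in> \<phi> ` U" "y \<in> \<phi> ` U"
  shows "coord_mult j (pair_coords n w y) = mm w y j"
proof -
  have inj: "inj_on (\<lambda>(x, y). pair_coords n (\<phi> x) (\<phi> y)) (U \<times> U)"
  proof (rule inj_onI, clarify)
    fix x y x' y' assume xy: "x \<in> U" "y \<in> U" "x' \<in> U" "y' \<in> U" "pair_coords n (\<phi> x) (\<phi> y) = pair_coords n (\<phi> x') (\<phi> y')"
    then have "\<phi> x = \<phi> x' \<and> \<phi> y = \<phi> y'"
      using pair_coords_inj [OF phi_in phi_in, of x x' "\<phi> y" "\<phi> y'"] by blast
    then show "x = x' \<and> y = y'" using phi_inj xy by (auto dest: inj_onD)
  qed
  have "pair_coords n w y = (\<lambda>(x, y). pair_coords n (\<phi> x) (\<phi> y)) (chi w, chi y)" using assms by simp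
  then have "inv_into (U \<times> U) (\<lambda>(x, y). pair_coords n (\<phi> x) (\<phi> y)) (pair_coords n w y) = (chi w, chi y)"
    using inv_into_f_f [OF inj, of "(chi w, chi y)"] chi_in assms by simp
  then show ?thesis by (simp add: coord_mult_def pair_chart mm_def)
qed

lemma coord_dom_pair:
  assumes "w \<in> \<phi> ` U" "y \<in> \<phi> ` U" "chi w \<otimes> chi y \<in> U"
  shows "pair_coords n w y \<in> coord_dom"
proof -
  have "(chi w, chi y) \<in> {p \<in> U \<times> U. (case p of (x, y) \<Rightarrow> x \<otimes> y) \<in> U}" using assms chi_in by simp
  moreover have "pair_coords n w y = (\<lambda>(x, y). pair_coords n (\<phi> x) (\<phi> y)) (chi w, chi y)" using assms by simp
  ultimately show ?thesis unfolding coord_dom_def pair_chart by blast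
qed

lemma coord_mult_C1:
  assumes "j < n" "i < n + n"
  shows "\<And>z. z \<in> coord_dom \<Longrightarrow> (\<lambda>t. coord_mult j (z(i := t))) field_differentiable at (z i)"
    and "continuous_map (subtopology (Euclidean_space (n + n)) coord_dom) euclideanreal (partial_deriv i (coord_mult j))"
proof -
  have "smooth_on (n + n) coord_dom (coord_mult j)"
    using mult_smooth assms(1) by (simp add: smooth_in_charts_def coord_dom_def coord_mult_def [abs_def])
  then have "Ck_on (Suc 0) (n + n) coord_dom (coord_mult j)" unfolding smooth_on_def by blast
  then show "\<And>z. z \<in> coord_dom \<Longrightarrow> (\<lambda>t. coord_mult j (z(i := t))) field_differentiable at (z i)"
    and "continuous_map (subtopology (Euclidean_space (n + n)) coord_dom) euclideanreal (partial_deriv i (coord_mult j))"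
    using assms(2) by simp_all
qed

lemma a_in: "a \<in> Euc" "a \<in> \<phi> ` U" "chi a = \<one>"
  using phi_in one_U by (auto simp: a_def)

text \<open>Left multiplication by the identity is the identity map, so the partial derivatives in
  the second factor form the unit matrix at \<open>(\<one>, \<one>)\<close>. Continuity of the
  derivatives keeps them \<eta>-close to it nearby.\<close>

lemma mm_derivative:
  assumes \<eta>: "\<eta> > 0"
  shows "\<exists>r>0. \<forall>w\<in>Euc. \<forall>y\<in>Euc. norm1 n (\<lambda>i. w i - a i) \<le> r \<longrightarrow> norm1 n (\<lambda>i. y i - a i) \<le> r \<longrightarrow>
     (w \<in> \<phi> ` U \<and> y \<in> \<phi> ` U \<and> chi w \<otimes> chi y \<in> U) \<and>
     (\<forall>i<n. \<forall>j<n. ((\<lambda>t. mm w (y(i := t)) j) has_field_derivative partial_deriv (n + i) (coord_mult j) (pair_coords n w y)) (at (y i)) \<and>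
        \<bar>partial_deriv (n + i) (coord_mult j) (pair_coords n w y) - (if i = j then 1 else 0)\<bar> \<le> \<eta>)"
proof -
  obtain r0 where r0: "r0 > 0" "\<And>w y. w \<in> Euc \<Longrightarrow> y \<in> Euc \<Longrightarrow> norm1 n (\<lambda>i. w i - a i) \<le> r0 \<Longrightarrow> norm1 n (\<lambda>i. y i - a i) \<le> r0 \<Longrightarrow>
     w \<in> \<phi> ` U \<and> y \<in> \<phi> ` U \<and> chi w \<otimes> chi y \<in> U" using mult_in_U by blast
  have der: "((\<lambda>t. mm w (y(i := t)) j) has_field_derivative partial_deriv (n + i) (coord_mult j) (pair_coords n w y)) (at (y i))"
    if w: "w \<in> Euc" "norm1 n (\<lambda>i. w i - a i) \<le> r0" and y: "y \<in> Euc" "norm1 n (\<lambda>i. y i - a i) < r0" and ij: "i < n" "j < n" for w y i j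
  proof -
    have wy: "w \<in> \<phi> ` U" "y \<in> \<phi> ` U" "chi w \<otimes> chi y \<in> U" using r0(2) w y by auto
    let ?z = "pair_coords n w y"
    have zi: "?z (n + i) = y i" by (simp add: pair_coords_def)
    have "(\<lambda>t. coord_mult j (?z(n + i := t))) field_differentiable at (?z (n + i))"
      using coord_mult_C1(1) [OF ij(2) _ coord_dom_pair [OF wy], of "n + i"] ij by simp
    then have D: "((\<lambda>t. coord_mult j (pair_coords n w (y(i := t)))) has_field_derivative partial_deriv (n + i) (coord_mult j) ?z) (at (y i))"
      unfolding partial_deriv_def field_differentiable_derivI zi pair_coords_upd [OF ij(1)]
      by (rule field_differentiable_derivI)
    \<comment> \<open>Smoothness concerns \<open>coord_mult\<close>, which agrees with
      \<open>mm\<close> only while the varied point stays in the chart. This radius guarantees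
      it.\<close>
    let ?e = "r0 - norm1 n (\<lambda>i. y i - a i)"
    show ?thesis
    proof (rule has_field_derivative_transform_within_open [OF D, of "ball (y i) ?e"])
      show "y i \<in> ball (y i) ?e" using y by simp
      fix t assume t: "t \<in> ball (y i) ?e"
      have yt: "y(i := t) \<in> Euc" using y(1) ij by (simp add: topspace_Euclidean_space)
      have "norm1 n (\<lambda>k. (y(i := t)) k - a k) \<le> norm1 n (\<lambda>k. (y(i := t)) k - y k) + norm1 n (\<lambda>k. y k - a k)"
        by (rule norm1_triangle_diff)
      also have "norm1 n (\<lambda>k. (y(i := t)) k - y k) = \<bar>t - y i\<bar>"
      proof -
        have "norm1 n (\<lambda>k. (y(i := t)) k - y k) = (\<Sum>k<n. if k = i then \<bar>t - y i\<bar> else 0)"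
          unfolding norm1_def by (rule sum.cong) auto
        then show ?thesis using ij by simp
      qed
      also have "\<bar>t - y i\<bar> + norm1 n (\<lambda>k. y k - a k) \<le> r0" using t by (simp add: dist_real_def)
      finally have "y(i := t) \<in> \<phi> ` U" using r0(2) [OF w(1) yt w(2)] by simp
      then show "coord_mult j (pair_coords n w (y(i := t))) = mm w (y(i := t)) j"
        by (rule coord_mult_pair [OF wy(1)])
    qed simp
  qed
  let ?p = "pair_coords n a a"
  have p_val: "partial_deriv (n + i) (coord_mult j) ?p = (if i = j then 1 else 0)" if ij: "i < n" "j < n" for i j
  proof -
    have "((\<lambda>t. mm a (a(i := t)) j) has_field_derivative partial_deriv (n + i) (coord_mult j) ?p) (at (a i))"
      using der [OF a_in(1) _ a_in(1) _ ij] r0(1) by simp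
    moreover have "((\<lambda>t. mm a (a(i := t)) j) has_field_derivative (if i = j then 1 else 0)) (at (a i))"
    proof (rule has_field_derivative_transform_within_open [of "\<lambda>t. (a(i := t)) j" _ _ "ball (a i) r0"])
      show "((\<lambda>t. (a(i := t)) j) has_field_derivative (if i = j then 1 else 0)) (at (a i))"
        by (cases "i = j") (auto intro!: derivative_eq_intros)
      fix t assume t: "t \<in> ball (a i) r0"
      have at: "a(i := t) \<in> Euc" using a_in(1) ij by (simp add: topspace_Euclidean_space)
      have "norm1 n (\<lambda>k. (a(i := t)) k - a k) = (\<Sum>k<n. if k = i then \<bar>t - a i\<bar> else 0)"
        unfolding norm1_def by (rule sum.cong) auto
      also have "\<dots> \<le> r0" using t ij by (simp add: dist_real_def)
      finally have atU: "a(i := t) \<in> \<phi> ` U" using r0 a_in at by simp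
      then have "chi (a(i := t)) \<in> carrier G" using chi_in U_sub by blast
      then show "(a(i := t)) j = mm a (a(i := t)) j" using atU a_in by (simp add: mm_def)
    qed (use r0 in auto)
    ultimately show ?thesis by (rule DERIV_unique)
  qed
  have p_dom: "?p \<in> coord_dom" using r0 a_in by (intro coord_dom_pair) (auto simp: one_U)
  have near: "\<exists>r>0. \<forall>z\<in>coord_dom. norm1 (n + n) (\<lambda>k. z k - ?p k) \<le> r \<longrightarrow>
      \<bar>partial_deriv (n + i) (coord_mult j) z - (if i = j then 1 else 0)\<bar> \<le> \<eta>" if ij: "i < n" "j < n" for i j
  proof -
    let ?f = "partial_deriv (n + i) (coord_mult j)" and ?S = "subtopology (Euclidean_space (n + n)) coord_dom"
    have "continuous_map ?S euclideanreal ?f" using coord_mult_C1(2) [of j "n + i"] ij by simp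
    then have "openin ?S {z \<in> topspace ?S. ?f z \<in> ball (?f ?p) \<eta>}"
      by (rule openin_continuous_map_preimage) simp
    then obtain O' where O': "openin (Euclidean_space (n + n)) O'" "{z \<in> topspace ?S. ?f z \<in> ball (?f ?p) \<eta>} = O' \<inter> coord_dom"
      unfolding openin_subtopology by blast
    have pE: "?p \<in> topspace (Euclidean_space (n + n))" using a_in by (intro pair_coords_in)
    then have "?p \<in> {z \<in> topspace ?S. ?f z \<in> ball (?f ?p) \<eta>}" using p_dom \<eta> by simp
    then have "?p \<in> O'" using O'(2) by blast
    from openin_Euclidean_space_box [OF O'(1) this] obtain r where r: "r > 0"
      "\<And>x. x \<in> topspace (Euclidean_space (n + n)) \<Longrightarrow> norm1 (n + n) (\<lambda>k. x k - ?p k) \<le> r \<Longrightarrow> x \<in> O'" by blast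
    have "\<bar>?f z - (if i = j then 1 else 0)\<bar> \<le> \<eta>" if z: "z \<in> coord_dom" "norm1 (n + n) (\<lambda>k. z k - ?p k) \<le> r" for z
    proof -
      have "z \<in> topspace (Euclidean_space (n + n))"
        using z(1) phi_in unfolding coord_dom_def pair_chart by (auto intro!: pair_coords_in)
      then have "z \<in> O' \<inter> coord_dom" using r(2) z by blast
      then have "?f z \<in> ball (?f ?p) \<eta>" using O'(2) by blast
      then show ?thesis unfolding p_val [OF ij] by (simp add: dist_real_def abs_minus_commute)
    qed
    then show ?thesis using r(1) by blast
  qed
  then obtain r1 where r1: "\<And>i j. i < n \<Longrightarrow> j < n \<Longrightarrow> r1 i j > 0 \<and> (\<forall>z\<in>coord_dom. norm1 (n + n) (\<lambda>k. z k - ?p k) \<le> r1 i j \<longrightarrow>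
      \<bar>partial_deriv (n + i) (coord_mult j) z - (if i = j then 1 else 0)\<bar> \<le> \<eta>)" by metis
  define s where "s = Min (insert r0 ((\<lambda>(i, j). r1 i j) ` ({..<n} \<times> {..<n})))"
  have s: "s > 0" "s \<le> r0" using r1 r0 by (auto simp: s_def)
  have sr: "s \<le> r1 i j" if "i < n" "j < n" for i j
    unfolding s_def using that by (intro Min_le) auto
  show ?thesis
  \<comment> \<open>Half of \<open>s\<close> for each factor, because the norm of the pair is the
    sum of the two norms.\<close>
  proof (intro exI [of _ "s / 2"] conjI ballI impI allI)
    show "s / 2 > 0" using s by simp
    fix w y assume wy: "w \<in> Euc" "y \<in> Euc" "norm1 n (\<lambda>i. w i - a i) \<le> s / 2" "norm1 n (\<lambda>i. y i - a i) \<le> s / 2"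
    then have le: "norm1 n (\<lambda>i. w i - a i) \<le> r0" "norm1 n (\<lambda>i. y i - a i) < r0" using s by auto
    then have *: "w \<in> \<phi> ` U \<and> y \<in> \<phi> ` U \<and> chi w \<otimes> chi y \<in> U" using r0(2) wy by auto
    then show "w \<in> \<phi> ` U" "y \<in> \<phi> ` U" "chi w \<otimes> chi y \<in> U" by auto
    fix i j assume ij: "i < n" "j < n"
    show "((\<lambda>t. mm w (y(i := t)) j) has_field_derivative partial_deriv (n + i) (coord_mult j) (pair_coords n w y)) (at (y i))"
      using der wy le ij by blast
    have "pair_coords n w y \<in> coord_dom" using * coord_dom_pair by blast
    moreover have "norm1 (n + n) (\<lambda>k. pair_coords n w y k - ?p k) \<le> r1 i j"
      using wy sr [OF ij] by (simp add: norm1_pair_coords)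
    ultimately show "\<bar>partial_deriv (n + i) (coord_mult j) (pair_coords n w y) - (if i = j then 1 else 0)\<bar> \<le> \<eta>"
      using r1 [OF ij] by blast
  qed
qed

text \<open>The difference \<open>mm w y j - y j\<close> has partial derivatives of size at most
  \<eta>, so \<open>coordinatewise_Lipschitz\<close> bounds each coordinate. The radius is halved
  because the path used there may go twice as far from the centre.\<close>

lemma mm_Lipschitz:
  "\<exists>r>0. \<forall>w\<in>Euc. \<forall>y\<in>Euc. \<forall>y'\<in>Euc. norm1 n (\<lambda>i. w i - a i) \<le> r \<longrightarrow> norm1 n (\<lambda>i. y i - a i) \<le> r \<longrightarrow>
     norm1 n (\<lambda>i. y' i - a i) \<le> r \<longrightarrow>
     (w \<in> \<phi> ` U \<and> y \<in> \<phi> ` U \<and> chi w \<otimes> chi y \<in> U) \<and>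
     norm1 n (\<lambda>i. mm w y i - mm w y' i - (y i - y' i)) \<le> norm1 n (\<lambda>i. y i - y' i) / 4"
proof -
  \<comment> \<open>Adding up \<open>n\<close> coordinates gives the factor
    \<open>n * \<eta>\<close>, which is at most 1/4; the summand 1 covers
    \<open>n = 0\<close>.\<close>
  define \<eta> where "\<eta> = 1 / (4 * (real n + 1))"
  have "\<eta> > 0" by (simp add: \<eta>_def)
  from mm_derivative [OF this] obtain r where r: "r > 0"
    and A: "\<And>w y. w \<in> Euc \<Longrightarrow> y \<in> Euc \<Longrightarrow> norm1 n (\<lambda>i. w i - a i) \<le> r \<Longrightarrow> norm1 n (\<lambda>i. y i - a i) \<le> r \<Longrightarrow>
     (w \<in> \<phi> ` U \<and> y \<in> \<phi> ` U \<and> chi w \<otimes> chi y \<in> U) \<and>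
     (\<forall>i<n. \<forall>j<n. ((\<lambda>t. mm w (y(i := t)) j) has_field_derivative partial_deriv (n + i) (coord_mult j) (pair_coords n w y)) (at (y i)) \<and>
        \<bar>partial_deriv (n + i) (coord_mult j) (pair_coords n w y) - (if i = j then 1 else 0)\<bar> \<le> \<eta>)" by blast
  have "norm1 n (\<lambda>i. mm w y i - mm w y' i - (y i - y' i)) \<le> norm1 n (\<lambda>i. y i - y' i) / 4"
    if w: "w \<in> Euc" "norm1 n (\<lambda>i. w i - a i) \<le> r/2" and y: "y \<in> Euc" "norm1 n (\<lambda>i. y i - a i) \<le> r/2"
      "y' \<in> Euc" "norm1 n (\<lambda>i. y' i - a i) \<le> r/2" for w y y'
  proof -
    have comp: "\<bar>mm w y j - mm w y' j - (y j - y' j)\<bar> \<le> \<eta> * norm1 n (\<lambda>i. y i - y' i)" if j: "j < n" for j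
    proof -
      have "\<bar>(mm w y j - y j) - (mm w y' j - y' j)\<bar> \<le> \<eta> * norm1 n (\<lambda>i. y i - y' i)"
      proof (rule coordinatewise_Lipschitz [where r = "r/2" and a = a and F = "\<lambda>q. mm w q j - q j"
            and F' = "\<lambda>i q. partial_deriv (n + i) (coord_mult j) (pair_coords n w q) - (if i = j then 1 else 0)"])
        fix q i assume q: "i < n" "q \<in> Euc" "norm1 n (\<lambda>i. q i - a i) \<le> 2 * (r/2)"
        let ?D = "partial_deriv (n + i) (coord_mult j) (pair_coords n w q)"
        have D: "((\<lambda>t. mm w (q(i := t)) j) has_field_derivative ?D) (at (q i))" "\<bar>?D - (if i = j then 1 else 0)\<bar> \<le> \<eta>"
          using A [OF w(1) q(2)] w q j r by auto
        have "((\<lambda>t. (q(i := t)) j) has_field_derivative (if i = j then 1 else 0)) (at (q i))"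
          by (cases "i = j") (auto intro!: derivative_eq_intros)
        from DERIV_diff [OF D(1) this]
        show "((\<lambda>t. mm w (q(i := t)) j - (q(i := t)) j) has_field_derivative ?D - (if i = j then 1 else 0)) (at (q i)) \<and>
            \<bar>?D - (if i = j then 1 else 0)\<bar> \<le> \<eta>" using D(2) by blast
      qed (use y in auto)
      then show ?thesis by (simp add: algebra_simps)
    qed
    have "norm1 n (\<lambda>i. mm w y i - mm w y' i - (y i - y' i)) \<le> (\<Sum>j<n. \<eta> * norm1 n (\<lambda>i. y i - y' i))"
      unfolding norm1_def [of n "\<lambda>i. mm w y i - mm w y' i - (y i - y' i)"] using comp by (intro sum_mono) auto
    also have "\<dots> = (real n * \<eta>) * norm1 n (\<lambda>i. y i - y' i)" by simp
    also have "\<dots> \<le> 1/4 * norm1 n (\<lambda>i. y i - y' i)"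
      by (intro mult_right_mono) (simp_all add: \<eta>_def field_simps)
    finally show ?thesis by simp
  qed
  moreover have "w \<in> \<phi> ` U \<and> y \<in> \<phi> ` U \<and> chi w \<otimes> chi y \<in> U"
    if "w \<in> Euc" "norm1 n (\<lambda>i. w i - a i) \<le> r/2" "y \<in> Euc" "norm1 n (\<lambda>i. y i - a i) \<le> r/2" for w y
    using A [OF that(1,3)] that r by auto
  moreover have "r / 2 > 0" using r by simp
  ultimately show ?thesis by blast
qed

text \<open>There are three regimes for \<open>x\<close>. Within \<open>\<delta>W\<close> of the
  identity the cut-off factor is 1 at both products, and \<open>v\<close> inherits the estimate for
  \<open>mm\<close>. Within \<open>2 * \<delta>0\<close> the chart is still available, and the
  cut-off multiplies the factor 5/4 by 3, which is below \<open>C = 4\<close>. Farther away both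
  values of \<open>v\<close> are 0. The radii are chosen in the order in which these regimes require
  them.\<close>

theorem ex_compact_group_chart:
  "\<exists>R \<psi> v \<delta>W C. compact_group_chart G T d n R \<psi> v \<delta>W C"
proof -
  obtain r where r: "r > 0"
    and rU: "\<And>w y. w \<in> Euc \<Longrightarrow> y \<in> Euc \<Longrightarrow> norm1 n (\<lambda>i. w i - a i) \<le> r \<Longrightarrow> norm1 n (\<lambda>i. y i - a i) \<le> r \<Longrightarrow>
       w \<in> \<phi> ` U \<and> y \<in> \<phi> ` U \<and> chi w \<otimes> chi y \<in> U"
    and rL: "\<And>w y y'. w \<in> Euc \<Longrightarrow> y \<in> Euc \<Longrightarrow> y' \<in> Euc \<Longrightarrow> norm1 n (\<lambda>i. w i - a i) \<le> r \<Longrightarrow>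
       norm1 n (\<lambda>i. y i - a i) \<le> r \<Longrightarrow> norm1 n (\<lambda>i. y' i - a i) \<le> r \<Longrightarrow>
       norm1 n (\<lambda>i. mm w y i - mm w y' i - (y i - y' i)) \<le> norm1 n (\<lambda>i. y i - y' i) / 4"
    using mm_Lipschitz by blast
  \<comment> \<open>The factor 2 leaves a margin: the support of \<open>v\<close> will lie in the
    ball of radius \<open>\<delta>0\<close>, and a factor \<open>psi y\<close> moves a point by less
    than another \<open>\<delta>0\<close>.\<close>
  obtain \<delta>0 where \<delta>0: "\<delta>0 > 0" "\<And>g. g \<in> carrier G \<Longrightarrow> d \<one> g < 2 * \<delta>0 \<Longrightarrow> g \<in> U \<and> norm1 n (\<lambda>i. \<phi> g i - a i) < r"
  proof -
    obtain \<delta> where "\<delta> > 0" "\<forall>g\<in>carrier G. d \<one> g < \<delta> \<longrightarrow> g \<in> U \<and> norm1 n (\<lambda>i. \<phi> g i - a i) < r"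
      using phi_near [OF r] by blast
    then show thesis by (intro that [of "\<delta> / 2"]) auto
  qed
  have ball_open: "openin T (MS.mball \<one> e)" for e using MS.openin_mball by (simp only: mtopology_eq)
  have chi_ball: "\<exists>s>0. \<forall>z\<in>Euc. norm1 n (\<lambda>i. z i - a i) \<le> s \<longrightarrow> z \<in> \<phi> ` U \<and> d \<one> (chi z) < e" if "e > 0" for e
    using chi_near [OF ball_open, of e] that by auto
  \<comment> \<open>The cut-off vanishes from norm \<rho> on, which confines the support of
    \<open>v\<close> to the ball of radius \<open>\<delta>0\<close>.\<close>
  obtain \<rho> where \<rho>: "\<rho> > 0" "\<And>z. z \<in> Euc \<Longrightarrow> norm1 n (\<lambda>i. z i - a i) \<le> \<rho> \<Longrightarrow> z \<in> \<phi> ` U \<and> d \<one> (chi z) < \<delta>0"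
    using chi_ball [OF \<delta>0(1)] by blast
  \<comment> \<open>Within \<open>\<delta>1\<close> of the identity the norm is below \<rho>/2,
    where the cut-off is 1.\<close>
  obtain \<delta>1 where \<delta>1: "\<delta>1 > 0" "\<And>g. g \<in> carrier G \<Longrightarrow> d \<one> g < \<delta>1 \<Longrightarrow> g \<in> U \<and> norm1 n (\<lambda>i. \<phi> g i - a i) < \<rho> / 2"
    using phi_near [of "\<rho> / 2"] \<rho>(1) by auto
  \<comment> \<open>\<open>\<delta>1 / 2\<close> is the share of \<open>psi y\<close>; the other
    half is left to \<open>x\<close>, so that their product stays within
    \<open>\<delta>1\<close>.\<close>
  obtain s where s: "s > 0" "\<And>z. z \<in> Euc \<Longrightarrow> norm1 n (\<lambda>i. z i - a i) \<le> s \<Longrightarrow> z \<in> \<phi> ` U \<and> d \<one> (chi z) < min \<delta>0 (\<delta>1 / 2)"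
    using chi_ball [of "min \<delta>0 (\<delta>1 / 2)"] \<delta>0(1) \<delta>1(1) by auto
  define R where "R = min r s"
  have R: "R > 0" "R \<le> r" "R \<le> s" using r s by (auto simp: R_def)
  define \<kappa> where "\<kappa> = (\<lambda>s. max 0 (min 1 (2 - 2 * s / \<rho>)) :: real)"
  define cut where "cut z = (\<lambda>i. \<kappa> (norm1 n z) * z i)" for z :: "nat \<Rightarrow> real"
  define v where "v g = (if g \<in> U then cut (\<lambda>i. \<phi> g i - a i) else (\<lambda>_. 0))" for g
  define \<delta>W where "\<delta>W = min \<delta>0 (\<delta>1 / 2)"
  have \<kappa>0: "\<kappa> t = 0" if "t \<ge> \<rho>" for t
  proof -
    have "2 - 2 * t / \<rho> \<le> 0" using that \<rho>(1) by (simp add: field_simps)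
    then show ?thesis by (simp add: \<kappa>_def)
  qed
  have \<kappa>1: "\<kappa> t = 1" if "t \<le> \<rho> / 2" for t
  proof -
    have "2 - 2 * t / \<rho> \<ge> 1" using that \<rho>(1) by (simp add: field_simps)
    then show ?thesis by (simp add: \<kappa>_def)
  qed
  have box: "(\<lambda>i. a i + y i) \<in> Euc" "norm1 n (\<lambda>i. (a i + y i) - a i) \<le> R" "(\<lambda>i. a i + y i) \<in> \<phi> ` U"
    "psi y \<in> U" "psi y \<in> carrier G" "d \<one> (psi y) < \<delta>0" "d \<one> (psi y) < \<delta>1 / 2" if y: "y \<in> box1 n R" for y
  proof -
    show 1: "(\<lambda>i. a i + y i) \<in> Euc" using shift_in [OF y] .
    show 2: "norm1 n (\<lambda>i. (a i + y i) - a i) \<le> R" using y by (simp add: box1_def)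
    then have 3: "(\<lambda>i. a i + y i) \<in> \<phi> ` U \<and> d \<one> (chi (\<lambda>i. a i + y i)) < min \<delta>0 (\<delta>1 / 2)" using s(2) 1 R by simp
    then show "(\<lambda>i. a i + y i) \<in> \<phi> ` U" "psi y \<in> U" "d \<one> (psi y) < \<delta>0" "d \<one> (psi y) < \<delta>1 / 2"
      using chi_in by (simp_all add: psi_def)
    then show "psi y \<in> carrier G" using U_sub by blast
  qed
  have v_supp: "d \<one> g < \<delta>0" if g: "g \<in> carrier G" and "v g \<noteq> (\<lambda>_. 0)" for g
  proof -
    have gU: "g \<in> U" using that by (auto simp: v_def)
    have "\<kappa> (norm1 n (\<lambda>i. \<phi> g i - a i)) \<noteq> 0" using that gU by (auto simp: v_def cut_def)
    then have "norm1 n (\<lambda>i. \<phi> g i - a i) \<le> \<rho>" using \<kappa>0 by (meson linear)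
    then show ?thesis using \<rho>(2) [OF phi_in [OF gU]] gU by simp
  qed
  have d_shift: "d \<one> (x \<otimes> g) \<le> d \<one> x + d \<one> g" "d \<one> x \<le> d \<one> (x \<otimes> g) + d \<one> g" if xg: "x \<in> carrier G" "g \<in> carrier G" for x g
  proof -
    have "d x (x \<otimes> g) = d \<one> g" using d_left [of x \<one> g] xg by simp
    then show "d \<one> (x \<otimes> g) \<le> d \<one> x + d \<one> g" "d \<one> x \<le> d \<one> (x \<otimes> g) + d \<one> g"
      using MS.triangle [of \<one> x "x \<otimes> g"] MS.triangle' [of \<one> "x \<otimes> g" x] MS.commute xg by auto
  qed
  have chart_x: "x \<otimes> psi y \<in> U \<and> (\<lambda>i. \<phi> (x \<otimes> psi y) i) = mm (\<phi> x) (\<lambda>i. a i + y i) \<and> \<phi> x \<in> Euc \<and> norm1 n (\<lambda>i. \<phi> x i - a i) \<le> r"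
    if x: "x \<in> carrier G" "d \<one> x < 2 * \<delta>0" and y: "y \<in> box1 n R" for x y
  proof -
    have xU: "x \<in> U" "norm1 n (\<lambda>i. \<phi> x i - a i) \<le> r" using \<delta>0(2) [OF x] by auto
    have "chi (\<phi> x) \<otimes> chi (\<lambda>i. a i + y i) \<in> U"
      using rU [OF phi_in [OF xU(1)] box(1) [OF y] xU(2)] box(2) [OF y] R by simp
    then show ?thesis using xU phi_in by (simp add: psi_def mm_def)
  qed
  have mm_L: "norm1 n (\<lambda>i. mm (\<phi> x) (\<lambda>i. a i + y i) i - mm (\<phi> x) (\<lambda>i. a i + y' i) i - (y i - y' i)) \<le> norm1 n (\<lambda>i. y i - y' i) / 4"
    if x: "x \<in> carrier G" "d \<one> x < 2 * \<delta>0" and y: "y \<in> box1 n R" "y' \<in> box1 n R" for x y y'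
    using rL [of "\<phi> x" "\<lambda>i. a i + y i" "\<lambda>i. a i + y' i"] chart_x [OF x y(1)] box(1,2) [OF y(1)] box(1,2) [OF y(2)] R by simp
  have "compact_group_chart G T d n R psi v \<delta>W 4"
  proof
    show "R > 0" by (rule R)
    show "psi y \<in> carrier G" if "y \<in> box1 n R" for y using box(5) [OF that] .
    show "psi (\<lambda>_. 0) = \<one>" using a_in by (simp add: psi_def)
    show "\<exists>\<delta>>0. \<forall>g\<in>carrier G. d \<one> g < \<delta> \<longrightarrow> g \<in> psi ` box1 n R"
    proof -
      obtain \<delta> where \<delta>: "\<delta> > 0" "\<And>g. g \<in> carrier G \<Longrightarrow> d \<one> g < \<delta> \<Longrightarrow> g \<in> U \<and> norm1 n (\<lambda>i. \<phi> g i - a i) < R"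
        using phi_near [OF R(1)] by blast
      have "g \<in> psi ` box1 n R" if "g \<in> carrier G" "d \<one> g < \<delta>" for g
      proof -
        have "g \<in> U" "norm1 n (\<lambda>i. \<phi> g i - a i) \<le> R" using \<delta>(2) [OF that] by auto
        then show ?thesis using psi_eq [of g] unshift_in [of g R] by (intro image_eqI)
      qed
      then show ?thesis using \<delta>(1) by blast
    qed
    show "\<exists>r>0. r \<le> R \<and> (\<forall>y\<in>box1 n r. d \<one> (psi y) < \<delta>)" if "\<delta> > 0" for \<delta>
    proof -
      obtain s where s: "s > 0" "\<And>z. z \<in> Euc \<Longrightarrow> norm1 n (\<lambda>i. z i - a i) \<le> s \<Longrightarrow> z \<in> \<phi> ` U \<and> d \<one> (chi z) < \<delta>"
        using chi_ball [OF \<open>\<delta> > 0\<close>] by blast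
      have "d \<one> (psi y) < \<delta>" if y: "y \<in> box1 n (min R s)" for y
        using s(2) [OF shift_in [OF y]] y by (simp add: psi_def box1_def)
      then show ?thesis using s(1) R(1) by (intro exI [of _ "min R s"]) auto
    qed
    show "continuous_map T euclideanreal (\<lambda>g. v g i)" if "i < n" for i
    proof (rule continuous_map_local)
      fix g assume g: "g \<in> topspace T"
      show "\<exists>W. openin T W \<and> g \<in> W \<and> continuous_map (subtopology T W) euclideanreal (\<lambda>g. v g i)"
      proof (cases "g \<in> U")
        case True
        have "continuous_map (subtopology T U) euclideanreal
            (\<lambda>g. max 0 (min 1 (2 - 2 * norm1 n (\<lambda>i. \<phi> g i - a i) / \<rho>)) * (\<phi> g i - a i))"
          using \<rho>(1) by (intro continuous_intros phi_norm_cont phi_coord_cont continuous_map_real_divide) auto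
        then have "continuous_map (subtopology T U) euclideanreal (\<lambda>g. v g i)"
          by (rule continuous_map_eq) (auto simp: v_def cut_def \<kappa>_def)
        then show ?thesis using True U_open by blast
      next
        case False
        \<comment> \<open>A point outside \<open>U\<close> has distance at least
          \<open>2 * \<delta>0\<close> from the identity, whereas \<open>v\<close> vanishes outside
          the ball of radius \<open>\<delta>0\<close>. So \<open>v\<close> is 0 on this whole
          neighbourhood, and extending it by 0 is continuous.\<close>
        let ?W = "topspace T - MS.mcball \<one> \<delta>0"
        have W: "openin T ?W" using MS.closedin_mcball unfolding mtopology_eq by blast
        have "continuous_map (subtopology T ?W) euclideanreal (\<lambda>g. 0)" by simp
        then have "continuous_map (subtopology T ?W) euclideanreal (\<lambda>g. v g i)"
        proof (rule continuous_map_eq)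
          fix h assume "h \<in> topspace (subtopology T ?W)"
          then have "h \<in> carrier G" "\<not> d \<one> h < \<delta>0" by (auto simp: topspace_T)
          then have "v h = (\<lambda>_. 0)" using v_supp [of h] by blast
          then show "0 = v h i" by simp
        qed
        moreover have "g \<in> ?W"
        proof -
          have "\<not> d \<one> g < 2 * \<delta>0" using \<delta>0(2) [of g] False g by (auto simp: topspace_T)
          then show ?thesis using g \<delta>0(1) by (simp add: topspace_T)
        qed
        ultimately show ?thesis using W by blast
      qed
    qed
    show "v g i = 0" if "i \<ge> n" for g i
      using phi_in [of g] phi_in [OF one_U] that by (auto simp: v_def cut_def a_def topspace_Euclidean_space)
    show "v \<one> i = 0" for i using one_U by (simp add: v_def cut_def a_def)
    show "\<delta>W > 0" using \<delta>0 \<delta>1 by (simp add: \<delta>W_def)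
    show "(4::real) \<ge> 0" by simp
    show "norm1 n (\<lambda>i. v (x \<otimes> psi y) i - v (x \<otimes> psi y') i - (y i - y' i)) \<le> norm1 n (\<lambda>i. y i - y' i) / 4"
      if x: "x \<in> carrier G" "d \<one> x < \<delta>W" and y: "y \<in> box1 n R" "y' \<in> box1 n R" for x y y'
    proof -
      have x2: "d \<one> x < 2 * \<delta>0" "d \<one> x < \<delta>1 / 2" using x(2) \<delta>0(1) by (auto simp: \<delta>W_def)
      have vx: "v (x \<otimes> psi y) = (\<lambda>i. mm (\<phi> x) (\<lambda>i. a i + y i) i - a i)" if y: "y \<in> box1 n R" for y
      proof -
        have xy: "x \<otimes> psi y \<in> carrier G" using x box(5) [OF y] by simp
        have "d \<one> (x \<otimes> psi y) < \<delta>1" using d_shift(1) [OF x(1) box(5) [OF y]] x2 box(7) [OF y] by simp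
        then have "norm1 n (\<lambda>i. \<phi> (x \<otimes> psi y) i - a i) \<le> \<rho> / 2" using \<delta>1(2) [OF xy] by simp
        then have "v (x \<otimes> psi y) = (\<lambda>i. \<phi> (x \<otimes> psi y) i - a i)"
          using chart_x [OF x(1) x2(1) y] \<kappa>1 by (simp add: v_def cut_def)
        then show ?thesis using chart_x [OF x(1) x2(1) y] by (simp add: fun_eq_iff)
      qed
      show ?thesis using mm_L [OF x(1) x2(1) y] by (simp add: vx y)
    qed
    show "norm1 n (\<lambda>i. v (x \<otimes> psi y) i - v (x \<otimes> psi y') i) \<le> 4 * norm1 n (\<lambda>i. y i - y' i)"
      if x: "x \<in> carrier G" and y: "y \<in> box1 n R" "y' \<in> box1 n R" for x y y'
    proof (cases "d \<one> x < 2 * \<delta>0")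
      case True
      let ?m = "\<lambda>y i. mm (\<phi> x) (\<lambda>i. a i + y i) i - a i"
      let ?N = "norm1 n (\<lambda>i. y i - y' i)"
      have vx: "v (x \<otimes> psi y) = cut (?m y)" if "y \<in> box1 n R" for y
      proof -
        have "(\<lambda>i. \<phi> (x \<otimes> psi y) i - a i) = ?m y" using chart_x [OF x True that] by (simp add: fun_eq_iff)
        then show ?thesis using chart_x [OF x True that] by (simp add: v_def)
      qed
      have "norm1 n (\<lambda>i. v (x \<otimes> psi y) i - v (x \<otimes> psi y') i) \<le> 3 * norm1 n (\<lambda>i. ?m y i - ?m y' i)"
        unfolding vx [OF y(1)] vx [OF y(2)] cut_def \<kappa>_def by (rule cutoff_Lipschitz [OF \<rho>(1)])
      also have "norm1 n (\<lambda>i. ?m y i - ?m y' i) \<le> ?N / 4 + ?N"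
        using mm_L [OF x True y] norm1_triangle [of n "\<lambda>i. ?m y i - ?m y' i - (y i - y' i)" "\<lambda>i. y i - y' i"] by simp
      also have "3 * (?N / 4 + ?N) \<le> 4 * ?N" using norm1_nonneg [of n "\<lambda>i. y i - y' i"] by simp
      finally show ?thesis by simp
    next
      case False
      have "v (x \<otimes> psi y) = (\<lambda>_. 0)" if y: "y \<in> box1 n R" for y
      proof (rule ccontr)
        assume "v (x \<otimes> psi y) \<noteq> (\<lambda>_. 0)"
        then have "d \<one> (x \<otimes> psi y) < \<delta>0" using v_supp x box(5) [OF y] by simp
        then show False using d_shift(2) [OF x box(5) [OF y]] box(6) [OF y] False by simp
      qed
      then show ?thesis using y by simp
    qed
  qed
  then show ?thesis by blast
qed

end

lemma (in compact_metric_group) Lie_group_chart: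
  assumes "Lie_group G T"
  shows "\<exists>n R \<psi> v \<delta>W C. compact_group_chart G T d n R \<psi> v \<delta>W C"
proof -
  obtain n A where m: "smooth_manifold n T A"
    and s: "smooth_map (n + n) (prod_topology T T) (prod_atlas n A A) n T A (\<lambda>(x, y). x \<otimes> y)"
    using assms unfolding Lie_group_def by blast
  have "(\<Union>c\<in>A. fst c) = topspace T" using m by (simp add: smooth_manifold_def)
  then obtain c where "c \<in> A" "\<one> \<in> fst c" using topspace_T by blast
  then obtain U \<phi> where c: "(U, \<phi>) \<in> A" "\<one> \<in> U" by (cases c) auto
  have "(U \<times> U, \<lambda>(x, y) i. if i < n then \<phi> x i else \<phi> y (i - n)) \<in> prod_atlas n A A"
    unfolding prod_atlas_def using c(1) by blast
  then have "smooth_in_charts (n + n) n (\<lambda>(x, y). x \<otimes> y)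
      (U \<times> U, \<lambda>(x, y) i. if i < n then \<phi> x i else \<phi> y (i - n)) (U, \<phi>)"
    using s c(1) unfolding smooth_map_def by blast
  moreover have "is_chart n T (U, \<phi>)" using m c(1) unfolding smooth_manifold_def by blast
  ultimately interpret group_with_chart G T d n U \<phi> using c(2) by unfold_locales
  show ?thesis using ex_compact_group_chart by blast
qed

section \<open>The classifying space\<close>

theorem (in mixing_bundle) classifying_space_mixing_bundle:
  assumes B: "paracompact_space B"
  shows "classifying_space TYPE('x) TYPE('p) G T B U"
  unfolding classifying_space_def
proof (intro conjI allI impI)
  show "paracompact_space B" by (rule B)
  show "principal_bundle G T B U" by (rule principal)
  fix X :: "'x topology" assume X: "paracompact_space X"
  fix f f' assume ff: "continuous_map X B f \<and> continuous_map X B f'"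
  show "homotopic_with (\<lambda>_. True) X B f f' \<longleftrightarrow> bundle_iso G (pullback X f U) (pullback X f' U)"
    using homotopic_imp_bundle_iso [OF X] bundle_iso_imp_homotopic ff by blast
next
  fix X :: "'x topology" and P :: "('g, 'p, 'x) gbundle"
  assume "paracompact_space X" "principal_bundle G T X P"
  then show "\<exists>f. continuous_map X B f \<and> bundle_iso G P (pullback X f U)" by (rule classifying_map_exists)
qed

theorem corollary7p11:
  fixes G :: "('g, 'm) monoid_scheme" and T :: "'g topology" and d :: "'g \<Rightarrow> 'g \<Rightarrow> real"
    and \<Omega> :: "'w measure"
  assumes "Lie_group G T" and "compact_space T"
    and "Metric_space (carrier G) d" and "Metric_space.mtopology (carrier G) d = T"
    and "bi_invariant G d"
    and "prob_space \<Omega>" and "standard_borel \<Omega>" and "uncountable (space \<Omega>)" and "nonatomic \<Omega>"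
  shows "classifying_space TYPE('x) TYPE('p) G T (LG_topology G \<Omega> T d) (LG_bundle G \<Omega> T d)"
proof -
  have tg: "top_group G T" using assms(1) by (simp add: Lie_group_def top_group_iff)
  have sc: "second_countable T" using assms(1) unfolding Lie_group_def smooth_manifold_def by blast
  interpret compact_metric_group G T d
    using tg sc assms(2-5) by (simp add: compact_metric_group_def compact_metric_group_axioms_def)
  obtain n R \<psi> v \<delta>W C where chart: "compact_group_chart G T d n R \<psi> v \<delta>W C"
    using Lie_group_chart [OF assms(1)] by blast
  obtain K where K: "K > 0" "\<forall>x\<in>carrier G. \<forall>y\<in>carrier G. d x y \<le> K" using d_bounded by blast
  obtain c where c: "c \<in> borel_measurable \<Omega>" "\<forall>t. 0 \<le> c t \<and> c t \<le> (1::real)"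
    "\<forall>s\<in>{0..1}. measure \<Omega> {t \<in> space \<Omega>. c t \<le> s} = s"
    using uniform_variable_exists [OF assms(6,7,9)] by blast
  interpret random_elements G T d \<Omega> c K
    using compact_metric_group_axioms assms(6) c K by (simp add: random_elements_def random_elements_axioms_def)
  have "principal_bundle G T (LG_topology G \<Omega> T d) (LG_bundle G \<Omega> T d)"
  proof (rule principal_bundle_LG)
    fix e0 assume "e0 \<in> L"
    then obtain k where k: "k \<in> RE" "e0 = cls k" by (rule LE)
    \<comment> \<open>The chart of \<open>G\<close> is fixed once, but the displacement equation is
      set up anew around each representative \<open>k\<close>.\<close>
    interpret charted_random_elements G T d \<Omega> c K n R \<psi> v \<delta>W C k
      using random_elements_axioms chart k(1)
      by (simp add: charted_random_elements_def charted_random_elements_axioms_def)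
    show "\<exists>\<epsilon>>0. \<exists>\<theta>. (\<forall>e\<in>tube \<epsilon> e0. \<theta> e \<in> carrier G) \<and>
      (\<forall>e\<in>tube \<epsilon> e0. \<forall>h\<in>carrier G. \<theta> (act h e) = h \<otimes>\<^bsub>G\<^esub> \<theta> e) \<and>
      continuous_map (subtopology LM.mtopology (tube \<epsilon> e0)) T \<theta>"
      unfolding k(2) by (rule local_equivariant_map)
  qed
  then have pb: "principal_bundle_on G T (LG_topology G \<Omega> T d) (LG_bundle G \<Omega> T d)"
    using tg by (simp add: principal_bundle_on_def principal_bundle_on_axioms_def)
  have total: "btotal (LG_bundle G \<Omega> T d) = LM.mtopology" "bact (LG_bundle G \<Omega> T d) = act"
    by (simp_all add: LG_bundle_def L_topology_eq)
  have "cls (\<lambda>_. \<one>\<^bsub>G\<^esub>) \<in> L" by (intro cls_in RE_const one_closed)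
  then interpret mixing_bundle G T "LG_topology G \<Omega> T d" "LG_bundle G \<Omega> T d" mixL "cls (\<lambda>_. \<one>\<^bsub>G\<^esub>)"
    using pb mixL_continuous
    by (simp add: mixing_bundle_def mixing_bundle_axioms_def total mixL_0 mixL_1 mixL_mixL act_mixL)
  show ?thesis
    by (rule classifying_space_mixing_bundle) (simp add: LG_topology_eq LGM.paracompact_space_mtopology)
qed

end
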